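(* Consider the partial-scan-and-move strategy described in the context, with $\varepsilon>0$, $\eta\in(0,1)$, $\delta\in(0,1)$, $\lambda>0$, $\bar\alpha\in(0,2\pi)$, and integer $m\ge5$, under the field assumption and the noise/motion assumption stated there. Let $$K_{\max}:=\left\lceil\frac{2L\Delta_0}{\eta^2\varepsilon^2}\right\rceil,\qquad \delta_k:=\frac{\delta}{K_{\max}+1}\quad\text{for }k=0,\ldots,K_{\max}.$$ Suppose the scan parameters $(\bar\alpha,m)$ satisfy $$\overline\varrho_m(\bar\alpha,\delta_k)\leq\frac{(1-\eta)\varepsilon}{4}$$ for this choice of $\delta_k$. Then, with probability at least $1-\delta$, every episode stops after at most $m$ measurements and a scan angle no greater than $\bar\alpha<2\pi$, and the algorithm terminates after at most $K_{\max}$ translational moves at a point $p_K$ satisfying $$\|\nabla F(p_K)\|\leq\varepsilon.$$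
   Context: Field assumption: $F:\mathbb{R}^2\to\mathbb{R}$ is $C^3$, has a unique global minimizer $p^\star$, which is its only stationary point; $\{p:F(p)\le F(p_0)\}$ is compact for the initial position $p_0$; there are known constants $G,L,M_3>0$ with $\|\nabla F(p)\|\le G$, $\|\nabla F(p)-\nabla F(\bar p)\|\le L\|p-\bar p\|$, $\|D^3F(p)\|\le M_3$ (operator norm of the trilinear form) for all $p,\bar p\in\mathbb{R}^2$; and $F(p_0)-F(p^\star)\le\Delta_0$ for a known $\Delta_0>0$. Sensing model: write $\varphi(\theta)=[\cos\theta\ \ \sin\theta]^\top$ and let $R(\theta)$ be the counterclockwise rotation matrix. A scalar sensor is mounted at distance $\rho>0$ from the robot center. Motion is organized in episodes $k=0,1,2,\dots$. During the scan of episode $k$ the robot center is fixed at $p_k$, with heading $\theta_k$ at the start of the episode. The $i$th measurement, at relative bearing $\alpha_{k,i}$, is $\mathsf{y}_{k,i}=F(p_k+\rho\varphi(\theta_k+\alpha_{k,i}))+w_{k,i}$. $\mathcal F_{k,i}$ is the information ($\sigma$-algebra) generated by all relative bearings and measurements up to sample $i$ of episode $k$, including previous episodes; $p_k,\theta_k$ are $\mathcal F_{k,0}$-measurable. Noise/motion assumption: for all $k,i$, $\mathbb{E}[w_{k,i}\mid\mathcal F_{k,i-1}]=0$ and $\mathbb{E}[e^{s w_{k,i}}\mid\mathcal F_{k,i-1}]\le\exp(s^2\sigma^2/2)$ for all $s\in\mathbb{R}$, with known variance proxy $\sigma^2$; $\alpha_{k,i}$ is $\mathcal F_{k,i-1}$-measurable;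 during each scan the center is held fixed and after the scan the commanded rotation and translation are executed exactly. Estimator: $z(\alpha)=[\cos\alpha\ \sin\alpha\ \cos2\alpha\ \sin2\alpha]^\top$, $\psi_{k,1}=e_1=[1\ 0\ 0\ 0\ 0]^\top$, $\psi_{k,i}=\begin{bmatrix}1\\ z(\alpha_{k,i})-z(\alpha_{k,1})\end{bmatrix}\in\mathbb{R}^5$ for $i\ge2$; $\Lambda_\lambda=\operatorname{diag}(0,\lambda I_4)$, $V_{k,n}=\Lambda_\lambda+\sum_{i=1}^n\psi_{k,i}\psi_{k,i}^\top$, $\hat\vartheta_{k,n}=V_{k,n}^{-1}\sum_{i=1}^n\psi_{k,i}\mathsf{y}_{k,i}$; $G_\rho=\frac1\rho[0\ \ I_2\ \ 0_{2\times2}]\in\mathbb{R}^{2\times5}$, $\hat g_{k,n}=G_\rho\hat\vartheta_{k,n}$, $P_{k,n}=G_\rho V_{k,n}^{-1}G_\rho^\top$. Here $\hat g_{k,n}$ estimates the gradient in the episode-local frame, i.e. $R(\theta_k)^\top\nabla F(p_k)$. Confidence set: $S_\xi=\sqrt{\rho^2G^2+\rho^4L^2/4}$, $b_\rho=M_3\rho^3/6$, $$\beta_{k,n}=\sigma\sqrt{2\log\frac{4}{\delta_k}}+\sigma\sqrt{2\log\!\left(\frac{2\det(V_{k,n})^{1/2}}{\delta_k\det(V_{k,1})^{1/2}}\right)}+\sqrt{\lambda}\,S_\xi+b_\rho\sqrt n,$$ $$\mathcal C_{k,n}=\{g\in\mathbb{R}^2:(g-\hat g_{k,n})^\top P_{k,n}^{-1}(g-\hat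 g_{k,n})\le\beta_{k,n}^2\},$$ $\gamma^-_{k,n}=\min_{g\in\mathcal C_{k,n}}\|g\|$, $\gamma^+_{k,n}=\max_{g\in\mathcal C_{k,n}}\|g\|$. Scan strategy: in every episode the candidate relative bearings are $\alpha_{k,i}=\frac{i-1}{m-1}\bar\alpha$, $i=1,\dots,m$. After every measurement, check (A) $\gamma^+_{k,n}\le\varepsilon$ and (B) $\gamma^-_{k,n}\ge\eta\gamma^+_{k,n}$; the scan stops at the first sample $n=\tau_k$ at which (A) or (B) holds. (A) takes priority if both hold. Move strategy: if (A) holds at $\tau_k$, the algorithm terminates at $p_k$ (so $K=k$). Otherwise (B) holds at $\tau_k$; let $g^\sharp=\arg\min_{g\in\mathcal C_{k,\tau_k}}\|g\|$, $d_k=-g^\sharp/\|g^\sharp\|$ (in the episode-local frame), rotate the robot toward $d_k$ and translate by $\ell_k=\gamma^-_{k,\tau_k}/L$ along it, i.e. $p_{k+1}=p_k+\ell_kR(\theta_k)d_k$ in the fixed frame; the new heading is $\theta_{k+1}$, with $\varphi(\theta_{k+1})=R(\theta_k)d_k$. (The strategy's behavior if neither condition holds by sample $m$, or after more than $K_{\max}+1$ episodes, is unspecified and irrelevant to the claim.) Design quantities (deterministic): $\Psi_m(\bar\alpha)\in\mathbb{R}^{m\times5}$ has as rows the $\psi_{k,i}^\top$, $i=1,\dots,m$, evaluated at the bearings $\alpha_{k,i}=\frac{i-1}{m-1}\bar\alpha$; $V_m(\bar\alpha)=\Lambda_\lambda+\Psi_m^\top\Psi_m$, $V_1=\operatorname{diag}(1,\lambda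 I_4)$, $\kappa_m(\bar\alpha)=\lambda_{\min}(\frac1m\Psi_m^\top\Psi_m)$ (which is positive), $D_m(\bar\alpha)=\det V_m(\bar\alpha)/\det V_1$. For $\delta'\in(0,1)$, $$\overline\beta_m(\bar\alpha,\delta')=\sigma\sqrt{2\log\frac{4}{\delta'}}+\sigma\sqrt{2\log\!\left(\frac{2D_m(\bar\alpha)^{1/2}}{\delta'}\right)}+\sqrt{\lambda}\,S_\xi+b_\rho\sqrt m,$$ $$\overline\varrho_m(\bar\alpha,\delta')=\frac{\overline\beta_m(\bar\alpha,\delta')}{\rho\sqrt{m\,\kappa_m(\bar\alpha)}}.$$ *)

theory Defs
  imports "HOL-Probability.Probability"
begin

definition fderiv ::
    "('a::real_normed_vector \<Rightarrow> 'b::real_normed_vector) \<Rightarrow> 'a \<Rightarrow> ('a \<Rightarrow>\<^sub>L 'b)" where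
  "fderiv f x = Blinfun (frechet_derivative f (at x))"

definition grad :: "('a::real_inner \<Rightarrow> real) \<Rightarrow> 'a \<Rightarrow> 'a" where
  "grad F p = (THE D. GDERIV F p :> D)"

text \<open>
  Third derivatives take values in iterated spaces of bounded linear maps. The norm there is the
  operator norm of the corresponding trilinear form.
\<close>

definition C3 :: "('a::real_normed_vector \<Rightarrow> 'b::real_normed_vector) \<Rightarrow> bool" where
  "C3 F \<longleftrightarrow>
     (\<forall>x. F differentiable at x) \<and>
     (\<forall>x. fderiv F differentiable at x) \<and>
     (\<forall>x. fderiv (fderiv F) differentiable at x) \<and>
     continuous_on UNIV (fderiv (fderiv (fderiv F)))"

definition field_assumption ::
    "(real^2 \<Rightarrow> real) \<Rightarrow> real^2 \<Rightarrow> real^2 \<Rightarrow> real \<Rightarrow> real \<Rightarrow> real \<Rightarrow> real \<Rightarrow> bool" where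
  "field_assumption F p0 pstar G L M3 \<Delta>0 \<longleftrightarrow>
     C3 F \<and>
     (\<forall>p. p \<noteq> pstar \<longrightarrow> F pstar < F p) \<and>
     (\<forall>p. grad F p = 0 \<longleftrightarrow> p = pstar) \<and>
     compact {p. F p \<le> F p0} \<and>
     0 < G \<and> 0 < L \<and> 0 < M3 \<and> 0 < \<Delta>0 \<and>
     (\<forall>p. norm (grad F p) \<le> G) \<and>
     (\<forall>p q. norm (grad F p - grad F q) \<le> L * norm (p - q)) \<and>
     (\<forall>p. norm (fderiv (fderiv (fderiv F)) p) \<le> M3) \<and>
     F p0 - F pstar \<le> \<Delta>0"

definition direction :: "real \<Rightarrow> real^2" where
  "direction t = vector [cos t, sin t]"

definition rot :: "real \<Rightarrow> real^2^2" where
  "rot t = vector [vector [cos t, - sin t], vector [sin t, cos t]]"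

text \<open>
  Here \<open>a i\<close> is the relative bearing and \<open>y i\<close> the measured value of the \<open>i\<close>-th sample of the
  scan, \<open>i \<ge> 1\<close>.
\<close>

definition harmonics :: "real \<Rightarrow> real^4" where
  "harmonics t = vector [cos t, sin t, cos (2 * t), sin (2 * t)]"

definition regressor :: "(nat \<Rightarrow> real) \<Rightarrow> nat \<Rightarrow> real^5" where
  "regressor a i =
     (if i = 1 then axis 1 1
      else (let z = harmonics (a i) - harmonics (a 1) in vector [1, z$1, z$2, z$3, z$4]))"

text \<open>
  \<open>gram a n\<close> is both the sum of the outer products of the first \<open>n\<close> regressors and the product
  of the transpose of the \<open>n \<times> 5\<close> matrix with these regressors as rows with that matrix.
\<close>

definition gram :: "(nat \<Rightarrow> real) \<Rightarrow> nat \<Rightarrow> real^5^5" where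
  "gram a n = (\<chi> r s. \<Sum>i=1..n. regressor a i $ r * regressor a i $ s)"

definition reg_weight :: "real \<Rightarrow> real^5^5" where
  "reg_weight lam = (\<chi> r s. if r = s \<and> r \<noteq> 1 then lam else 0)"

definition V_mat :: "real \<Rightarrow> (nat \<Rightarrow> real) \<Rightarrow> nat \<Rightarrow> real^5^5" where
  "V_mat lam a n = reg_weight lam + gram a n"

definition theta_hat :: "real \<Rightarrow> (nat \<Rightarrow> real) \<Rightarrow> (nat \<Rightarrow> real) \<Rightarrow> nat \<Rightarrow> real^5" where
  "theta_hat lam a y n = matrix_inv (V_mat lam a n) *v (\<Sum>i=1..n. y i *\<^sub>R regressor a i)"

definition G_mat :: "real \<Rightarrow> real^5^2" where
  "G_mat \<rho> = (1 / \<rho>) *\<^sub>R vector [vector [0, 1, 0, 0, 0], vector [0, 0, 1, 0, 0]]"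

definition g_hat :: "real \<Rightarrow> real \<Rightarrow> (nat \<Rightarrow> real) \<Rightarrow> (nat \<Rightarrow> real) \<Rightarrow> nat \<Rightarrow> real^2" where
  "g_hat \<rho> lam a y n = G_mat \<rho> *v theta_hat lam a y n"

definition P_mat :: "real \<Rightarrow> real \<Rightarrow> (nat \<Rightarrow> real) \<Rightarrow> nat \<Rightarrow> real^2^2" where
  "P_mat \<rho> lam a n = G_mat \<rho> ** matrix_inv (V_mat lam a n) ** transpose (G_mat \<rho>)"

definition S_xi :: "real \<Rightarrow> real \<Rightarrow> real \<Rightarrow> real" where
  "S_xi \<rho> G L = sqrt (\<rho>^2 * G^2 + \<rho>^4 * L^2 / 4)"

definition b_bias :: "real \<Rightarrow> real \<Rightarrow> real" where
  "b_bias \<rho> M3 = M3 * \<rho>^3 / 6"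

definition conf_radius ::
    "real \<Rightarrow> real \<Rightarrow> real \<Rightarrow> real \<Rightarrow> real \<Rightarrow> real \<Rightarrow> real \<Rightarrow> (nat \<Rightarrow> real) \<Rightarrow> nat \<Rightarrow> real" where
  "conf_radius \<rho> G L M3 \<sigma> lam \<delta>' a n =
     \<sigma> * sqrt (2 * ln (4 / \<delta>')) +
     \<sigma> * sqrt (2 * ln (2 * sqrt (det (V_mat lam a n)) / (\<delta>' * sqrt (det (V_mat lam a 1))))) +
     sqrt lam * S_xi \<rho> G L +
     b_bias \<rho> M3 * sqrt (real n)"

definition conf_set ::
    "real \<Rightarrow> real \<Rightarrow> real \<Rightarrow> (nat \<Rightarrow> real) \<Rightarrow> (nat \<Rightarrow> real) \<Rightarrow> nat \<Rightarrow> (real^2) set" where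
  "conf_set \<rho> lam r a y n =
     {g. (g - g_hat \<rho> lam a y n) \<bullet>
           (matrix_inv (P_mat \<rho> lam a n) *v (g - g_hat \<rho> lam a y n)) \<le> r^2}"

text \<open>
  The confidence sets of the strategy are nonempty and compact, so that the infimum and the supremum are a
  minimum and a maximum; by convexity the element of least norm is unique.
\<close>

definition norm_min :: "(real^2) set \<Rightarrow> real" where
  "norm_min C = (INF g\<in>C. norm g)"

definition norm_max :: "(real^2) set \<Rightarrow> real" where
  "norm_max C = (SUP g\<in>C. norm g)"

definition descent_dir :: "(real^2) set \<Rightarrow> real^2" where
  "descent_dir C = (let g = arg_min_on norm C in - (g /\<^sub>R norm g))"

definition scan_bearing :: "nat \<Rightarrow> real \<Rightarrow> nat \<Rightarrow> real" where
  "scan_bearing m abar i = (real i - 1) / (real m - 1) * abar"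

definition least_eigenvalue :: "real^'n^'n \<Rightarrow> real" where
  "least_eigenvalue A = (LEAST \<mu>. \<exists>v. v \<noteq> 0 \<and> A *v v = \<mu> *\<^sub>R v)"

definition kappa :: "nat \<Rightarrow> real \<Rightarrow> real" where
  "kappa m abar = least_eigenvalue ((1 / real m) *\<^sub>R gram (scan_bearing m abar) m)"

definition V_one :: "real \<Rightarrow> real^5^5" where
  "V_one lam = (\<chi> r s. if r = s then (if r = 1 then 1 else lam) else 0)"

definition det_ratio :: "real \<Rightarrow> nat \<Rightarrow> real \<Rightarrow> real" where
  "det_ratio lam m abar = det (V_mat lam (scan_bearing m abar) m) / det (V_one lam)"

definition beta_bar ::
    "real \<Rightarrow> real \<Rightarrow> real \<Rightarrow> real \<Rightarrow> real \<Rightarrow> real \<Rightarrow> nat \<Rightarrow> real \<Rightarrow> real \<Rightarrow> real" where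
  "beta_bar \<rho> G L M3 \<sigma> lam m abar \<delta>' =
     \<sigma> * sqrt (2 * ln (4 / \<delta>')) +
     \<sigma> * sqrt (2 * ln (2 * sqrt (det_ratio lam m abar) / \<delta>')) +
     sqrt lam * S_xi \<rho> G L +
     b_bias \<rho> M3 * sqrt (real m)"

definition rho_bar ::
    "real \<Rightarrow> real \<Rightarrow> real \<Rightarrow> real \<Rightarrow> real \<Rightarrow> real \<Rightarrow> nat \<Rightarrow> real \<Rightarrow> real \<Rightarrow> real" where
  "rho_bar \<rho> G L M3 \<sigma> lam m abar \<delta>' =
     beta_bar \<rho> G L M3 \<sigma> lam m abar \<delta>' / (\<rho> * sqrt (real m * kappa m abar))"

text \<open>
  \<open>A k n \<omega>\<close> and \<open>B k n \<omega>\<close> say that the termination test, respectively the motion test,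
  succeeds after sample \<open>n\<close> of episode \<open>k\<close>.
\<close>

definition scan_stops ::
    "(nat \<Rightarrow> nat \<Rightarrow> 'w \<Rightarrow> bool) \<Rightarrow> (nat \<Rightarrow> nat \<Rightarrow> 'w \<Rightarrow> bool) \<Rightarrow> nat \<Rightarrow> nat \<Rightarrow> 'w \<Rightarrow> bool" where
  "scan_stops A B k n \<omega> \<longleftrightarrow>
     1 \<le> n \<and> (A k n \<omega> \<or> B k n \<omega>) \<and> (\<forall>j\<in>{1..<n}. \<not> (A k j \<omega> \<or> B k j \<omega>))"

text \<open>Episode \<open>k\<close> takes place iff every earlier one stopped within \<open>m\<close> samples and led to a move.\<close>

definition episode_reached ::
    "nat \<Rightarrow> (nat \<Rightarrow> nat \<Rightarrow> 'w \<Rightarrow> bool) \<Rightarrow> (nat \<Rightarrow> nat \<Rightarrow> 'w \<Rightarrow> bool) \<Rightarrow> nat \<Rightarrow> 'w \<Rightarrow> bool" where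
  "episode_reached m A B k \<omega> \<longleftrightarrow> (\<forall>j<k. \<exists>n\<le>m. scan_stops A B j n \<omega> \<and> \<not> A j n \<omega>)"

definition sample_taken ::
    "nat \<Rightarrow> (nat \<Rightarrow> nat \<Rightarrow> 'w \<Rightarrow> bool) \<Rightarrow> (nat \<Rightarrow> nat \<Rightarrow> 'w \<Rightarrow> bool) \<Rightarrow> nat \<Rightarrow> nat \<Rightarrow> 'w \<Rightarrow> bool" where
  "sample_taken m A B k i \<omega> \<longleftrightarrow>
     episode_reached m A B k \<omega> \<and> 1 \<le> i \<and> i \<le> m \<and> (\<forall>j\<in>{1..<i}. \<not> (A k j \<omega> \<or> B k j \<omega>))"

text \<open>
  Only samples that are actually taken contribute information: those of episodes before \<open>k\<close>, and
  those of episode \<open>k\<close> up to index \<open>i\<close>. The choice \<open>S = UNIV\<close> makes the event that a sample has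
  been taken part of the information carried by that sample.
\<close>

definition scan_info ::
    "'w measure \<Rightarrow> (nat \<Rightarrow> nat \<Rightarrow> 'w \<Rightarrow> bool) \<Rightarrow> (nat \<Rightarrow> nat \<Rightarrow> 'w \<Rightarrow> real) \<Rightarrow>
     (nat \<Rightarrow> nat \<Rightarrow> 'w \<Rightarrow> real) \<Rightarrow> nat \<Rightarrow> nat \<Rightarrow> 'w measure" where
  "scan_info M taken \<alpha> y k i =
     sigma (space M)
       {{\<omega>\<in>space M. taken k' j \<omega> \<and> (\<alpha> k' j \<omega>, y k' j \<omega>) \<in> S} | k' j S.
          (k' < k \<or> k' = k \<and> j \<le> i) \<and> S \<in> sets (borel :: (real \<times> real) measure)}"

definition cond_subgaussian ::
    "'w measure \<Rightarrow> 'w measure \<Rightarrow> real \<Rightarrow> ('w \<Rightarrow> real) \<Rightarrow> bool" where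
  "cond_subgaussian M H \<sigma> X \<longleftrightarrow>
     integrable M X \<and>
     (AE \<omega> in M. real_cond_exp M H X \<omega> = 0) \<and>
     (\<forall>s. integrable M (\<lambda>\<omega>. exp (s * X \<omega>)) \<and>
          (AE \<omega> in M. real_cond_exp M H (\<lambda>\<omega>. exp (s * X \<omega>)) \<omega> \<le> exp (s^2 * \<sigma>^2 / 2)))"

end

theory Submission
  imports Defs "HOL-Computational_Algebra.Polynomial"
begin

text \<open>
  By Taylor's formula along the rays from \<open>p k\<close>, the measurements of an episode follow a linear regression
  on the regressors with error at most \<open>b_bias \<rho> M3\<close>, in which the gradient gives two of the coefficients.
  In the norm of \<open>V_mat\<close> the error of the estimator splits into the noise of the first sample, the noise of the
  later samples, the regularization and the Taylor remainder; these are the four terms of \<open>conf_radius\<close>.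
  The second is controlled by the maximal inequality for the supermartingale
  \<open>exp (S \<bullet> V\<^sup>-\<^sup>1 S / (2 \<sigma>\<^sup>2)) / sqrt (det V / det V\<^sub>1)\<close>: a rank-one update of \<open>V\<close> multiplies it by a factor that
  is a one-dimensional Gaussian mixture of \<open>exp (x w / \<sigma> - x\<^sup>2 / 2)\<close>.

  Hence, outside an event of probability at most \<open>\<delta>\<close>, all confidence sets of the first \<open>Kmax + 1\<close> episodes
  contain the true local gradient. There, after \<open>m\<close> samples the diameter of the confidence set is at most
  \<open>(1 - \<eta>) \<epsilon> / 2\<close>, which forces one of the two stopping conditions. Since the element of least norm of a convex
  set supports it, a move decreases \<open>F\<close> by more than \<open>\<eta>\<^sup>2 \<epsilon>\<^sup>2 / (2 L)\<close>, which bounds the number of moves.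
\<close>

section \<open>Positive definite matrices\<close>

text \<open>The regularization leaves the constant coefficient free, so \<open>V_mat\<close> is
  invertible only from the first sample on. This is why the first noise value gets a plain tail
  bound and the self-normalized process starts at \<open>V 1\<close>, with sums from index 2. The
  two bounds share the failure probability of an episode equally, which produces the
  \<open>4 / \<delta>'\<close> and the \<open>2 / \<delta>'\<close> under the logarithms. The main
  obstacle is that samples exist only until the scan stops. \<open>Info\<close> records nothing
  about later samples, so the noise sums are adapted only on the event that the next sample is
  taken. The maximal inequality and the measurability statements are therefore relative to the
  decreasing events \<open>T k n\<close>. These events depend on the confidence sets themselves.
  They are measurable because the bearings of the design are deterministic, so that a confidence set
  is a random translate of a fixed ellipsoid, and its least and greatest norm are continuous in the
  centre.\<close>

definition pos_def :: "real^'n^'n \<Rightarrow> bool" where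
  "pos_def A \<longleftrightarrow> transpose A = A \<and> (\<forall>x. x \<noteq> 0 \<longrightarrow> 0 < x \<bullet> (A *v x))"

section \<open>Rank-one matrices and their effect on determinants and inverses\<close>

definition outer :: "real^'n \<Rightarrow> real^'m \<Rightarrow> real^'m^'n" where
  "outer u v = (\<chi> i j. u $ i * v $ j)"

lemma outer_mult_vec: "outer u v *v x = (v \<bullet> x) *\<^sub>R u"
  by (simp add: outer_def vec_eq_iff matrix_vector_mult_def inner_vec_def sum_distrib_left
      sum_distrib_right mult_ac)

lemma transpose_outer: "transpose (outer u v) = outer v u"
  by (simp add: outer_def transpose_def vec_eq_iff mult.commute)

lemma matrix_mult_outer: "A ** outer u v = outer (A *v u) v"
  by (simp add: outer_def vec_eq_iff matrix_matrix_mult_def matrix_vector_mult_def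
      sum_distrib_left sum_distrib_right mult_ac)

lemma outer_matrix_mult: "outer u v ** A = outer u (transpose A *v v)"
  by (simp add: outer_def vec_eq_iff matrix_matrix_mult_def vector_matrix_mult_def
      sum_distrib_left mult_ac)

lemma outer_scaleR: "outer (c *\<^sub>R u) v = outer u (c *\<^sub>R v)"
  by (simp add: outer_def vec_eq_iff mult_ac)

lemma matrix_mult_add_rdistrib: "(A + B) ** C = A ** C + B ** (C :: real^'k^'n)"
  by (simp add: matrix_matrix_mult_def vec_eq_iff distrib_right sum.distrib)

lemma symmetric_inner:
  fixes A :: "real^'n^'n"
  assumes "transpose A = A"
  shows "x \<bullet> (A *v y) = (A *v x) \<bullet> y"
  by (metis assms dot_lmul_matrix transpose_matrix_vector)

text \<open>Outside row \<open>k\<close> the matrix is the identity, so the off-diagonal entries of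
  row \<open>k\<close> are multiples of other rows. Removing them leaves the diagonal matrix
  \<open>D\<close> and does not change the determinant.\<close>

lemma det_mat_1_plus_outer_axis:
  "det (mat 1 + outer (axis k 1) w :: real^'n^'n) = 1 + w $ k"
proof -
  define D :: "real^'n^'n" where
    "D = (\<chi> i j. if i = j then (if i = k then 1 + w $ k else 1) else 0)"
  define x :: "real^'n" where "x = (\<Sum>j\<in>UNIV - {k}. (w $ j) *s axis j 1)"
  have row: "row j D = axis j 1" if "j \<noteq> k" for j
    using that by (auto simp: D_def row_def vec_eq_iff axis_def)
  have "axis j 1 \<in> {row j D |j. j \<noteq> k}" if "j \<noteq> k" for j
    using row[OF that] that by (metis (mono_tags, lifting) mem_Collect_eq)
  then have "x \<in> vec.span {row j D |j. j \<noteq> k}"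
    unfolding x_def by (intro vec.span_sum vec.span_scale vec.span_base) auto
  then have "det (\<chi> i. if i = k then row k D + x else row i D) = det D"
    by (rule det_row_span)
  moreover have "(\<chi> i. if i = k then row k D + x else row i D) = mat 1 + outer (axis k 1) w"
  proof -
    have "x $ j = (if j = k then 0 else w $ j)" for j
    proof -
      have "x $ j = (\<Sum>i\<in>UNIV - {k}. if i = j then w $ i else 0)"
        by (simp add: x_def axis_def if_distrib[of "(*) _"] eq_commute[of j] cong: if_cong)
      then show ?thesis by (simp add: sum.delta)
    qed
    then show ?thesis
      by (auto simp: vec_eq_iff D_def row_def outer_def axis_def mat_def)
  qed
  moreover have "det D = 1 + w $ k"
  proof -
    have "det D = (\<Prod>i\<in>UNIV. D $ i $ i)"
      by (rule det_diagonal) (simp add: D_def)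
    also have "\<dots> = (\<Prod>i\<in>UNIV. if i = k then 1 + w $ k else 1)"
      by (simp add: D_def)
    finally show ?thesis by simp
  qed
  ultimately show ?thesis by simp
qed

text \<open>Conjugation by an orthogonal matrix \<open>P\<close> that turns a coordinate axis into
  the direction of \<open>u\<close> reduces to the axis case. The length of \<open>u\<close>, lost
  in the normalization, is carried by the second factor \<open>w\<close>.\<close>

lemma det_mat_1_plus_outer:
  fixes u v :: "real^'n"
  shows "det (mat 1 + outer u v) = 1 + u \<bullet> v"
proof (cases "u = 0")
  case True
  then have "outer u v = 0" by (simp add: outer_def vec_eq_iff)
  with True show ?thesis by simp
next
  case False
  fix k :: 'n
  have "norm (u /\<^sub>R norm u) = 1" using False by simp
  then obtain P where P: "orthogonal_matrix P" "P *v axis k 1 = u /\<^sub>R norm u"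
    by (rule orthogonal_matrix_exists_basis[where k = k])
  define w where "w = norm u *\<^sub>R (transpose P *v v)"
  have PP: "P ** transpose P = mat 1" and PP': "transpose P ** P = mat 1"
    using P(1) by (auto simp: orthogonal_matrix_def)
  have "P ** (mat 1 + outer (axis k 1) w) ** transpose P
      = P ** transpose P + outer (P *v axis k 1) (P *v w)"
    by (simp add: matrix_add_ldistrib matrix_mult_add_rdistrib matrix_mult_outer outer_matrix_mult)
  also have "P *v w = norm u *\<^sub>R v"
    unfolding w_def matrix_vector_mult_scaleR by (simp add: matrix_vector_mul_assoc PP del: transpose_matrix_vector)
  also have "outer (P *v axis k 1) (norm u *\<^sub>R v) = outer u v"
    unfolding P(2) using False outer_scaleR[of "norm u" "u /\<^sub>R norm u" v] by simp
  finally have "det (mat 1 + outer u v) = det P * det (mat 1 + outer (axis k 1) w) * det P"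
    by (metis PP det_mul det_transpose)
  also have "\<dots> = 1 + w $ k"
    using det_orthogonal_matrix[OF P(1)] by (auto simp: det_mat_1_plus_outer_axis)
  also have "w $ k = norm u * (axis k 1 \<bullet> (transpose P *v v))"
    by (simp add: w_def inner_axis')
  also have "axis k 1 \<bullet> (transpose P *v v) = (P *v axis k 1) \<bullet> v"
    by (metis dot_lmul_matrix inner_commute transpose_matrix_vector)
  also have "norm u * \<dots> = u \<bullet> v"
    unfolding P(2) using False by simp
  finally show ?thesis .
qed

lemma pos_def_invertible:
  assumes "pos_def A" shows "invertible A"
proof -
  have "x = 0" if "A *v x = 0" for x
    using assms that by (force simp: pos_def_def)
  then show ?thesis
    using matrix_left_invertible_ker[of A] invertible_left_inverse[of A] by blast
qed

lemma matrix_inv_inverse: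
  fixes A :: "real^'n^'n"
  assumes "invertible A"
  shows "A ** matrix_inv A = mat 1" "matrix_inv A ** A = mat 1"
    "A *v (matrix_inv A *v x) = x" "matrix_inv A *v (A *v x) = x"
proof -
  have *: "A ** matrix_inv A = mat 1 \<and> matrix_inv A ** A = mat 1"
    using assms unfolding invertible_def matrix_inv_def by (rule someI_ex)
  then show "A ** matrix_inv A = mat 1" "matrix_inv A ** A = mat 1" by auto
  with * show "A *v (matrix_inv A *v x) = x" "matrix_inv A *v (A *v x) = x"
    by (simp_all add: matrix_vector_mul_assoc)
qed

lemma transpose_matrix_inv:
  fixes A :: "real^'n^'n"
  assumes "transpose A = A" "invertible A"
  shows "transpose (matrix_inv A) = matrix_inv A"
proof -
  have "transpose (matrix_inv A) ** A = mat 1"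
    by (metis assms matrix_inv_inverse(1) matrix_transpose_mul transpose_mat)
  then show ?thesis
    by (metis assms(2) matrix_inv_inverse(1) matrix_mul_assoc matrix_mul_lid matrix_mul_rid)
qed

lemma pos_def_matrix_inv:
  assumes "pos_def A" shows "pos_def (matrix_inv A)"
proof -
  note inv = matrix_inv_inverse[OF pos_def_invertible[OF assms]]
  have "0 < x \<bullet> (matrix_inv A *v x)" if "x \<noteq> 0" for x
  proof -
    have "matrix_inv A *v x \<noteq> 0" using inv(3)[of x] that by auto
    then have "0 < (matrix_inv A *v x) \<bullet> (A *v (matrix_inv A *v x))"
      using assms by (auto simp: pos_def_def)
    then show ?thesis by (simp add: inv inner_commute)
  qed
  then show ?thesis
    using transpose_matrix_inv[of A] pos_def_invertible[OF assms] assms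
    by (simp add: pos_def_def)
qed

lemma pos_def_nonneg: "pos_def A \<Longrightarrow> 0 \<le> x \<bullet> (A *v x)"
  by (cases "x = 0") (auto simp: pos_def_def less_imp_le)

lemma pos_def_cauchy_schwarz:
  assumes "pos_def A"
  shows "\<bar>x \<bullet> (A *v y)\<bar> \<le> sqrt (x \<bullet> (A *v x)) * sqrt (y \<bullet> (A *v y))"
proof -
  let ?a = "y \<bullet> (A *v y)" and ?b = "x \<bullet> (A *v y)" and ?c = "x \<bullet> (A *v x)"
  have sym: "y \<bullet> (A *v x) = ?b"
    using symmetric_inner[of A y x] assms by (simp add: pos_def_def inner_commute)
  have "?b\<^sup>2 \<le> ?c * ?a"
  proof (cases "y = 0")
    case False
    then have a: "0 < ?a" using assms by (simp add: pos_def_def)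
    \<comment> \<open>This is the minimizer over \<open>t\<close> of the quadratic form at
      \<open>x - t *\<^sub>R y\<close>.\<close>
    define t where "t = ?b / ?a"
    have "0 \<le> (x - t *\<^sub>R y) \<bullet> (A *v (x - t *\<^sub>R y))" by (rule pos_def_nonneg[OF assms])
    also have "\<dots> = ?c - 2 * t * ?b + t\<^sup>2 * ?a"
      by (simp add: matrix_vector_mult_diff_distrib matrix_vector_mult_scaleR inner_diff_left
          inner_diff_right sym power2_eq_square algebra_simps)
    also have "\<dots> = ?c - ?b\<^sup>2 / ?a" using a by (simp add: t_def field_simps power2_eq_square)
    finally show ?thesis using a by (simp add: field_simps)
  qed simp
  then have "sqrt (?b\<^sup>2) \<le> sqrt (?c * ?a)" by (rule real_sqrt_le_mono)
  then show ?thesis by (simp add: real_sqrt_mult)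
qed

lemma pos_def_add_outer:
  assumes "pos_def A" shows "pos_def (A + outer u u)"
proof -
  have "0 < x \<bullet> ((A + outer u u) *v x)" if "x \<noteq> 0" for x
  proof -
    have "x \<bullet> ((A + outer u u) *v x) = x \<bullet> (A *v x) + (u \<bullet> x)\<^sup>2"
      by (simp add: matrix_vector_mult_add_rdistrib inner_add_right outer_mult_vec
          power2_eq_square inner_commute)
    then show ?thesis using assms that by (auto simp: pos_def_def intro: add_pos_nonneg)
  qed
  moreover have "transpose (A + outer u u) = A + outer u u"
    using assms transpose_outer[of u u] by (simp add: pos_def_def transpose_def vec_eq_iff)
  ultimately show ?thesis by (simp add: pos_def_def)
qed

text \<open>Matrix determinant lemma: taking out the factor \<open>A\<close> leaves a rank-one
  perturbation of the identity.\<close>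

lemma det_add_outer:
  fixes A :: "real^'n^'n"
  assumes "invertible A"
  shows "det (A + outer u v) = det A * (1 + v \<bullet> (matrix_inv A *v u))"
proof -
  have "A + outer u v = A ** (mat 1 + outer (matrix_inv A *v u) v)"
    by (simp add: matrix_add_ldistrib matrix_mult_outer matrix_inv_inverse[OF assms])
  then show ?thesis by (simp add: det_mul det_mat_1_plus_outer inner_commute)
qed

text \<open>One step of the self-normalized process: \<open>u\<close> is the new regressor and
  \<open>w\<close> its noise. Up to the scaling by \<sigma>, half of the increment is the exponent
  that \<open>gaussian_mixture\<close> produces; this agreement gives the supermartingale
  property.\<close>

lemma Sherman_Morrison_form:
  fixes S u :: "real^'n"
  assumes A: "pos_def A"
    and q: "q = u \<bullet> (matrix_inv A *v u)" and s: "s = u \<bullet> (matrix_inv A *v S)"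
  shows "(S + w *\<^sub>R u) \<bullet> (matrix_inv (A + outer u u) *v (S + w *\<^sub>R u))
    = S \<bullet> (matrix_inv A *v S) + (2 * s * w + q * w\<^sup>2 - s\<^sup>2) / (1 + q)"
proof -
  let ?B = "A + outer u u"
  note inv = matrix_inv_inverse[OF pos_def_invertible[OF A]]
  note invB = matrix_inv_inverse[OF pos_def_invertible[OF pos_def_add_outer[OF A]]]
  have q0: "0 \<le> q" unfolding q by (intro pos_def_nonneg pos_def_matrix_inv A)
  \<comment> \<open>The solution of the updated system is sought as \<open>matrix_inv A *v S\<close>
    plus \<open>c\<close> times \<open>matrix_inv A *v u\<close>. Comparing the coefficients of
    \<open>u\<close> gives \<open>c + s + c * q = w\<close>.\<close>
  define x where "x = matrix_inv A *v S + ((w - s) / (1 + q)) *\<^sub>R (matrix_inv A *v u)"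
  have "?B *v x = S + (((w - s) / (1 + q)) + s + ((w - s) / (1 + q)) * q) *\<^sub>R u"
    by (simp add: x_def matrix_vector_mult_add_rdistrib matrix_vector_right_distrib
        matrix_vector_mult_scaleR outer_mult_vec inv s[symmetric] q[symmetric]
        inner_add_right algebra_simps)
  also have "((w - s) / (1 + q)) + s + ((w - s) / (1 + q)) * q = w"
  proof -
    have "((w - s) / (1 + q)) + s + ((w - s) / (1 + q)) * q = (w - s) / (1 + q) * (1 + q) + s"
      by (simp only: distrib_left distrib_right mult_1_right mult_1_left ac_simps)
    then show ?thesis using q0 by simp
  qed
  finally have x: "matrix_inv ?B *v (S + w *\<^sub>R u) = x"
    using invB(4)[of u x] by simp
  have S: "S \<bullet> (matrix_inv A *v u) = s"
    unfolding s using symmetric_inner[of "matrix_inv A" S u] pos_def_matrix_inv[OF A]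
    by (simp add: pos_def_def inner_commute)
  have "(S + w *\<^sub>R u) \<bullet> x = S \<bullet> (matrix_inv A *v S) + (w - s) / (1 + q) * s + w * s
      + w * ((w - s) / (1 + q)) * q"
    by (simp add: x_def inner_add_left inner_add_right S s[symmetric] q[symmetric]
        distrib_left add_divide_distrib diff_divide_distrib algebra_simps)
  also have "\<dots> = S \<bullet> (matrix_inv A *v S) + (2 * s * w + q * w\<^sup>2 - s\<^sup>2) / (1 + q)"
  proof -
    define c where "c = (w - s) / (1 + q)"
    have "c * (1 + q) = w - s" using q0 by (simp add: c_def)
    then have "(c * s + w * s + w * c * q) * (1 + q) = 2 * s * w + q * w\<^sup>2 - s\<^sup>2" by algebra
    then have "c * s + w * s + w * c * q = (2 * s * w + q * w\<^sup>2 - s\<^sup>2) / (1 + q)"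
      using q0 by (simp add: eq_divide_eq)
    then show ?thesis unfolding c_def[symmetric] by linarith
  qed
  finally show ?thesis by (simp add: x)
qed

section \<open>Linear images and least eigenvalues of quadratic forms\<close>

lemma pos_def_congruence:
  fixes H :: "real^'n^'m"
  assumes A: "pos_def A" and H: "inj ((*v) (transpose H))"
  shows "pos_def (H ** A ** transpose H)"
proof -
  have "0 < x \<bullet> ((H ** A ** transpose H) *v x)" if "x \<noteq> 0" for x
  proof -
    have "transpose H *v x \<noteq> 0"
      using H that by (metis injD matrix_vector_mult_0_right)
    then have "0 < (transpose H *v x) \<bullet> (A *v (transpose H *v x))"
      using A unfolding pos_def_def by blast
    also have "\<dots> = x \<bullet> ((H ** A ** transpose H) *v x)"
      by (metis dot_lmul_matrix matrix_vector_mul_assoc transpose_matrix_vector)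
    finally show ?thesis .
  qed
  moreover have "transpose (H ** A ** transpose H) = H ** A ** transpose H"
    using A by (simp add: pos_def_def matrix_transpose_mul matrix_mul_assoc)
  ultimately show ?thesis by (simp add: pos_def_def)
qed

text \<open>A linear image of an ellipsoid is the ellipsoid of the transformed inverse matrix.\<close>

lemma projected_form_le:
  fixes H :: "real^'n^'m" and x :: "real^'n"
  assumes A: "pos_def A" and H: "inj ((*v) (transpose H))"
  shows "(H *v x) \<bullet> (matrix_inv (H ** matrix_inv A ** transpose H) *v (H *v x)) \<le> x \<bullet> (A *v x)"
proof -
  let ?P = "H ** matrix_inv A ** transpose H"
  have P: "pos_def ?P" by (rule pos_def_congruence[OF pos_def_matrix_inv[OF A] H])
  note inv = matrix_inv_inverse[OF pos_def_invertible[OF A]]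
  note invP = matrix_inv_inverse[OF pos_def_invertible[OF P]]
  define u where "u = matrix_inv ?P *v (H *v x)"
  \<comment> \<open>Among the vectors with the same image as \<open>x\<close>, \<open>z\<close> has
    the least value of the form of \<open>A\<close>, and this value is \<open>?c\<close>. The claim
    is then Cauchy-Schwarz for \<open>x\<close> and \<open>z\<close>.\<close>
  define z where "z = matrix_inv A *v (transpose H *v u)"
  let ?c = "(H *v x) \<bullet> u"
  have Hz: "H *v z = H *v x"
    using invP(3)[of "H *v x"]
    by (simp add: z_def u_def matrix_vector_mul_assoc matrix_mul_assoc del: transpose_matrix_vector)
  have eq: "y \<bullet> (A *v z) = (H *v y) \<bullet> u" for y
    by (metis z_def inv(3) dot_lmul_matrix inner_commute transpose_matrix_vector)
  have c: "?c = z \<bullet> (A *v z)" "?c = x \<bullet> (A *v z)"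
    using eq Hz by auto
  have c0: "0 \<le> ?c" unfolding c(1) by (rule pos_def_nonneg[OF A])
  have "sqrt ?c * sqrt ?c \<le> sqrt (x \<bullet> (A *v x)) * sqrt ?c"
    using pos_def_cauchy_schwarz[OF A, of x z] c c0 by simp
  then have "sqrt ?c \<le> sqrt (x \<bullet> (A *v x)) \<or> ?c = 0"
    using c0 by (auto simp: mult_le_cancel_right simp del: real_sqrt_mult_self)
  then show ?thesis
    using pos_def_nonneg[OF A, of x] by (auto simp: u_def)
qed

text \<open>First-order optimality: moving from \<open>v\<close> against the residual
  \<open>r\<close> changes the excess of the form over its lower bound by
  \<open>t\<^sup>2 * c - 2 * t * (r \<bullet> r)\<close>, which is negative for small positive
  \<open>t\<close> unless \<open>r\<close> vanishes.\<close>

lemma Rayleigh_minimizer_eigenvector: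
  fixes A :: "real^'n^'n"
  assumes sym: "transpose A = A" and v: "norm v = 1"
    and ge: "\<And>x. (v \<bullet> (A *v v)) * (x \<bullet> x) \<le> x \<bullet> (A *v x)"
  shows "A *v v = (v \<bullet> (A *v v)) *\<^sub>R v"
proof -
  let ?\<mu> = "v \<bullet> (A *v v)"
  define r where "r = A *v v - ?\<mu> *\<^sub>R v"
  define c where "c = r \<bullet> (A *v r) - ?\<mu> * (r \<bullet> r)"
  have rv: "r \<bullet> (A *v v) - ?\<mu> * (r \<bullet> v) = r \<bullet> r"
    by (simp add: r_def inner_diff_right algebra_simps)
  have vv: "v \<bullet> v = 1" using v by (simp add: norm_eq_sqrt_inner)
  have sym': "v \<bullet> (A *v r) = r \<bullet> (A *v v)"
    using symmetric_inner[OF sym, of v r] by (simp add: inner_commute)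
  have quad: "0 \<le> t\<^sup>2 * c - 2 * t * (r \<bullet> r)" for t
  proof -
    have "0 \<le> (v - t *\<^sub>R r) \<bullet> (A *v (v - t *\<^sub>R r)) - ?\<mu> * ((v - t *\<^sub>R r) \<bullet> (v - t *\<^sub>R r))"
      using ge[of "v - t *\<^sub>R r"] by simp
    also have "\<dots> = t\<^sup>2 * c - 2 * t * (r \<bullet> (A *v v) - ?\<mu> * (r \<bullet> v))"
      using vv sym' inner_commute[of r v]
      by (simp add: c_def matrix_vector_mult_diff_distrib matrix_vector_mult_scaleR
          inner_diff_left inner_diff_right algebra_simps power2_eq_square)
    finally show ?thesis unfolding rv .
  qed
  have "r \<bullet> r = 0"
  proof (rule ccontr)
    assume "r \<bullet> r \<noteq> 0"
    then have r: "0 < r \<bullet> r" by simp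
    \<comment> \<open>Small enough for \<open>t * c\<close> to stay below
      \<open>2 * (r \<bullet> r)\<close>; the added 1 covers the case \<open>c = 0\<close>.\<close>
    define t where "t = r \<bullet> r / (\<bar>c\<bar> + 1)"
    have t: "0 < t" using r by (simp add: t_def)
    have "t * c < 2 * (r \<bullet> r)"
    proof -
      have "t * c \<le> t * (\<bar>c\<bar> + 1)" using t by (intro mult_left_mono) auto
      also have "\<dots> = r \<bullet> r" by (simp add: t_def add_eq_0_iff_both_eq_0)
      finally show ?thesis using r by linarith
    qed
    then have "t * (t * c - 2 * (r \<bullet> r)) < 0" using t by (simp add: mult_less_0_iff)
    then show False using quad[of t] by (simp add: algebra_simps power2_eq_square)
  qed
  then show ?thesis by (simp add: r_def)
qed

text \<open>A \<open>LEAST\<close> over the reals means something only if the minimum exists.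
  Compactness of the unit sphere supplies a minimizer of the form, which is an eigenvector; every
  other eigenvalue is a value of the Rayleigh quotient and so at least as large.\<close>

lemma least_eigenvalue_symmetric:
  fixes A :: "real^'n^'n"
  assumes sym: "transpose A = A"
  shows "\<exists>v. norm v = 1 \<and> A *v v = least_eigenvalue A *\<^sub>R v"
    and "least_eigenvalue A * (x \<bullet> x) \<le> x \<bullet> (A *v x)"
proof -
  have "compact (sphere (0::real^'n) 1)" "sphere (0::real^'n) 1 \<noteq> {}" by auto
  moreover have "continuous_on (sphere 0 1) (\<lambda>x. x \<bullet> (A *v x))"
    by (intro continuous_intros matrix_vector_mult_linear_continuous_on)
  ultimately obtain v where v: "norm v = 1"
    and min: "\<And>x. norm x = 1 \<Longrightarrow> v \<bullet> (A *v v) \<le> x \<bullet> (A *v x)"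
    using continuous_attains_inf[of "sphere (0::real^'n) 1" "\<lambda>x. x \<bullet> (A *v x)"]
    by (metis mem_sphere_0)
  let ?\<mu> = "v \<bullet> (A *v v)"
  have ge: "?\<mu> * (x \<bullet> x) \<le> x \<bullet> (A *v x)" for x
  proof (cases "x = 0")
    case False
    have "?\<mu> \<le> (x /\<^sub>R norm x) \<bullet> (A *v (x /\<^sub>R norm x))" using False by (intro min) simp
    also have "\<dots> = (x \<bullet> (A *v x)) / (norm x)\<^sup>2"
      by (simp add: matrix_vector_mult_scaleR power2_eq_square divide_simps)
    finally show ?thesis using False by (simp add: pos_le_divide_eq power2_norm_eq_inner)
  qed simp
  have ev: "A *v v = ?\<mu> *\<^sub>R v" by (rule Rayleigh_minimizer_eigenvector[OF sym v ge])
  have "least_eigenvalue A = ?\<mu>"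
    unfolding least_eigenvalue_def
  proof (rule Least_equality)
    show "\<exists>u. u \<noteq> 0 \<and> A *v u = ?\<mu> *\<^sub>R u" using ev v by (intro exI[of _ v]) auto
  next
    fix \<nu> assume "\<exists>u. u \<noteq> 0 \<and> A *v u = \<nu> *\<^sub>R u"
    then obtain u where u: "u \<noteq> 0" "A *v u = \<nu> *\<^sub>R u" by blast
    then show "?\<mu> \<le> \<nu>" using ge[of u] by simp
  qed
  then show "\<exists>v. norm v = 1 \<and> A *v v = least_eigenvalue A *\<^sub>R v"
    and "least_eigenvalue A * (x \<bullet> x) \<le> x \<bullet> (A *v x)"
    using ev v ge by auto
qed

section \<open>The scan design\<close>

lemma trigonometric_polynomial_zero:
  fixes c0 a1 b1 a2 b2 :: real
  assumes S: "finite S" "5 \<le> card S" "S \<subseteq> {0..<2 * pi}"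
    and zero: "\<And>t. t \<in> S \<Longrightarrow> c0 + a1 * cos t + b1 * sin t + a2 * cos (2 * t) + b2 * sin (2 * t) = 0"
  shows "c0 = 0 \<and> a1 = 0 \<and> b1 = 0 \<and> a2 = 0 \<and> b2 = 0"
proof -
  \<comment> \<open>An algebraic polynomial of degree 4 in \<open>cis t\<close>, with at most four zeros.\<close>
  define P where "P = [:Complex a2 b2, Complex a1 b1, 2 * complex_of_real c0, Complex a1 (- b1), Complex a2 (- b2):]"
  have P: "poly P (cis t) = cis (2 * t) * complex_of_real
      (2 * (c0 + a1 * cos t + b1 * sin t + a2 * cos (2 * t) + b2 * sin (2 * t)))" for t
  proof -
    have c: "Complex a b = complex_of_real a + \<i> * complex_of_real b" for a b
      by (simp add: complex_eq_iff)
    let ?z = "cis t"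
    have z: "?z * cis (- t) = 1" by (simp add: cis_mult)
    have e1: "complex_of_real (2 * cos t) = ?z + cis (- t)"
      and e2: "complex_of_real (2 * sin t) = - \<i> * (?z - cis (- t))"
      and e3: "complex_of_real (2 * cos (2 * t)) = ?z^2 + cis (- t)^2"
      and e4: "complex_of_real (2 * sin (2 * t)) = - \<i> * (?z^2 - cis (- t)^2)"
      and e5: "cis (2 * t) = ?z^2"
      by (auto simp: Complex.DeMoivre complex_eq_iff)
    have "complex_of_real (2 * (c0 + a1 * cos t + b1 * sin t + a2 * cos (2 * t) + b2 * sin (2 * t)))
      = 2 * of_real c0 + of_real a1 * complex_of_real (2 * cos t) + of_real b1 * complex_of_real (2 * sin t)
        + of_real a2 * complex_of_real (2 * cos (2 * t)) + of_real b2 * complex_of_real (2 * sin (2 * t))"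
      by (simp add: algebra_simps)
    then have "cis (2 * t) * complex_of_real
        (2 * (c0 + a1 * cos t + b1 * sin t + a2 * cos (2 * t) + b2 * sin (2 * t)))
      = ?z^2 * (2 * of_real c0 + of_real a1 * (?z + cis (- t)) - of_real b1 * \<i> * (?z - cis (- t))
        + of_real a2 * (?z^2 + cis (- t)^2) - of_real b2 * \<i> * (?z^2 - cis (- t)^2))"
      unfolding e1 e2 e3 e4 e5 by simp
    also have "\<dots> = poly P ?z"
      unfolding P_def c using z by (simp add: power2_eq_square) algebra
    finally show ?thesis by simp
  qed
  have "P = 0"
  proof (rule ccontr)
    assume "P \<noteq> 0"
    have "cis ` S \<subseteq> {z. poly P z = 0}"
      using zero by (auto simp: P)
    \<comment> \<open>The half-open interval matters: the angles 0 and \<open>2 * pi\<close> give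
      the same point of the circle. This is where the bound \<open>abar < 2 * pi\<close> on the scan
      angle has its origin.\<close>
    moreover have "inj_on cis S"
    proof (rule inj_onI)
      fix s t assume "s \<in> S" "t \<in> S" "cis s = cis t"
      then have "sin s = sin t" "cos s = cos t" "0 \<le> s" "s < 2 * pi" "0 \<le> t" "t < 2 * pi"
        using S(3) by (auto simp: complex_eq_iff)
      then obtain n :: int where n: "s = t + 2 * pi * of_int n" using sin_cos_eq_iff[of s t] by blast
      then have "2 * pi * of_int n < 2 * pi * 1" "2 * pi * (- 1) < 2 * pi * of_int n"
        using \<open>0 \<le> s\<close> \<open>s < 2 * pi\<close> \<open>0 \<le> t\<close> \<open>t < 2 * pi\<close> by linarith+
      then have "n = 0"
        unfolding mult_less_cancel_left_pos[OF mult_pos_pos[OF zero_less_numeral pi_gt_zero]] by linarith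
      with n show "s = t" by simp
    qed
    ultimately have "5 \<le> card {z. poly P z = 0}"
      using S card_mono[OF poly_roots_finite[OF \<open>P \<noteq> 0\<close>]] by (metis card_image order_trans)
    moreover have "card {z. poly P z = 0} \<le> degree P" by (rule card_poly_roots_bound[OF \<open>P \<noteq> 0\<close>])
    moreover have "degree P \<le> 4"
      unfolding P_def by (simp add: degree_pCons_le)
    ultimately show False by simp
  qed
  then show ?thesis by (auto simp: P_def complex_eq_iff)
qed

lemma scan_bearing_inj:
  assumes "5 \<le> m" "0 < abar"
  shows "inj_on (scan_bearing m abar) {1..m}"
  using assms by (auto simp: inj_on_def scan_bearing_def)

lemma scan_bearing_range:
  assumes "5 \<le> m" "0 < abar" "i \<in> {1..m}"
  shows "0 \<le> scan_bearing m abar i" "scan_bearing m abar i \<le> abar"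
proof -
  have "(real i - 1) / (real m - 1) \<le> 1" "0 \<le> (real i - 1) / (real m - 1)" using assms by auto
  then show "0 \<le> scan_bearing m abar i" "scan_bearing m abar i \<le> abar"
    using assms mult_right_mono[of "(real i - 1) / (real m - 1)" 1 abar]
    unfolding scan_bearing_def by auto
qed

section \<open>Coordinates of the regressors and of the information matrix\<close>

lemma exhaust_5: "x = 1 \<or> x = 2 \<or> x = 3 \<or> x = 4 \<or> x = (5::5)"
proof (induct x)
  case (of_int z)
  then have "0 \<le> z" "z < 5" by simp_all
  then have "z = 0 \<or> z = 1 \<or> z = 2 \<or> z = 3 \<or> z = 4" by arith
  then show ?case by auto
qed

lemma forall_5: "(\<forall>i::5. P i) \<longleftrightarrow> P 1 \<and> P 2 \<and> P 3 \<and> P 4 \<and> P 5"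
  by (metis exhaust_5)

lemma sum_5: "sum f (UNIV :: 5 set) = f 1 + f 2 + f 3 + f 4 + f 5"
proof -
  have UNIV_5: "(UNIV :: 5 set) = {1, 2, 3, 4, 5}" using exhaust_5 by auto
  show ?thesis unfolding UNIV_5 by (simp add: ac_simps)
qed

lemma vector_4 [simp]:
  "(vector [a, b, c, d] :: 'a::zero^4) $ 1 = a" "(vector [a, b, c, d] :: 'a^4) $ 2 = b"
  "(vector [a, b, c, d] :: 'a^4) $ 3 = c" "(vector [a, b, c, d] :: 'a^4) $ 4 = d"
  by (simp_all add: vector_def)

lemma vector_5 [simp]:
  "(vector [a, b, c, d, e] :: 'a::zero^5) $ 1 = a" "(vector [a, b, c, d, e] :: 'a^5) $ 2 = b"
  "(vector [a, b, c, d, e] :: 'a^5) $ 3 = c" "(vector [a, b, c, d, e] :: 'a^5) $ 4 = d"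
  "(vector [a, b, c, d, e] :: 'a^5) $ 5 = e"
  by (simp_all add: vector_def)

lemma gram_Suc: "gram a (Suc n) = gram a n + outer (regressor a (Suc n)) (regressor a (Suc n))"
  by (simp add: gram_def outer_def vec_eq_iff)

lemma V_mat_Suc:
  "V_mat lam a (Suc n) = V_mat lam a n + outer (regressor a (Suc n)) (regressor a (Suc n))"
  by (simp add: V_mat_def gram_Suc)

lemma gram_symmetric: "transpose (gram a n) = gram a n"
  by (simp add: gram_def transpose_def vec_eq_iff mult.commute)

lemma gram_form: "x \<bullet> (gram a n *v x) = (\<Sum>i=1..n. (regressor a i \<bullet> x)\<^sup>2)"
proof (induction n)
  case 0
  have "gram a 0 = 0" by (simp add: gram_def vec_eq_iff)
  then show ?case by simp
next
  case (Suc n)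
  then show ?case
    by (simp add: gram_Suc matrix_vector_mult_add_rdistrib inner_add_right outer_mult_vec
        power2_eq_square inner_commute)
qed

lemma V_mat_1: "V_mat lam a 1 = V_one lam"
  by (auto simp: V_mat_def reg_weight_def gram_def V_one_def regressor_def axis_def vec_eq_iff)

lemma reg_weight_mult_vec: "(reg_weight lam *v x) $ r = (if r = 1 then 0 else lam * x $ r)"
proof -
  have "(reg_weight lam *v x) $ r = (\<Sum>s\<in>UNIV. if r = s then (if r = 1 then 0 else lam * x $ r) else 0)"
    unfolding matrix_vector_mult_def reg_weight_def vec_lambda_beta by (rule sum.cong) auto
  also have "\<dots> = (if r = 1 then 0 else lam * x $ r)" by simp
  finally show ?thesis .
qed

lemma V_mat_form:
  "x \<bullet> (V_mat lam a n *v x)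
    = lam * ((x $ 2)\<^sup>2 + (x $ 3)\<^sup>2 + (x $ 4)\<^sup>2 + (x $ 5)\<^sup>2) + (\<Sum>i=1..n. (regressor a i \<bullet> x)\<^sup>2)"
proof -
  have "x \<bullet> (reg_weight lam *v x) = lam * ((x $ 2)\<^sup>2 + (x $ 3)\<^sup>2 + (x $ 4)\<^sup>2 + (x $ 5)\<^sup>2)"
    by (simp add: inner_vec_def sum_5 reg_weight_mult_vec power2_eq_square algebra_simps)
  then show ?thesis
    by (simp add: V_mat_def matrix_vector_mult_add_rdistrib inner_add_right gram_form)
qed

text \<open>The regularization controls the coordinates 2 to 5 and the first regressor, a unit
  vector, controls coordinate 1; hence the start at \<open>n = 1\<close>. Later samples only add
  rank-one terms.\<close>

lemma pos_def_V_mat: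
  assumes "0 < lam" "1 \<le> n"
  shows "pos_def (V_mat lam a n)"
  using \<open>1 \<le> n\<close>
proof (induction n rule: dec_induct)
  case base
  have "0 < x \<bullet> (V_mat lam a 1 *v x)" if "x \<noteq> 0" for x
  proof -
    have "x \<bullet> (V_mat lam a 1 *v x)
      = lam * ((x $ 2)\<^sup>2 + (x $ 3)\<^sup>2 + (x $ 4)\<^sup>2 + (x $ 5)\<^sup>2) + (x $ 1)\<^sup>2"
      unfolding V_mat_form by (simp add: regressor_def inner_axis')
    moreover have "x $ 1 \<noteq> 0 \<or> x $ 2 \<noteq> 0 \<or> x $ 3 \<noteq> 0 \<or> x $ 4 \<noteq> 0 \<or> x $ 5 \<noteq> 0"
      using that by (auto simp: vec_eq_iff forall_5)
    then have "0 < (x $ 2)\<^sup>2 + (x $ 3)\<^sup>2 + (x $ 4)\<^sup>2 + (x $ 5)\<^sup>2 \<or> x $ 1 \<noteq> 0"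
      by (auto simp: order_less_le add_nonneg_eq_0_iff eq_commute[of 0])
    ultimately show ?thesis
      using assms(1) by (auto intro: add_nonneg_pos add_pos_nonneg)
  qed
  moreover have "transpose (V_one lam) = V_one lam"
    by (simp add: V_one_def transpose_def vec_eq_iff)
  ultimately show ?case unfolding pos_def_def V_mat_1 by blast
next
  case (step n)
  then show ?case unfolding V_mat_Suc by (intro pos_def_add_outer)
qed

lemma det_V_one: "det (V_one lam) = lam ^ 4"
proof -
  have "det (V_one lam) = (\<Prod>i\<in>UNIV. V_one lam $ i $ i)"
    by (rule det_diagonal) (simp add: V_one_def)
  also have "\<dots> = (\<Prod>i\<in>UNIV - {1 :: 5}. lam)"
    by (subst prod.remove[of _ "1"]) (auto simp: V_one_def intro!: prod.cong)
  finally show ?thesis by (simp add: card_Diff_singleton)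
qed

text \<open>If the minimum were 0, a unit eigenvector \<open>v\<close> would be orthogonal to all
  regressors. Its entries would then be the coefficients of a trigonometric polynomial of degree 2
  that vanishes at \<open>m \<ge> 5\<close> distinct bearings, hence zero.\<close>

lemma kappa_pos:
  assumes "5 \<le> m" "0 < abar" "abar < 2 * pi"
  shows "0 < kappa m abar"
proof -
  let ?a = "scan_bearing m abar" let ?A = "(1 / real m) *\<^sub>R gram ?a m"
  have "transpose ?A = ?A"
    using gram_symmetric[of ?a m] by (simp add: transpose_def vec_eq_iff)
  from least_eigenvalue_symmetric(1)[OF this] obtain v
    where v: "norm v = 1" "?A *v v = kappa m abar *\<^sub>R v" unfolding kappa_def by blast
  have "v \<bullet> (?A *v v) = kappa m abar"
    unfolding v(2) using v(1) by (simp add: norm_eq_sqrt_inner)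
  then have k: "kappa m abar = (1 / real m) * (\<Sum>i=1..m. (regressor ?a i \<bullet> v)\<^sup>2)"
    by (simp add: scaleR_matrix_vector_assoc[symmetric] gram_form)
  have "(\<Sum>i=1..m. (regressor ?a i \<bullet> v)\<^sup>2) \<noteq> 0"
  proof
    assume "(\<Sum>i=1..m. (regressor ?a i \<bullet> v)\<^sup>2) = 0"
    then have 0: "regressor ?a i \<bullet> v = 0" if "i \<in> {1..m}" for i
      using that by (subst (asm) sum_nonneg_eq_0_iff) auto
    let ?z = "harmonics (?a 1)"
    \<comment> \<open>The constant term that remains once the subtraction of the harmonics at the
      first bearing is undone.\<close>
    let ?c = "v $ 1 - (v $ 2 * ?z $ 1 + v $ 3 * ?z $ 2 + v $ 4 * ?z $ 3 + v $ 5 * ?z $ 4)"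
    have v1: "v $ 1 = 0" using 0[of 1] assms by (simp add: regressor_def inner_axis')
    have trig: "?c + v $ 2 * cos t + v $ 3 * sin t + v $ 4 * cos (2 * t) + v $ 5 * sin (2 * t) = 0"
      if "t \<in> ?a ` {1..m}" for t
    proof -
      from that obtain i where i: "i \<in> {1..m}" "t = ?a i" by blast
      show ?thesis
      proof (cases "i = 1")
        \<comment> \<open>At the first bearing the harmonics cancel against their own values in
          \<open>?c\<close>, and \<open>v $ 1\<close> remains.\<close>
        case True
        then show ?thesis using v1 i by (simp add: harmonics_def)
      next
        case False
        then show ?thesis using 0[OF i(1)] i(2)
          by (simp add: regressor_def Let_def inner_vec_def sum_5 harmonics_def algebra_simps)
      qed
    qed
    have "?c = 0 \<and> v $ 2 = 0 \<and> v $ 3 = 0 \<and> v $ 4 = 0 \<and> v $ 5 = 0"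
    proof (rule trigonometric_polynomial_zero[OF _ _ _ trig])
      show "5 \<le> card (?a ` {1..m})"
        using card_image[OF scan_bearing_inj[of m abar]] assms by simp
      show "?a ` {1..m} \<subseteq> {0..<2 * pi}"
        using scan_bearing_range[of m abar] assms by force
    qed auto
    then have "v = 0" using v1 by (auto simp: vec_eq_iff forall_5)
    then show False using v(1) by simp
  qed
  then have "0 < (\<Sum>i=1..m. (regressor ?a i \<bullet> v)\<^sup>2)"
    by (simp add: sum_nonneg order_less_le)
  then show ?thesis unfolding k using assms by simp
qed

lemma kappa_le_V_mat_form:
  assumes "5 \<le> m" "0 < lam"
  shows "real m * kappa m abar * (x \<bullet> x) \<le> x \<bullet> (V_mat lam (scan_bearing m abar) m *v x)"
proof -
  let ?a = "scan_bearing m abar" let ?A = "(1 / real m) *\<^sub>R gram ?a m"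
  have "transpose ?A = ?A"
    using gram_symmetric[of ?a m] by (simp add: transpose_def vec_eq_iff)
  from least_eigenvalue_symmetric(2)[OF this, of x]
  have "kappa m abar * (x \<bullet> x) \<le> (x \<bullet> (gram ?a m *v x)) / real m"
    unfolding kappa_def by (simp add: scaleR_matrix_vector_assoc[symmetric])
  then have "real m * kappa m abar * (x \<bullet> x) \<le> x \<bullet> (gram ?a m *v x)"
    using assms by (simp add: field_simps)
  also have "\<dots> \<le> x \<bullet> (V_mat lam ?a m *v x)"
    using assms by (simp add: V_mat_form gram_form)
  finally show ?thesis .
qed

section \<open>A self-normalized bound for sub-Gaussian noise\<close>

text \<open>The form in which the noise hypothesis is used: integrated against any nonnegative
  weight \<open>Z\<close> known to \<open>H\<close>. Working in \<open>ennreal\<close> keeps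
  integrability of the product out of all later steps.\<close>

lemma cond_subgaussian_mgf_le:
  assumes "prob_space M" and sub: "subalgebra M H" and X: "cond_subgaussian M H \<sigma> X"
    and Z: "Z \<in> borel_measurable H"
  shows "(\<integral>\<^sup>+\<omega>. Z \<omega> * ennreal (exp (s * X \<omega>)) \<partial>M) \<le> (\<integral>\<^sup>+\<omega>. Z \<omega> * ennreal (exp (s\<^sup>2 * \<sigma>\<^sup>2 / 2)) \<partial>M)"
proof -
  interpret prob_space M by fact
  interpret finite_measure_subalgebra M H by unfold_locales (rule sub)
  let ?g = "\<lambda>\<omega>. exp (s * X \<omega>)"
  have int: "integrable M ?g" and le: "AE \<omega> in M. real_cond_exp M H ?g \<omega> \<le> exp (s\<^sup>2 * \<sigma>\<^sup>2 / 2)"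
    using X by (auto simp: cond_subgaussian_def)
  have [measurable]: "?g \<in> borel_measurable M" using int by auto
  \<comment> \<open>\<open>real_cond_exp\<close> is a difference of two values of
    \<open>enn2real\<close>, which sends infinity to 0. The bound passes to
    \<open>nn_cond_exp\<close> only once the negative part is known to vanish and the positive part
    to be finite almost everywhere.\<close>
  have "AE \<omega> in M. nn_cond_exp M H (\<lambda>_. 0) \<omega> = 0"
    using nn_cond_exp_F_meas[of "\<lambda>_. 0"] by auto
  moreover have "(\<integral>\<^sup>+\<omega>. nn_cond_exp M H (\<lambda>\<omega>. ennreal (?g \<omega>)) \<omega> \<partial>M) \<noteq> \<infinity>"
    using nn_cond_exp_intg[of "\<lambda>_. 1" "\<lambda>\<omega>. ennreal (?g \<omega>)"] int
    by (simp add: integrable_iff_bounded)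
  then have "AE \<omega> in M. nn_cond_exp M H (\<lambda>\<omega>. ennreal (?g \<omega>)) \<omega> \<noteq> \<infinity>"
    by (intro nn_integral_noteq_infinite) auto
  ultimately have "AE \<omega> in M. nn_cond_exp M H (\<lambda>\<omega>. ennreal (?g \<omega>)) \<omega> \<le> ennreal (exp (s\<^sup>2 * \<sigma>\<^sup>2 / 2))"
    using le
  proof eventually_elim
    case (elim \<omega>)
    have "ennreal (- ?g \<omega>) = 0" for \<omega> by (simp add: ennreal_neg)
    with elim have "enn2real (nn_cond_exp M H (\<lambda>\<omega>. ennreal (?g \<omega>)) \<omega>) \<le> exp (s\<^sup>2 * \<sigma>\<^sup>2 / 2)"
      by (simp add: real_cond_exp_def)
    then show ?case using elim(2)
      by (metis ennreal_enn2real_if ennreal_leI infinity_ennreal_def)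
  qed
  then have "(\<integral>\<^sup>+\<omega>. Z \<omega> * nn_cond_exp M H (\<lambda>\<omega>. ennreal (?g \<omega>)) \<omega> \<partial>M)
      \<le> (\<integral>\<^sup>+\<omega>. Z \<omega> * ennreal (exp (s\<^sup>2 * \<sigma>\<^sup>2 / 2)) \<partial>M)"
    by (intro nn_integral_mono_AE) (auto elim!: eventually_mono intro!: mult_left_mono)
  then show ?thesis using nn_cond_exp_intg[OF Z, of "\<lambda>\<omega>. ennreal (?g \<omega>)"] by simp
qed

lemma cond_subgaussian_mgf:
  assumes "prob_space M" "subalgebra M H" and X: "cond_subgaussian M H \<sigma> X"
  shows "(\<integral>\<omega>. exp (s * X \<omega>) \<partial>M) \<le> exp (s\<^sup>2 * \<sigma>\<^sup>2 / 2)"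
proof -
  interpret prob_space M by fact
  have "integrable M (\<lambda>\<omega>. exp (s * X \<omega>))" using X by (auto simp: cond_subgaussian_def)
  then have "ennreal (\<integral>\<omega>. exp (s * X \<omega>) \<partial>M) = (\<integral>\<^sup>+\<omega>. 1 * ennreal (exp (s * X \<omega>)) \<partial>M)"
    by (simp add: nn_integral_eq_integral)
  also have "\<dots> \<le> (\<integral>\<^sup>+\<omega>. 1 * ennreal (exp (s\<^sup>2 * \<sigma>\<^sup>2 / 2)) \<partial>M)"
    using assms by (rule cond_subgaussian_mgf_le) auto
  finally show ?thesis by (simp add: emeasure_space_1)
qed

text \<open>The sum of the exponentials of \<open>X\<close> and \<open>- X\<close>, minus 2, is a
  square, and with variance proxy 0 its integral is at most 0. This settles the case
  \<open>\<sigma> = 0\<close>, in which the arguments below would divide by zero.\<close>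

lemma cond_subgaussian_zero:
  assumes "prob_space M" "subalgebra M H" and X: "cond_subgaussian M H 0 X"
  shows "AE \<omega> in M. X \<omega> = 0"
proof -
  interpret prob_space M by fact
  let ?f = "\<lambda>\<omega>. exp (1 * X \<omega>) + exp (- 1 * X \<omega>) - 2"
  have int: "integrable M (\<lambda>\<omega>. exp (s * X \<omega>))" for s using X by (auto simp: cond_subgaussian_def)
  have eq: "?f \<omega> = (exp (X \<omega> / 2) - exp (- X \<omega> / 2))\<^sup>2" for \<omega>
    by (simp add: power2_eq_square algebra_simps flip: exp_add)
  have f: "0 \<le> ?f \<omega>" for \<omega> unfolding eq by simp
  have intf: "integrable M ?f" using int[of 1] int[of "- 1"] by auto
  have "(\<integral>\<omega>. ?f \<omega> \<partial>M) \<le> 0"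
    using cond_subgaussian_mgf[OF assms, of 1] cond_subgaussian_mgf[OF assms, of "- 1"]
      int[of 1] int[of "- 1"] by (simp add: prob_space)
  then have "(\<integral>\<omega>. ?f \<omega> \<partial>M) = 0"
    using f by (intro antisym integral_nonneg_AE) auto
  then have "AE \<omega> in M. ?f \<omega> = 0"
    using integral_nonneg_eq_0_iff_AE[OF intf] f by auto
  then show ?thesis by eventually_elim (unfold eq, simp)
qed

lemma cond_subgaussian_tail:
  assumes M: "prob_space M" and sub: "subalgebra M H" and X: "cond_subgaussian M H \<sigma> X"
    and \<sigma>: "0 \<le> \<sigma>" and d: "0 < d" "d \<le> 1"
  shows "measure M {\<omega> \<in> space M. \<sigma> * sqrt (2 * ln (2 / d)) < \<bar>X \<omega>\<bar>} \<le> d"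
proof -
  interpret prob_space M by fact
  have [measurable]: "X \<in> borel_measurable M" using X by (auto simp: cond_subgaussian_def)
  show ?thesis
  proof (cases "\<sigma> = 0")
    case True
    have "AE \<omega> in M. X \<omega> = 0"
      using cond_subgaussian_zero[OF M sub] X True by simp
    then have "measure M {\<omega> \<in> space M. \<sigma> * sqrt (2 * ln (2 / d)) < \<bar>X \<omega>\<bar>} = 0"
      using True by (subst prob_eq_0) auto
    then show ?thesis using d by simp
  next
    case False
    with \<sigma> have \<sigma>: "0 < \<sigma>" by simp
    define t where "t = \<sigma> * sqrt (2 * ln (2 / d))"
    have ln: "0 < ln (2 / d)" using d by simp
    have t: "0 < t" "t\<^sup>2 = \<sigma>\<^sup>2 * (2 * ln (2 / d))"
      using \<sigma> ln by (auto simp: t_def power_mult_distrib)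
    have tail: "measure M {\<omega> \<in> space M. t \<le> a * X \<omega>} \<le> d / 2" if a: "a = 1 \<or> a = -1" for a
    proof -
      \<comment> \<open>The Chernoff parameter that minimizes
        \<open>s\<^sup>2 * \<sigma>\<^sup>2 / 2 - s * t\<close>; each of the two signs then costs
        \<open>d / 2\<close>.\<close>
      let ?s = "t / \<sigma>\<^sup>2"
      have "measure M {\<omega> \<in> space M. t \<le> a * X \<omega>}
          \<le> measure M {\<omega> \<in> space M. exp (?s * t) \<le> exp (?s * a * X \<omega>)}"
        using t \<sigma> by (intro finite_measure_mono) (auto simp: field_simps mult_left_mono)
      also have "\<dots> \<le> (\<integral>\<omega>. exp (?s * a * X \<omega>) \<partial>M) / exp (?s * t)"
      proof (rule integral_Markov_inequality_measure[where A = "{}"])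
        show "integrable M (\<lambda>\<omega>. exp (?s * a * X \<omega>))"
          using X unfolding cond_subgaussian_def by blast
      qed auto
      also have "\<dots> \<le> exp ((?s * a)\<^sup>2 * \<sigma>\<^sup>2 / 2) / exp (?s * t)"
        by (intro divide_right_mono cond_subgaussian_mgf[OF M sub X]) auto
      also have "\<dots> = exp (- (t\<^sup>2 / (2 * \<sigma>\<^sup>2)))"
        using a \<sigma> by (auto simp: power2_eq_square field_simps simp flip: exp_diff)
      also have "\<dots> = exp (- ln (2 / d))" unfolding t(2) using \<sigma> by simp
      also have "\<dots> = d / 2" using d by (simp add: exp_minus)
      finally show ?thesis .
    qed
    have "measure M {\<omega> \<in> space M. t < \<bar>X \<omega>\<bar>}
      \<le> measure M ({\<omega> \<in> space M. t \<le> 1 * X \<omega>} \<union> {\<omega> \<in> space M. t \<le> - 1 * X \<omega>})"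
      by (intro finite_measure_mono) auto
    also have "\<dots> \<le> d / 2 + d / 2"
      by (rule order_trans[OF measure_Un_le]) (use tail[of 1] tail[of "- 1"] in auto)
    finally show ?thesis by (simp add: t_def)
  qed
qed

section \<open>Gaussian mixing and the maximal inequality\<close>

lemma nn_integral_normal_density:
  assumes "0 < \<tau>" shows "(\<integral>\<^sup>+x. ennreal (normal_density \<mu> \<tau> x) \<partial>lborel) = 1"
proof -
  interpret prob_space "density lborel (normal_density \<mu> \<tau>)"
    by (rule prob_space_normal_density[OF assms])
  show ?thesis using emeasure_space_1 by (simp add: emeasure_density)
qed

text \<open>Completing the square turns the integrand into \<open>?K\<close> times a normal density
  with mean \<open>?\<mu>\<close> and variance \<open>q / (1 + q)\<close>. The weights come from the
  Gaussian with mean \<open>V\<^sup>-\<^sup>1 S / \<sigma>\<close> and covariance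
  \<open>V\<^sup>-\<^sup>1\<close>: \<open>s\<close> and \<open>q\<close> are the mean and variance
  of its component along the new regressor, so one real variable suffices.\<close>

lemma gaussian_mixture:
  assumes q: "0 < q"
  shows "(\<integral>\<^sup>+x. ennreal (normal_density s (sqrt q) x * exp (x * w - x\<^sup>2 / 2)) \<partial>lborel)
    = ennreal (exp ((2 * s * w + q * w\<^sup>2 - s\<^sup>2) / (2 * (1 + q))) / sqrt (1 + q))"
proof -
  let ?K = "exp ((2 * s * w + q * w\<^sup>2 - s\<^sup>2) / (2 * (1 + q))) / sqrt (1 + q)"
  let ?\<mu> = "(s + q * w) / (1 + q)" and ?\<tau> = "sqrt (q / (1 + q))"
  have eq: "normal_density s (sqrt q) x * exp (x * w - x\<^sup>2 / 2) = ?K * normal_density ?\<mu> ?\<tau> x" for x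
  proof -
    have "- (x - s)\<^sup>2 / (2 * q) + (x * w - x\<^sup>2 / 2)
        = (2 * s * w + q * w\<^sup>2 - s\<^sup>2) / (2 * (1 + q)) + - (x - ?\<mu>)\<^sup>2 / (2 * (q / (1 + q)))"
    proof -
      define m where "m = ?\<mu>"
      have m: "m * (1 + q) = s + q * w" using q by (simp add: m_def)
      have "(- (x - s)\<^sup>2 + 2 * q * (x * w - x\<^sup>2 / 2)) * (1 + q)
        = q * (2 * s * w + q * w\<^sup>2 - s\<^sup>2) - (1 + q)\<^sup>2 * (x - m)\<^sup>2"
        using m by algebra
      then have "- (x - s)\<^sup>2 + 2 * q * (x * w - x\<^sup>2 / 2)
        = (q * (2 * s * w + q * w\<^sup>2 - s\<^sup>2) - (1 + q)\<^sup>2 * (x - m)\<^sup>2) / (1 + q)"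
        using q by (simp add: eq_divide_eq)
      moreover have "(q * R - (1 + q)\<^sup>2 * D) / (1 + q) / (2 * q) = R / (2 * (1 + q)) + - D / (2 * (q / (1 + q)))"
        for R D using q by (simp add: diff_divide_distrib power2_eq_square mult.commute)
      moreover have "- (x - s)\<^sup>2 / (2 * q) + (x * w - x\<^sup>2 / 2) = (- (x - s)\<^sup>2 + 2 * q * (x * w - x\<^sup>2 / 2)) / (2 * q)"
        using q by (simp add: add_divide_distrib diff_divide_distrib)
      ultimately show ?thesis unfolding m_def[symmetric] by presburger
    qed
    then have "exp (- (x - s)\<^sup>2 / (2 * q)) * exp (x * w - x\<^sup>2 / 2)
      = exp ((2 * s * w + q * w\<^sup>2 - s\<^sup>2) / (2 * (1 + q))) * exp (- (x - ?\<mu>)\<^sup>2 / (2 * (q / (1 + q))))"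
      unfolding exp_add[symmetric] by simp
    moreover have "1 / sqrt (2 * pi * q) = 1 / sqrt (1 + q) * (1 / sqrt (2 * pi * (q / (1 + q))))"
      using q by (simp add: real_sqrt_mult real_sqrt_divide)
    ultimately show ?thesis using q by (simp add: normal_density_def)
  qed
  have "(\<integral>\<^sup>+x. ennreal (normal_density s (sqrt q) x * exp (x * w - x\<^sup>2 / 2)) \<partial>lborel)
    = (\<integral>\<^sup>+x. ennreal ?K * ennreal (normal_density ?\<mu> ?\<tau> x) \<partial>lborel)"
    unfolding eq using q by (intro nn_integral_cong ennreal_mult) auto
  also have "\<dots> = ennreal ?K"
    using q nn_integral_normal_density[of ?\<tau> ?\<mu>] by (simp add: nn_integral_cmult)
  finally show ?thesis .
qed

text \<open>
  Mixing over \<open>x\<close> with the Gaussian of \<open>gaussian_mixture\<close> reduces the claim to the bound on the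
  conditional moment generating function at the deterministic points \<open>x / \<sigma>\<close>.
\<close>

lemma cond_subgaussian_mixture_step:
  assumes M: "prob_space M" and sub: "subalgebra M H" and X: "cond_subgaussian M H \<sigma> X"
    and \<sigma>: "0 < \<sigma>" and q: "0 < q"
    and Z: "Z \<in> borel_measurable H" and s: "s \<in> borel_measurable H"
  shows "(\<integral>\<^sup>+\<omega>. Z \<omega> * ennreal (exp ((2 * s \<omega> * X \<omega> + q * (X \<omega>)\<^sup>2 - (s \<omega>)\<^sup>2) / (1 + q) / (2 * \<sigma>\<^sup>2)) / sqrt (1 + q)) \<partial>M)
    \<le> (\<integral>\<^sup>+\<omega>. Z \<omega> \<partial>M)"
proof -
  interpret prob_space M by fact
  interpret pair_sigma_finite M "lborel :: real measure" ..
  have [measurable]: "X \<in> borel_measurable M" using X by (auto simp: cond_subgaussian_def)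
  have [measurable]: "Z \<in> borel_measurable M" "s \<in> borel_measurable M"
    using measurable_from_subalg[OF sub] Z s by auto
  let ?n = "\<lambda>\<omega> x. normal_density (s \<omega> / \<sigma>) (sqrt q) x"
  have [measurable]: "(\<lambda>(\<omega>, x). ?n \<omega> x) \<in> borel_measurable (M \<Otimes>\<^sub>M lborel)"
    unfolding normal_density_def by measurable
  have mix: "ennreal (exp ((2 * s \<omega> * X \<omega> + q * (X \<omega>)\<^sup>2 - (s \<omega>)\<^sup>2) / (1 + q) / (2 * \<sigma>\<^sup>2)) / sqrt (1 + q))
    = (\<integral>\<^sup>+x. ennreal (?n \<omega> x * exp (x * (X \<omega> / \<sigma>) - x\<^sup>2 / 2)) \<partial>lborel)" for \<omega>
  proof -
    have "(2 * s \<omega> * X \<omega> + q * (X \<omega>)\<^sup>2 - (s \<omega>)\<^sup>2) / (1 + q) / (2 * \<sigma>\<^sup>2)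
      = (2 * (s \<omega> / \<sigma>) * (X \<omega> / \<sigma>) + q * (X \<omega> / \<sigma>)\<^sup>2 - (s \<omega> / \<sigma>)\<^sup>2) / (2 * (1 + q))"
    proof -
      have "2 * (s \<omega> / \<sigma>) * (X \<omega> / \<sigma>) + q * (X \<omega> / \<sigma>)\<^sup>2 - (s \<omega> / \<sigma>)\<^sup>2
        = (2 * s \<omega> * X \<omega> + q * (X \<omega>)\<^sup>2 - (s \<omega>)\<^sup>2) / \<sigma>\<^sup>2"
        by (simp add: power_divide power2_eq_square add_divide_distrib diff_divide_distrib)
      then show ?thesis by (simp add: mult_ac)
    qed
    then show ?thesis unfolding gaussian_mixture[OF q] by presburger
  qed
  have "(\<integral>\<^sup>+\<omega>. Z \<omega> * ennreal (exp ((2 * s \<omega> * X \<omega> + q * (X \<omega>)\<^sup>2 - (s \<omega>)\<^sup>2) / (1 + q) / (2 * \<sigma>\<^sup>2)) / sqrt (1 + q)) \<partial>M)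
    = (\<integral>\<^sup>+\<omega>. (\<integral>\<^sup>+x. Z \<omega> * ennreal (?n \<omega> x * exp (x * (X \<omega> / \<sigma>) - x\<^sup>2 / 2)) \<partial>lborel) \<partial>M)"
    unfolding mix by (intro nn_integral_cong nn_integral_cmult[symmetric]) measurable
  also have "\<dots> = (\<integral>\<^sup>+x. (\<integral>\<^sup>+\<omega>. Z \<omega> * ennreal (?n \<omega> x * exp (x * (X \<omega> / \<sigma>) - x\<^sup>2 / 2)) \<partial>M) \<partial>lborel)"
    by (rule Fubini'[symmetric]) measurable
  also have "\<dots> \<le> (\<integral>\<^sup>+x. (\<integral>\<^sup>+\<omega>. Z \<omega> * ennreal (?n \<omega> x) \<partial>M) \<partial>lborel)"
  proof (rule nn_integral_mono)
    fix x :: real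
    \<comment> \<open>For fixed \<open>x\<close> the density depends on the outcome only through
      \<open>s\<close>, so this weight is known to \<open>H\<close>. Its factor
      \<open>exp (- x\<^sup>2 / 2)\<close> exactly cancels the bound on the moment generating
      function at \<open>x / \<sigma>\<close>.\<close>
    let ?Z = "\<lambda>\<omega>. Z \<omega> * ennreal (?n \<omega> x * exp (- x\<^sup>2 / 2))"
    have ZH: "?Z \<in> borel_measurable H"
      using Z s unfolding normal_density_def by measurable
    have "(\<integral>\<^sup>+\<omega>. Z \<omega> * ennreal (?n \<omega> x * exp (x * (X \<omega> / \<sigma>) - x\<^sup>2 / 2)) \<partial>M)
        = (\<integral>\<^sup>+\<omega>. ?Z \<omega> * ennreal (exp (x / \<sigma> * X \<omega>)) \<partial>M)"
    proof (intro nn_integral_cong)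
      fix \<omega>
      have eq: "?n \<omega> x * exp (x * (X \<omega> / \<sigma>) - x\<^sup>2 / 2) = ?n \<omega> x * exp (- x\<^sup>2 / 2) * exp (x / \<sigma> * X \<omega>)"
        by (simp add: mult.assoc flip: exp_add)
      show "Z \<omega> * ennreal (?n \<omega> x * exp (x * (X \<omega> / \<sigma>) - x\<^sup>2 / 2)) = ?Z \<omega> * ennreal (exp (x / \<sigma> * X \<omega>))"
        unfolding eq by (simp only: ennreal_mult''[OF exp_ge_zero]) (simp only: mult.assoc)
    qed
    also have "\<dots> \<le> (\<integral>\<^sup>+\<omega>. ?Z \<omega> * ennreal (exp ((x / \<sigma>)\<^sup>2 * \<sigma>\<^sup>2 / 2)) \<partial>M)"
      by (rule cond_subgaussian_mgf_le[OF M sub X ZH])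
    also have "\<dots> = (\<integral>\<^sup>+\<omega>. Z \<omega> * ennreal (?n \<omega> x) \<partial>M)"
    proof (intro nn_integral_cong)
      fix \<omega>
      have "exp (- x\<^sup>2 / 2) * exp ((x / \<sigma>)\<^sup>2 * \<sigma>\<^sup>2 / 2) = 1"
        using \<sigma> by (simp add: power_divide flip: exp_add)
      then have "?n \<omega> x * exp (- x\<^sup>2 / 2) * exp ((x / \<sigma>)\<^sup>2 * \<sigma>\<^sup>2 / 2) = ?n \<omega> x"
        by (simp add: mult.assoc)
      then show "?Z \<omega> * ennreal (exp ((x / \<sigma>)\<^sup>2 * \<sigma>\<^sup>2 / 2)) = Z \<omega> * ennreal (?n \<omega> x)"
        by (simp only: mult.assoc flip: ennreal_mult''[OF exp_ge_zero])
    qed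
    finally show "(\<integral>\<^sup>+\<omega>. Z \<omega> * ennreal (?n \<omega> x * exp (x * (X \<omega> / \<sigma>) - x\<^sup>2 / 2)) \<partial>M)
      \<le> (\<integral>\<^sup>+\<omega>. Z \<omega> * ennreal (?n \<omega> x) \<partial>M)" .
  qed
  also have "\<dots> = (\<integral>\<^sup>+\<omega>. (\<integral>\<^sup>+x. Z \<omega> * ennreal (?n \<omega> x) \<partial>lborel) \<partial>M)"
    by (rule Fubini') measurable
  also have "\<dots> = (\<integral>\<^sup>+\<omega>. Z \<omega> \<partial>M)"
    using q by (intro nn_integral_cong) (simp add: nn_integral_cmult nn_integral_normal_density)
  finally show ?thesis .
qed


text \<open>Ville's inequality for a process that is adapted only while it is alive, that is, on the
  decreasing events \<open>T n\<close>. The outcomes are split by first crossing: \<open>A n\<close>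
  is alive and below \<open>c\<close> before \<open>n\<close>, \<open>B n\<close> crosses at
  \<open>n\<close>, \<open>D n\<close> stays below. The mass on \<open>D n\<close> pays for all
  later crossings, and what dies with \<open>T\<close> is lost on the favourable side because
  \<open>U\<close> is nonnegative.\<close>

lemma stopped_maximal_inequality:
  fixes U :: "nat \<Rightarrow> 'w \<Rightarrow> ennreal" and T :: "nat \<Rightarrow> 'w set"
  assumes M: "prob_space M"
    and U: "\<And>n. n \<in> {1..N} \<Longrightarrow> U n \<in> borel_measurable M"
    and T: "\<And>n. n \<in> {1..N} \<Longrightarrow> T n \<in> sets M" "\<And>n. T (Suc n) \<subseteq> T n"
    and U1: "\<And>\<omega>. U 1 \<omega> \<le> 1"
    and meas: "\<And>n j. n \<in> {1..<N} \<Longrightarrow> j \<in> {1..n} \<Longrightarrow> {\<omega> \<in> T (Suc n). U j \<omega> < c} \<in> sets (H n)"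
    and step: "\<And>n A. n \<in> {1..<N} \<Longrightarrow> A \<in> sets (H n) \<Longrightarrow> A \<subseteq> T (Suc n) \<Longrightarrow>
      (\<integral>\<^sup>+\<omega>. indicator A \<omega> * U (Suc n) \<omega> \<partial>M) \<le> (\<integral>\<^sup>+\<omega>. indicator A \<omega> * U n \<omega> \<partial>M)"
  shows "c * emeasure M {\<omega> \<in> space M. \<exists>n\<in>{1..N}. \<omega> \<in> T n \<and> c \<le> U n \<omega>} \<le> 1"
proof -
  interpret prob_space M by fact
  define A where "A n = {\<omega> \<in> T n. \<forall>j\<in>{1..<n}. U j \<omega> < c}" for n
  define B where "B n = {\<omega> \<in> A n. c \<le> U n \<omega>}" for n
  define D where "D n = {\<omega> \<in> A n. U n \<omega> < c}" for n
  have Am: "A n \<in> sets M" and Bm: "B n \<in> sets M" and Dm: "D n \<in> sets M" if "n \<in> {1..N}" for n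
  proof -
    have T': "T n \<in> sets M" and U': "\<And>j. j \<in> {1..n} \<Longrightarrow> U j \<in> borel_measurable M"
      using that T U by auto
    have "{\<omega> \<in> space M. \<omega> \<in> T n \<and> (\<forall>j\<in>{1..<n}. U j \<omega> < c)} \<in> sets M"
    proof (intro sets.sets_Collect_conj sets.sets_Collect_finite_All)
      show "{\<omega> \<in> space M. \<omega> \<in> T n} \<in> sets M" using T' by simp
      fix j assume "j \<in> {1..<n}"
      then have [measurable]: "U j \<in> borel_measurable M" using U' by simp
      show "{\<omega> \<in> space M. U j \<omega> < c} \<in> sets M" by measurable
    qed simp
    also have "{\<omega> \<in> space M. \<omega> \<in> T n \<and> (\<forall>j\<in>{1..<n}. U j \<omega> < c)} = A n"
      using sets.sets_into_space[OF T'] by (auto simp: A_def)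
    finally show A': "A n \<in> sets M" .
    have "U n \<in> borel_measurable M" using U that by auto
    then have "{\<omega> \<in> space M. c \<le> U n \<omega>} \<inter> A n \<in> sets M" "{\<omega> \<in> space M. U n \<omega> < c} \<inter> A n \<in> sets M"
      using A' by auto
    moreover have "{\<omega> \<in> space M. c \<le> U n \<omega>} \<inter> A n = B n" "{\<omega> \<in> space M. U n \<omega> < c} \<inter> A n = D n"
      using sets.sets_into_space[OF A'] by (auto simp: B_def D_def)
    ultimately show "B n \<in> sets M" "D n \<in> sets M" by auto
  qed
  have split: "c * emeasure M (B n) + (\<integral>\<^sup>+\<omega>. indicator (D n) \<omega> * U n \<omega> \<partial>M)
      \<le> (\<integral>\<^sup>+\<omega>. indicator (A n) \<omega> * U n \<omega> \<partial>M)" if n: "n \<in> {1..N}" for n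
  proof -
    note [measurable] = Am[OF n] Bm[OF n] Dm[OF n] U[OF n]
    have "c * emeasure M (B n) + (\<integral>\<^sup>+\<omega>. indicator (D n) \<omega> * U n \<omega> \<partial>M)
      = (\<integral>\<^sup>+\<omega>. c * indicator (B n) \<omega> + indicator (D n) \<omega> * U n \<omega> \<partial>M)"
      by (subst nn_integral_add) (auto simp: nn_integral_cmult)
    also have "\<dots> \<le> (\<integral>\<^sup>+\<omega>. indicator (A n) \<omega> * U n \<omega> \<partial>M)"
      by (intro nn_integral_mono) (auto simp: B_def D_def indicator_def not_less)
    finally show ?thesis .
  qed
  have partial: "c * (\<Sum>i=1..n. emeasure M (B i)) + (\<integral>\<^sup>+\<omega>. indicator (D n) \<omega> * U n \<omega> \<partial>M) \<le> 1"
    if "1 \<le> n" "n \<le> N" for n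
    using that
  proof (induction n rule: dec_induct)
    case base
    have "(\<integral>\<^sup>+\<omega>. indicator (A 1) \<omega> * U 1 \<omega> \<partial>M) \<le> (\<integral>\<^sup>+\<omega>. 1 \<partial>M)"
      using U1 by (intro nn_integral_mono) (auto simp: indicator_def)
    then show ?case using split[of 1] base by (simp add: emeasure_space_1)
  next
    case (step n)
    then have n: "n \<in> {1..<N}" "Suc n \<in> {1..N}" by auto
    have AD: "A (Suc n) = D n \<inter> T (Suc n)"
      using T(2)[of n] n(1) by (auto simp: A_def D_def less_Suc_eq)
    \<comment> \<open>Only the sets cut by \<open>T (Suc n)\<close> are known to lie in
      \<open>H n\<close>, so \<open>A (Suc n)\<close> has to be written as an intersection of such
      sets; \<open>T (Suc n)\<close> is absorbed because the index set contains 1.\<close>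
    have "A (Suc n) = T (Suc n) \<inter> (\<Inter>j\<in>{1..n}. {\<omega> \<in> T (Suc n). U j \<omega> < c})"
      by (auto simp: A_def)
    also have "\<dots> = (\<Inter>j\<in>{1..n}. {\<omega> \<in> T (Suc n). U j \<omega> < c})" 
    proof -
      have "1 \<in> {1..n}" using n by simp
      then show ?thesis by blast
    qed
    also have "\<dots> \<in> sets (H n)" using n meas[of n] by (intro sets.finite_INT) auto
    finally have AH: "A (Suc n) \<in> sets (H n)" .
    have "c * emeasure M (B (Suc n)) + (\<integral>\<^sup>+\<omega>. indicator (D (Suc n)) \<omega> * U (Suc n) \<omega> \<partial>M)
      \<le> (\<integral>\<^sup>+\<omega>. indicator (A (Suc n)) \<omega> * U (Suc n) \<omega> \<partial>M)" by (rule split[OF n(2)])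
    also have "\<dots> \<le> (\<integral>\<^sup>+\<omega>. indicator (A (Suc n)) \<omega> * U n \<omega> \<partial>M)"
      by (rule assms(7)[OF n(1) AH]) (auto simp: A_def)
    also have "\<dots> \<le> (\<integral>\<^sup>+\<omega>. indicator (D n) \<omega> * U n \<omega> \<partial>M)"
      by (intro nn_integral_mono) (auto simp: AD indicator_def)
    finally have D: "c * emeasure M (B (Suc n)) + (\<integral>\<^sup>+\<omega>. indicator (D (Suc n)) \<omega> * U (Suc n) \<omega> \<partial>M)
      \<le> (\<integral>\<^sup>+\<omega>. indicator (D n) \<omega> * U n \<omega> \<partial>M)" .
    have "c * (\<Sum>i=1..n. emeasure M (B i)) + (\<integral>\<^sup>+\<omega>. indicator (D n) \<omega> * U n \<omega> \<partial>M) \<le> 1"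
      using step by simp
    from order_trans[OF add_left_mono[OF D] this] have "c * (\<Sum>i=1..n. emeasure M (B i)) + (c * emeasure M (B (Suc n))
        + (\<integral>\<^sup>+\<omega>. indicator (D (Suc n)) \<omega> * U (Suc n) \<omega> \<partial>M)) \<le> 1"
      .
    moreover have "(\<Sum>i=1..Suc n. emeasure M (B i)) = (\<Sum>i=1..n. emeasure M (B i)) + emeasure M (B (Suc n))"
      by simp
    ultimately show ?case by (simp only: distrib_left add.assoc)
  qed
  have sum: "c * (\<Sum>i=1..N. emeasure M (B i)) \<le> 1"
  proof (cases "N = 0")
    case False
    have "c * (\<Sum>i=1..N. emeasure M (B i))
      \<le> c * (\<Sum>i=1..N. emeasure M (B i)) + (\<integral>\<^sup>+\<omega>. indicator (D N) \<omega> * U N \<omega> \<partial>M)"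
      by (rule add_increasing2[OF zero_le order_refl])
    also have "\<dots> \<le> 1" using False by (intro partial) auto
    finally show ?thesis .
  qed simp
  have "{\<omega> \<in> space M. \<exists>n\<in>{1..N}. \<omega> \<in> T n \<and> c \<le> U n \<omega>} \<subseteq> (\<Union>i\<in>{1..N}. B i)"
  proof safe
    fix \<omega> n assume n: "n \<in> {1..N}" "\<omega> \<in> T n" "c \<le> U n \<omega>"
    \<comment> \<open>The time of the first crossing. Since \<open>T\<close> decreases, an outcome
      alive at \<open>n\<close> is alive at the earlier time \<open>k\<close>.\<close>
    define k where "k = (LEAST k. k \<in> {1..N} \<and> c \<le> U k \<omega>)"
    have k: "k \<in> {1..N} \<and> c \<le> U k \<omega>" unfolding k_def
      by (rule LeastI[of "\<lambda>k. k \<in> {1..N} \<and> c \<le> U k \<omega>" n]) (use n in simp)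
    have "k \<le> n" unfolding k_def by (rule Least_le) (use n in simp)
    then have "T n \<subseteq> T k" by (rule lift_Suc_antimono_le[of T, OF T(2)])
    moreover have "U j \<omega> < c" if "j \<in> {1..<k}" for j
    proof -
      have "\<not> (j \<in> {1..N} \<and> c \<le> U j \<omega>)"
        by (rule not_less_Least[of j "\<lambda>k. k \<in> {1..N} \<and> c \<le> U k \<omega>"])
          (use that in \<open>simp add: k_def\<close>)
      then show ?thesis using that k by simp
    qed
    ultimately have "\<omega> \<in> B k" using n k by (auto simp: B_def A_def)
    then show "\<omega> \<in> (\<Union>i\<in>{1..N}. B i)" using k by blast
  qed
  then have "emeasure M {\<omega> \<in> space M. \<exists>n\<in>{1..N}. \<omega> \<in> T n \<and> c \<le> U n \<omega>} \<le> emeasure M (\<Union>i\<in>{1..N}. B i)"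
    using Bm by (intro emeasure_mono sets.finite_UN) auto
  also have "\<dots> \<le> (\<Sum>i=1..N. emeasure M (B i))"
    using Bm by (intro emeasure_subadditive_finite) auto
  finally have "c * emeasure M {\<omega> \<in> space M. \<exists>n\<in>{1..N}. \<omega> \<in> T n \<and> c \<le> U n \<omega>}
    \<le> c * (\<Sum>i=1..N. emeasure M (B i))" by (rule mult_left_mono) simp
  then show ?thesis using sum by (rule order_trans)
qed


text \<open>The process \<open>U\<close> starts at 1 because the sum \<open>S\<close> is empty at
  \<open>n = 1\<close>. The matrices are deterministic, so \<open>q\<close> is a constant in each
  step, and a nonzero regressor makes it positive, as the Gaussian mixture requires. Taking
  logarithms of \<open>U n < c\<close> gives the stated bound.\<close>

lemma self_normalized_bound:
  fixes V :: "nat \<Rightarrow> real^'n^'n" and \<psi> :: "nat \<Rightarrow> real^'n" and X :: "nat \<Rightarrow> 'w \<Rightarrow> real"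
  assumes M: "prob_space M" and \<sigma>: "0 \<le> \<sigma>" and c: "0 < c"
    and V1: "pos_def (V 1)"
    and V_Suc: "\<And>n. 1 \<le> n \<Longrightarrow> V (Suc n) = V n + outer (\<psi> (Suc n)) (\<psi> (Suc n))"
    and \<psi>: "\<And>n. \<psi> n \<noteq> 0"
    and T: "\<And>n. n \<in> {1..N} \<Longrightarrow> T n \<in> sets M" "\<And>n. T (Suc n) \<subseteq> T n"
    and sub: "\<And>n. n \<in> {1..<N} \<Longrightarrow> subalgebra M (H n)"
    and TH: "\<And>n. n \<in> {1..<N} \<Longrightarrow> T (Suc n) \<in> sets (H n)"
    and XH: "\<And>n j. n \<in> {1..<N} \<Longrightarrow> j \<in> {2..n} \<Longrightarrow>
      (\<lambda>\<omega>. indicator (T (Suc n)) \<omega> * X j \<omega>) \<in> borel_measurable (H n)"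
    and X: "\<And>n. n \<in> {1..<N} \<Longrightarrow> cond_subgaussian M (H n) \<sigma> (X (Suc n))"
  defines "S \<equiv> \<lambda>n \<omega>. \<Sum>i=2..n. X i \<omega> *\<^sub>R \<psi> i"
  obtains B where "B \<in> sets M" "measure M B \<le> 1 / c"
    "\<And>n \<omega>. n \<in> {1..N} \<Longrightarrow> \<omega> \<in> space M - B \<Longrightarrow> \<omega> \<in> T n \<Longrightarrow>
      S n \<omega> \<bullet> (matrix_inv (V n) *v S n \<omega>) \<le> 2 * \<sigma>\<^sup>2 * ln (c * sqrt (det (V n) / det (V 1)))"
proof -
  interpret prob_space M by fact
  have Xm: "X i \<in> borel_measurable M" if "i \<in> {2..N}" for i
  proof -
    obtain j where "i = Suc j" "j \<in> {1..<N}" using \<open>i \<in> {2..N}\<close> by (cases i) auto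
    then show ?thesis using X[of j] by (auto simp: cond_subgaussian_def)
  qed
  show thesis
  proof (cases "\<sigma> = 0")
    case True
    define B where "B = {\<omega> \<in> space M. \<exists>i\<in>{2..N}. X i \<omega> \<noteq> 0}"
    have B: "B \<in> sets M" unfolding B_def using Xm by (intro sets.sets_Collect_finite_Ex) auto
    have "AE \<omega> in M. X i \<omega> = 0" if "i \<in> {2..N}" for i
    proof -
      obtain j where "i = Suc j" "j \<in> {1..<N}" using \<open>i \<in> {2..N}\<close> by (cases i) auto
      then show ?thesis using cond_subgaussian_zero[OF M sub[of j]] X[of j] True by blast
    qed
    then have "AE \<omega> in M. \<forall>i\<in>{2..N}. X i \<omega> = 0" by (intro AE_finite_allI) auto
    then have "prob B = 0" unfolding B_def using B[unfolded B_def] by (subst prob_eq_0) auto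
    moreover have "S n \<omega> = 0" if "n \<in> {1..N}" "\<omega> \<in> space M - B" for n \<omega>
      using that unfolding S_def B_def by (intro sum.neutral) auto
    ultimately show thesis using B c True by (intro that[of B]) auto
  next
    case False
    with \<sigma> have \<sigma>: "0 < \<sigma>" by simp
    have V: "pos_def (V n)" if "1 \<le> n" for n
      using that
    proof (induction n rule: dec_induct)
      case base
      show ?case by (rule V1)
    next
      case (step n)
      then show ?case by (simp add: V_Suc pos_def_add_outer)
    qed
    define q where "q n = \<psi> (Suc n) \<bullet> (matrix_inv (V n) *v \<psi> (Suc n))" for n
    have q: "0 < q n" if "1 \<le> n" for n
      using pos_def_matrix_inv[OF V[OF that]] \<psi> by (auto simp: q_def pos_def_def)
    define R where "R n = det (V n) / det (V 1)" for n
    have det1: "det (V 1) \<noteq> 0" using pos_def_invertible[OF V1] by (simp add: invertible_det_nz)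
    have R1: "R 1 = 1" using det1 by (simp add: R_def)
    have R_Suc: "R (Suc n) = R n * (1 + q n)" if "1 \<le> n" for n
      using det_add_outer[OF pos_def_invertible[OF V[OF that]]] by (simp add: R_def V_Suc[OF that] q_def)
    have R: "0 < R n" if "1 \<le> n" for n
      using that
    proof (induction n rule: dec_induct)
      case base
      show ?case unfolding R1 by simp
    next
      case (step n)
      then show ?case using R_Suc[of n] q[of n] by simp
    qed
    define f where "f n x = exp (x \<bullet> (matrix_inv (V n) *v x) / (2 * \<sigma>\<^sup>2)) / sqrt (R n)" for n x
    have f_cont: "f n \<in> borel_measurable borel" for n
    proof -
      have "(\<lambda>x. x \<bullet> (matrix_inv (V n) *v x)) \<in> borel_measurable borel"
        by (intro borel_measurable_continuous_onI continuous_intros matrix_vector_mult_linear_continuous_on)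
      then show ?thesis unfolding f_def by measurable
    qed
    define U where "U n \<omega> = ennreal (f n (S n \<omega>))" for n \<omega>
    have Sm: "S n \<in> borel_measurable M" if "n \<in> {1..N}" for n
      unfolding S_def using Xm that by (intro borel_measurable_sum borel_measurable_scaleR) auto
    \<comment> \<open>The noise is known to \<open>H k\<close> only after multiplication by the
      indicator of \<open>T (Suc k)\<close>. \<open>S'\<close> is the version of \<open>S\<close>
      that is \<open>H k\<close>-measurable everywhere and agrees with \<open>S\<close> on that
      event.\<close>
    define S' where "S' k n \<omega> = (\<Sum>i=2..n. (indicator (T (Suc k)) \<omega> * X i \<omega>) *\<^sub>R \<psi> i)" for k n \<omega>
    have S'm: "S' k n \<in> borel_measurable (H k)" if "k \<in> {1..<N}" "n \<le> k" for k n
      unfolding S'_def using XH[OF that(1)] that by (intro borel_measurable_sum borel_measurable_scaleR) auto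
    have S'_eq: "S' k n \<omega> = S n \<omega>" if "\<omega> \<in> T (Suc k)" for k n \<omega>
      using that by (simp add: S'_def S_def)
    have "ennreal c * emeasure M {\<omega> \<in> space M. \<exists>n\<in>{1..N}. \<omega> \<in> T n \<and> ennreal c \<le> U n \<omega>} \<le> 1"
    proof (rule stopped_maximal_inequality[where M = M and N = N and U = U and T = T and H = H])
      fix n assume "n \<in> {1..N}"
      then show "U n \<in> borel_measurable M"
        unfolding U_def using measurable_compose[OF Sm f_cont] by simp
    next
      fix \<omega> show "U 1 \<omega> \<le> 1" by (simp add: U_def f_def S_def R1[simplified])
    next
      fix n show "n \<in> {1..N} \<Longrightarrow> T n \<in> sets M" "T (Suc n) \<subseteq> T n" by (fact T)+
    next
      fix n j assume n: "n \<in> {1..<N}" and j: "j \<in> {1..n}"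
      have "(\<lambda>\<omega>. ennreal (f j (S' n j \<omega>))) \<in> borel_measurable (H n)"
        using measurable_compose[OF S'm f_cont, of n j j] n j by simp
      then have "{\<omega> \<in> space (H n). ennreal (f j (S' n j \<omega>)) < ennreal c} \<in> sets (H n)"
        by measurable
      then have "T (Suc n) \<inter> {\<omega> \<in> space (H n). ennreal (f j (S' n j \<omega>)) < ennreal c} \<in> sets (H n)"
        using TH[OF n] by blast
      also have "T (Suc n) \<inter> {\<omega> \<in> space (H n). ennreal (f j (S' n j \<omega>)) < ennreal c}
        = {\<omega> \<in> T (Suc n). U j \<omega> < ennreal c}"
        using sets.sets_into_space[OF TH[OF n]] by (auto simp: U_def S'_eq)
      finally show "{\<omega> \<in> T (Suc n). U j \<omega> < ennreal c} \<in> sets (H n)" .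
    next
      fix n A assume n: "n \<in> {1..<N}" and A: "A \<in> sets (H n)" "A \<subseteq> T (Suc n)"
      define Z where "Z \<omega> = indicator A \<omega> * ennreal (f n (S' n n \<omega>))" for \<omega>
      define s where "s \<omega> = \<psi> (Suc n) \<bullet> (matrix_inv (V n) *v S' n n \<omega>)" for \<omega>
      have n1: "1 \<le> n" using n by simp
      have Z: "Z \<in> borel_measurable (H n)"
        unfolding Z_def using measurable_compose[OF S'm f_cont, of n n n] n A(1) by simp
      have "(\<lambda>x. \<psi> (Suc n) \<bullet> (matrix_inv (V n) *v x)) \<in> borel_measurable borel"
        by (intro borel_measurable_continuous_onI continuous_intros matrix_vector_mult_linear_continuous_on)
      then have s: "s \<in> borel_measurable (H n)"
        unfolding s_def using measurable_compose[OF S'm, of n n] n by simp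
      \<comment> \<open>The update of the form supplies the exponential and the update of the
        determinant supplies \<open>sqrt (1 + q n)\<close>, so the new value is the old one times
        the factor of the mixture step.\<close>
      have "indicator A \<omega> * U (Suc n) \<omega>
        = Z \<omega> * ennreal (exp ((2 * s \<omega> * X (Suc n) \<omega> + q n * (X (Suc n) \<omega>)\<^sup>2 - (s \<omega>)\<^sup>2)
            / (1 + q n) / (2 * \<sigma>\<^sup>2)) / sqrt (1 + q n))" for \<omega>
      proof (cases "\<omega> \<in> A")
        case True
        then have eq: "S' n n \<omega> = S n \<omega>" using A by (intro S'_eq) auto
        have S_Suc: "S (Suc n) \<omega> = S n \<omega> + X (Suc n) \<omega> *\<^sub>R \<psi> (Suc n)"
          using n1 by (simp add: S_def)
        have "f (Suc n) (S (Suc n) \<omega>)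
          = f n (S n \<omega>) * (exp ((2 * s \<omega> * X (Suc n) \<omega> + q n * (X (Suc n) \<omega>)\<^sup>2 - (s \<omega>)\<^sup>2)
            / (1 + q n) / (2 * \<sigma>\<^sup>2)) / sqrt (1 + q n))"
          unfolding f_def S_Suc V_Suc[OF n1] R_Suc[OF n1]
            Sherman_Morrison_form[OF V[OF n1] q_def s_def[of \<omega>, unfolded eq]]
          by (simp add: add_divide_distrib exp_add real_sqrt_mult eq)
        then have "U (Suc n) \<omega> = ennreal (f n (S n \<omega>)) * ennreal (exp ((2 * s \<omega> * X (Suc n) \<omega>
            + q n * (X (Suc n) \<omega>)\<^sup>2 - (s \<omega>)\<^sup>2) / (1 + q n) / (2 * \<sigma>\<^sup>2)) / sqrt (1 + q n))"
          unfolding U_def using R[OF n1] q[OF n1] by (simp only:) (intro ennreal_mult, auto simp: f_def)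
        then show ?thesis using True by (simp add: Z_def eq)
      qed (simp add: Z_def)
      then have "(\<integral>\<^sup>+\<omega>. indicator A \<omega> * U (Suc n) \<omega> \<partial>M) \<le> (\<integral>\<^sup>+\<omega>. Z \<omega> \<partial>M)"
        using cond_subgaussian_mixture_step[OF M sub[OF n] X[OF n] \<sigma> q[OF n1] Z s] by simp
      also have "\<dots> = (\<integral>\<^sup>+\<omega>. indicator A \<omega> * U n \<omega> \<partial>M)"
        using A S'_eq by (intro nn_integral_cong) (auto simp: Z_def U_def indicator_def subset_iff)
      finally show "(\<integral>\<^sup>+\<omega>. indicator A \<omega> * U (Suc n) \<omega> \<partial>M) \<le> (\<integral>\<^sup>+\<omega>. indicator A \<omega> * U n \<omega> \<partial>M)" .
    qed (fact M)
    moreover define B where "B = {\<omega> \<in> space M. \<exists>n\<in>{1..N}. \<omega> \<in> T n \<and> ennreal c \<le> U n \<omega>}"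
    ultimately have "ennreal (c * measure M B) \<le> 1"
      using c by (simp add: emeasure_eq_measure ennreal_mult)
    then have "measure M B \<le> 1 / c" using c by (simp add: ennreal_le_1 field_simps)
    moreover have "B \<in> sets M"
      unfolding B_def
    proof (intro sets.sets_Collect_finite_Ex sets.sets_Collect_conj)
      fix n assume n: "n \<in> {1..N}"
      show "{\<omega> \<in> space M. \<omega> \<in> T n} \<in> sets M" using T(1)[OF n] by simp
      have "U n \<in> borel_measurable M"
        unfolding U_def using measurable_compose[OF Sm[OF n] f_cont] by simp
      then show "{\<omega> \<in> space M. ennreal c \<le> U n \<omega>} \<in> sets M" by measurable
    qed simp
    moreover have "S n \<omega> \<bullet> (matrix_inv (V n) *v S n \<omega>) \<le> 2 * \<sigma>\<^sup>2 * ln (c * sqrt (det (V n) / det (V 1)))"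
      if "n \<in> {1..N}" "\<omega> \<in> space M - B" "\<omega> \<in> T n" for n \<omega>
    proof -
      have Rn: "0 < R n" using R[of n] that by simp
      have "U n \<omega> < ennreal c" using that by (auto simp: B_def not_le)
      then have "f n (S n \<omega>) < c" by (simp add: U_def ennreal_less_iff f_def Rn less_imp_le)
      then have "exp (S n \<omega> \<bullet> (matrix_inv (V n) *v S n \<omega>) / (2 * \<sigma>\<^sup>2)) < c * sqrt (R n)"
        using Rn by (simp add: f_def pos_divide_less_eq)
      then have "S n \<omega> \<bullet> (matrix_inv (V n) *v S n \<omega>) / (2 * \<sigma>\<^sup>2) \<le> ln (c * sqrt (R n))"
        using c Rn by (simp add: ln_ge_iff)
      then show ?thesis using \<sigma> by (simp add: R_def field_simps)
    qed
    ultimately show thesis by (intro that[of B])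
  qed
qed

section \<open>Taylor expansion of the field\<close>

lemma has_derivative_fderiv:
  assumes "f differentiable at x"
  shows "(f has_derivative blinfun_apply (fderiv f x)) (at x)"
proof -
  have d: "(f has_derivative frechet_derivative f (at x)) (at x)"
    using assms by (simp add: frechet_derivative_works)
  then have "blinfun_apply (fderiv f x) = frechet_derivative f (at x)"
    unfolding fderiv_def by (intro bounded_linear_Blinfun_apply has_derivative_bounded_linear)
  with d show ?thesis by simp
qed

lemma has_vector_derivative_line:
  assumes "\<And>x. f differentiable at x"
  shows "((\<lambda>t. f (p + t *\<^sub>R u)) has_vector_derivative blinfun_apply (fderiv f (p + t *\<^sub>R u)) u) (at t)"
proof -
  have line: "((\<lambda>t. p + t *\<^sub>R u) has_derivative (\<lambda>h. h *\<^sub>R u)) (at t)"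
    by (auto intro!: derivative_eq_intros)
  have "((\<lambda>t. f (p + t *\<^sub>R u)) has_derivative (\<lambda>h. blinfun_apply (fderiv f (p + t *\<^sub>R u)) (h *\<^sub>R u))) (at t)"
    by (rule has_derivative_compose[OF line has_derivative_fderiv[OF assms]])
  then show ?thesis by (simp add: has_vector_derivative_def blinfun.scaleR_right)
qed

text \<open>In an iterated derivative the direction of the latest differentiation is the first
  argument; the arguments behind it stay fixed while the point moves along the line.\<close>

lemma C3_line_derivatives:
  fixes F :: "'a::real_normed_vector \<Rightarrow> real"
  assumes "C3 F"
  shows "((\<lambda>t. F (p + t *\<^sub>R u)) has_real_derivative fderiv F (p + t *\<^sub>R u) u) (at t)"
    and "((\<lambda>t. fderiv F (p + t *\<^sub>R u) v) has_real_derivative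
      fderiv (fderiv F) (p + t *\<^sub>R u) u v) (at t)"
    and "((\<lambda>t. fderiv (fderiv F) (p + t *\<^sub>R u) v v) has_real_derivative
      fderiv (fderiv (fderiv F)) (p + t *\<^sub>R u) u v v) (at t)"
proof -
  have d: "\<And>x. F differentiable at x" "\<And>x. fderiv F differentiable at x"
    "\<And>x. fderiv (fderiv F) differentiable at x"
    using assms by (auto simp: C3_def)
  note bl = bounded_linear.has_vector_derivative
  show "((\<lambda>t. F (p + t *\<^sub>R u)) has_real_derivative fderiv F (p + t *\<^sub>R u) u) (at t)"
    unfolding has_real_derivative_iff_has_vector_derivative by (rule has_vector_derivative_line[OF d(1)])
  show "((\<lambda>t. fderiv F (p + t *\<^sub>R u) v) has_real_derivative fderiv (fderiv F) (p + t *\<^sub>R u) u v) (at t)"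
    unfolding has_real_derivative_iff_has_vector_derivative
    by (rule bl[OF blinfun.bounded_linear_left has_vector_derivative_line[OF d(2)]])
  show "((\<lambda>t. fderiv (fderiv F) (p + t *\<^sub>R u) v v) has_real_derivative
      fderiv (fderiv (fderiv F)) (p + t *\<^sub>R u) u v v) (at t)"
    unfolding has_real_derivative_iff_has_vector_derivative
    by (rule bl[OF blinfun.bounded_linear_left
          bl[OF blinfun.bounded_linear_left has_vector_derivative_line[OF d(3)]]])
qed

text \<open>\<open>grad\<close> is a definite description, so both existence and uniqueness have to
  be shown. The vector \<open>D\<close> collects the derivatives along the basis.\<close>

lemma fderiv_eq_inner_grad:
  fixes F :: "'a::euclidean_space \<Rightarrow> real"
  assumes "F differentiable at p"
  shows "fderiv F p v = grad F p \<bullet> v"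
proof -
  define D where "D = (\<Sum>b\<in>Basis. fderiv F p b *\<^sub>R b)"
  have D: "fderiv F p v = v \<bullet> D" for v
  proof -
    have "fderiv F p v = fderiv F p (\<Sum>b\<in>Basis. (v \<bullet> b) *\<^sub>R b)" by (simp add: euclidean_representation)
    also have "\<dots> = (\<Sum>b\<in>Basis. (v \<bullet> b) * fderiv F p b)"
      by (simp only: blinfun.sum_right blinfun.scaleR_right real_scaleR_def)
    also have "\<dots> = v \<bullet> D" by (simp add: D_def inner_sum_right mult.commute)
    finally show ?thesis .
  qed
  have "blinfun_apply (fderiv F p) = (\<lambda>h. h \<bullet> D)" by (rule ext) (rule D)
  then have g: "GDERIV F p :> D"
    using has_derivative_fderiv[OF assms] by (simp add: gderiv_def)
  have "grad F p = D"
    unfolding grad_def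
  proof (rule the_equality)
    show "GDERIV F p :> D" by (rule g)
  next
    fix D' assume "GDERIV F p :> D'"
    then have "(\<lambda>h. h \<bullet> D') = (\<lambda>h. h \<bullet> D)"
      using g unfolding gderiv_def by (rule has_derivative_unique)
    then have "(D' - D) \<bullet> D' = (D' - D) \<bullet> D" by metis
    then have "(D' - D) \<bullet> (D' - D) = 0" by (simp add: inner_diff_right)
    then show "D' = D" by simp
  qed
  then show ?thesis by (simp add: D inner_commute)
qed

text \<open>The second derivative is a limit of difference quotients of the gradient, and the
  Lipschitz condition bounds each of them.\<close>

lemma second_derivative_bound:
  fixes F :: "'a::euclidean_space \<Rightarrow> real"
  assumes C3: "C3 F" and L: "\<And>p q. norm (grad F p - grad F q) \<le> L * norm (p - q)"
  shows "\<bar>fderiv (fderiv F) p u v\<bar> \<le> L * norm u * norm v"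
proof -
  have d: "F differentiable at x" for x using C3 by (simp add: C3_def)
  define h where "h t = fderiv F (p + t *\<^sub>R u) v" for t
  have "(h has_real_derivative fderiv (fderiv F) (p + 0 *\<^sub>R u) u v) (at 0)"
    unfolding h_def by (rule C3_line_derivatives(2)[OF C3])
  then have "((\<lambda>t. (h (0 + t) - h 0) / t) \<longlongrightarrow> fderiv (fderiv F) p u v) (at 0)"
    by (simp add: DERIV_def)
  then have lim: "((\<lambda>t. \<bar>(h (0 + t) - h 0) / t\<bar>) \<longlongrightarrow> \<bar>fderiv (fderiv F) p u v\<bar>) (at 0)"
    by (rule tendsto_rabs)
  have "\<bar>(h (0 + t) - h 0) / t\<bar> \<le> L * norm u * norm v" if "t \<noteq> 0" for t
  proof -
    have "\<bar>h t - h 0\<bar> = \<bar>(grad F (p + t *\<^sub>R u) - grad F p) \<bullet> v\<bar>"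
      by (simp add: h_def fderiv_eq_inner_grad[OF d] inner_diff_left)
    also have "\<dots> \<le> norm (grad F (p + t *\<^sub>R u) - grad F p) * norm v" by (rule Cauchy_Schwarz_ineq2)
    also have "\<dots> \<le> (L * norm (t *\<^sub>R u)) * norm v"
      using L[of "p + t *\<^sub>R u" p] by (intro mult_right_mono) auto
    finally show ?thesis using that by (simp add: abs_divide divide_le_eq mult_ac)
  qed
  then show ?thesis
    by (intro tendsto_upperbound[OF lim]) (auto simp: eventually_at intro!: exI[of _ 1])
qed

lemma Taylor_line_third_order:
  fixes F :: "'a::real_normed_vector \<Rightarrow> real"
  assumes C3: "C3 F" and M3: "\<And>p. norm (fderiv (fderiv (fderiv F)) p) \<le> M3"
    and \<rho>: "0 < \<rho>" and u: "norm u = 1"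
  shows "\<bar>F (p + \<rho> *\<^sub>R u) - (F p + \<rho> * fderiv F p u + \<rho>\<^sup>2 / 2 * fderiv (fderiv F) p u u)\<bar> \<le> M3 * \<rho>^3 / 6"
proof -
  define D where "D k t = (if k = 0 then F (p + t *\<^sub>R u) else if k = 1 then fderiv F (p + t *\<^sub>R u) u
    else if k = 2 then fderiv (fderiv F) (p + t *\<^sub>R u) u u
    else fderiv (fderiv (fderiv F)) (p + t *\<^sub>R u) u u u)" for k :: nat and t :: real
  have "\<exists>t>0. t < \<rho> \<and> F (p + \<rho> *\<^sub>R u) = (\<Sum>m<3. D m 0 / fact m * \<rho> ^ m) + D 3 t / fact 3 * \<rho> ^ 3"
  proof (rule Maclaurin[OF \<rho>])
    show "D 0 = (\<lambda>t. F (p + t *\<^sub>R u))" by (rule ext) (simp add: D_def)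
    have "k = 0 \<or> k = 1 \<or> k = 2" if "k < 3" for k :: nat using that by auto
    then show "\<forall>k t. k < 3 \<and> 0 \<le> t \<and> t \<le> \<rho> \<longrightarrow> (D k has_real_derivative D (Suc k) t) (at t)"
      using C3_line_derivatives[OF C3] unfolding D_def by fastforce
  qed simp
  then obtain t where t: "F (p + \<rho> *\<^sub>R u) = (\<Sum>m<3. D m 0 / fact m * \<rho> ^ m) + D 3 t / fact 3 * \<rho> ^ 3"
    by blast
  have rem: "F (p + \<rho> *\<^sub>R u) - (F p + \<rho> * fderiv F p u + \<rho>\<^sup>2 / 2 * fderiv (fderiv F) p u u) = D 3 t * \<rho> ^ 3 / 6"
    unfolding t by (simp add: eval_nat_numeral D_def fact_numeral)
  have "\<bar>D 3 t\<bar> \<le> M3"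
  proof -
    let ?T = "fderiv (fderiv (fderiv F)) (p + t *\<^sub>R u)"
    have "norm (?T u u u) \<le> norm (?T u u) * norm u" by (rule norm_blinfun)
    also have "norm (?T u u) \<le> norm (?T u) * norm u" by (rule norm_blinfun)
    also have "norm (?T u) \<le> norm ?T * norm u" by (rule norm_blinfun)
    also have "norm ?T \<le> M3" by (rule M3)
    finally show ?thesis using u by (simp add: D_def)
  qed
  then show ?thesis unfolding rem using \<rho> by (simp add: abs_mult mult_right_mono)
qed

text \<open>Taylor's formula on the segment with Lagrange remainder, the second derivative being at
  most \<open>L\<close> times the squared length.\<close>

lemma descent_lemma:
  fixes F :: "'a::euclidean_space \<Rightarrow> real"
  assumes C3: "C3 F" and L: "\<And>p q. norm (grad F p - grad F q) \<le> L * norm (p - q)"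
  shows "F (p + d) \<le> F p + grad F p \<bullet> d + L / 2 * (norm d)\<^sup>2"
proof -
  have d: "F differentiable at x" for x using C3 by (simp add: C3_def)
  define D where "D k t = (if k = 0 then F (p + t *\<^sub>R d) else if k = 1 then fderiv F (p + t *\<^sub>R d) d
    else fderiv (fderiv F) (p + t *\<^sub>R d) d d)" for k :: nat and t :: real
  have "\<exists>t>0. t < 1 \<and> F (p + 1 *\<^sub>R d) = (\<Sum>m<2. D m 0 / fact m * 1 ^ m) + D 2 t / fact 2 * 1 ^ 2"
  proof (rule Maclaurin[OF zero_less_one])
    show "D 0 = (\<lambda>t. F (p + t *\<^sub>R d))" by (rule ext) (simp add: D_def)
    have "k = 0 \<or> k = 1" if "k < 2" for k :: nat using that by auto
    then show "\<forall>k t. k < 2 \<and> 0 \<le> t \<and> t \<le> 1 \<longrightarrow> (D k has_real_derivative D (Suc k) t) (at t)"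
      using C3_line_derivatives[OF C3] unfolding D_def by fastforce
  qed simp
  then obtain t where "F (p + d) = F p + fderiv F p d + D 2 t / 2"
    by (auto simp: eval_nat_numeral D_def)
  moreover have "D 2 t \<le> L * (norm d)\<^sup>2"
    using second_derivative_bound[OF C3 L, of "p + t *\<^sub>R d" d d]
    by (simp add: D_def power2_eq_square mult.assoc)
  ultimately show ?thesis by (simp add: fderiv_eq_inner_grad[OF d])
qed

section \<open>Harmonics of the field along the sensor circle\<close>

lemma direction_simps [simp]: "direction t $ 1 = cos t" "direction t $ 2 = sin t"
  by (simp_all add: direction_def)

lemma norm_direction [simp]: "norm (direction t) = 1"
  by (simp add: norm_eq_sqrt_inner inner_vec_def sum_2 flip: power2_eq_square)

lemma direction_add:
  "direction (t + a) = cos a *\<^sub>R direction t + sin a *\<^sub>R direction (t + pi / 2)"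
  by (simp add: vec_eq_iff forall_2 cos_add sin_add mult.commute)

lemma transpose_rot_mult_vec:
  "(transpose (rot t) *v x) $ 1 = x \<bullet> direction t" "(transpose (rot t) *v x) $ 2 = x \<bullet> direction (t + pi / 2)"
  by (simp_all add: rot_def transpose_def vector_matrix_mult_def inner_vec_def sum_2 cos_add sin_add mult.commute
      del: transpose_matrix_vector add: matrix_vector_mult_def)

lemma quadratic_form_harmonics:
  fixes B11 B12 B21 B22 :: real
  shows "(cos a)\<^sup>2 * B11 + cos a * sin a * (B12 + B21) + (sin a)\<^sup>2 * B22
    = (B11 + B22) / 2 + (B11 - B22) / 2 * cos (2 * a) + (B12 + B21) / 2 * sin (2 * a)"
proof -
  have "(cos a)\<^sup>2 = (1 + cos (2 * a)) / 2" "(sin a)\<^sup>2 = (1 - cos (2 * a)) / 2" "cos a * sin a = sin (2 * a) / 2"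
    by (simp_all add: cos_double sin_double cos_squared_eq)
  then show ?thesis by (simp only:) (simp add: field_simps)
qed

text \<open>On the unit circle of the plane spanned by \<open>e1\<close> and \<open>e2\<close> the
  form is a constant plus a second harmonic of amplitude \<open>r\<close> and phase
  \<open>t\<close>. Its values at the angles \<open>t / 2\<close> and \<open>t / 2 + pi / 2\<close>
  differ by \<open>2 * r\<close>, and each is at most \<open>L\<close> in modulus.\<close>

lemma second_harmonic_bound:
  fixes B :: "'a::real_inner \<Rightarrow>\<^sub>L 'a \<Rightarrow>\<^sub>L real"
  assumes B: "\<And>u v. \<bar>B u v\<bar> \<le> L * norm u * norm v" and L: "0 \<le> L"
    and e: "norm e1 = 1" "norm e2 = 1" "e1 \<bullet> e2 = 0"
  shows "((B e1 e1 - B e2 e2) / 2)\<^sup>2 + ((B e1 e2 + B e2 e1) / 2)\<^sup>2 \<le> L\<^sup>2"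
proof -
  let ?P = "(B e1 e1 - B e2 e2) / 2" and ?Q = "(B e1 e2 + B e2 e1) / 2"
  obtain r t where rt: "?P = r * cos t" "?Q = r * sin t" using polar_Ex by blast
  define u where "u = (\<lambda>a. cos a *\<^sub>R e1 + sin a *\<^sub>R e2)"
  have norm_u: "norm (u a) = 1" for a
  proof -
    have "e1 \<bullet> e1 = 1" "e2 \<bullet> e2 = 1" "e2 \<bullet> e1 = 0"
      using e by (simp_all add: norm_eq_sqrt_inner inner_commute)
    then have "u a \<bullet> u a = 1"
      using e(3) by (simp add: u_def inner_add_left inner_add_right flip: power2_eq_square)
    then show ?thesis by (simp add: norm_eq_sqrt_inner)
  qed
  have Bu: "B (u a) (u a) = (B e1 e1 + B e2 e2) / 2 + ?P * cos (2 * a) + ?Q * sin (2 * a)" for a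
  proof -
    have "B (u a) (u a) = (cos a)\<^sup>2 * B e1 e1 + cos a * sin a * (B e1 e2 + B e2 e1) + (sin a)\<^sup>2 * B e2 e2"
      by (simp add: u_def blinfun.bilinear_simps power2_eq_square algebra_simps)
    then show ?thesis unfolding quadratic_form_harmonics .
  qed
  have "r * cos t * cos t + r * sin t * sin t = r"
    by (metis distrib_left mult.assoc mult.right_neutral power2_eq_square sin_cos_squared_add2)
  then have "B (u (t / 2)) (u (t / 2)) - B (u (t / 2 + pi / 2)) (u (t / 2 + pi / 2)) = 2 * r"
    unfolding Bu rt by (simp add: distrib_left)
  then have "\<bar>r\<bar> \<le> L"
    using B[of "u (t / 2)" "u (t / 2)"] B[of "u (t / 2 + pi / 2)" "u (t / 2 + pi / 2)"] norm_u by simp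
  moreover have "?P\<^sup>2 + ?Q\<^sup>2 = r\<^sup>2"
    unfolding rt power_mult_distrib by (metis distrib_left mult.right_neutral sin_cos_squared_add2)
  ultimately show ?thesis using L abs_le_square_iff[of r L] by simp
qed


text \<open>On the circle the linear Taylor term is a first harmonic and the quadratic one a
  constant plus a second harmonic, so four harmonics capture the second-order expansion. The two
  parts of \<open>S_xi\<close> arise here: the first harmonic has amplitude at most
  \<open>\<rho> * G\<close>, the second at most \<open>\<rho>\<^sup>2 * L / 2\<close>.\<close>

lemma field_scan_expansion:
  assumes field: "field_assumption F p0 pstar G L M3 \<Delta>0" and \<rho>: "0 < \<rho>"
  obtains \<beta> :: "real^5" where
    "\<beta> $ 2 = \<rho> * (transpose (rot t) *v grad F p) $ 1"
    "\<beta> $ 3 = \<rho> * (transpose (rot t) *v grad F p) $ 2"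
    "(\<beta> $ 2)\<^sup>2 + (\<beta> $ 3)\<^sup>2 + (\<beta> $ 4)\<^sup>2 + (\<beta> $ 5)\<^sup>2 \<le> (S_xi \<rho> G L)\<^sup>2"
    "\<And>i. \<bar>F (p + \<rho> *\<^sub>R direction (t + a i)) - regressor a i \<bullet> \<beta>\<bar> \<le> b_bias \<rho> M3"
proof -
  have C3: "C3 F" and L: "0 < L" "\<And>p q. norm (grad F p - grad F q) \<le> L * norm (p - q)"
    and M3: "\<And>p. norm (fderiv (fderiv (fderiv F)) p) \<le> M3" and G: "\<And>p. norm (grad F p) \<le> G" "0 < G"
    using field by (auto simp: field_assumption_def)
  have d: "F differentiable at x" for x using C3 by (simp add: C3_def)
  let ?e1 = "direction t" and ?e2 = "direction (t + pi / 2)"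
  define B where "B = fderiv (fderiv F) p"
  define g where "g = transpose (rot t) *v grad F p"
  have e: "?e1 \<bullet> ?e2 = 0" by (simp add: inner_vec_def sum_2 cos_add sin_add)
  have g: "fderiv F p ?e1 = g $ 1" "fderiv F p ?e2 = g $ 2"
    by (simp_all only: fderiv_eq_inner_grad[OF d] g_def transpose_rot_mult_vec)
  have norm_g: "(g $ 1)\<^sup>2 + (g $ 2)\<^sup>2 \<le> G\<^sup>2"
  proof -
    have "(x * cos t + y * sin t)\<^sup>2 + (y * cos t - x * sin t)\<^sup>2 = x\<^sup>2 + y\<^sup>2" for x y
      using sin_cos_squared_add2[of t] by algebra
    from this[of "grad F p $ 1" "grad F p $ 2"]
    have "(g $ 1)\<^sup>2 + (g $ 2)\<^sup>2 = (norm (grad F p))\<^sup>2"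
      unfolding g_def transpose_rot_mult_vec power2_norm_eq_inner
      by (simp add: inner_vec_def sum_2 cos_add sin_add flip: power2_eq_square)
    then show ?thesis using G(1)[of p] by (simp add: power_mono)
  qed
  define \<xi> :: "real^4" where
    "\<xi> = vector [\<rho> * g $ 1, \<rho> * g $ 2, \<rho>\<^sup>2 / 4 * (B ?e1 ?e1 - B ?e2 ?e2), \<rho>\<^sup>2 / 4 * (B ?e1 ?e2 + B ?e2 ?e1)]"
  define c where "c = F p + \<rho>\<^sup>2 / 4 * (B ?e1 ?e1 + B ?e2 ?e2)"
  \<comment> \<open>Since the regressors are centred at the first bearing, the first coefficient is
    the value of the model there and not the constant \<open>c\<close>.\<close>
  define \<beta> :: "real^5" where
    "\<beta> = vector [c + harmonics (a 1) \<bullet> \<xi>, \<xi> $ 1, \<xi> $ 2, \<xi> $ 3, \<xi> $ 4]"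
  have reg: "regressor a i \<bullet> \<beta> = c + harmonics (a i) \<bullet> \<xi>" for i
  proof (cases "i = 1")
    case True
    then show ?thesis by (simp add: regressor_def inner_axis' \<beta>_def)
  next
    case False
    then show ?thesis
      by (simp add: regressor_def Let_def \<beta>_def inner_vec_def sum_5 sum_4 algebra_simps)
  qed
  have "\<bar>F (p + \<rho> *\<^sub>R direction (t + a i)) - regressor a i \<bullet> \<beta>\<bar> \<le> b_bias \<rho> M3" for i
  proof -
    let ?u = "direction (t + a i)"
    have alg: "f + \<rho> * (C * g1 + S * g2) + \<rho>\<^sup>2 / 2 * ((x + y) / 2 + (x - y) / 2 * C2 + z / 2 * S2)
      = f + \<rho>\<^sup>2 / 4 * (x + y) + (C * (\<rho> * g1) + S * (\<rho> * g2) + C2 * (\<rho>\<^sup>2 / 4 * (x - y)) + S2 * (\<rho>\<^sup>2 / 4 * z))"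
      for f C S C2 S2 g1 g2 x y z :: real by (simp add: field_simps)
    have fu: "fderiv F p ?u = cos (a i) * g $ 1 + sin (a i) * g $ 2"
      unfolding direction_add[of t "a i"] g[symmetric] by (simp add: blinfun.bilinear_simps)
    have Bu: "B ?u ?u = (B ?e1 ?e1 + B ?e2 ?e2) / 2 + (B ?e1 ?e1 - B ?e2 ?e2) / 2 * cos (2 * a i)
        + (B ?e1 ?e2 + B ?e2 ?e1) / 2 * sin (2 * a i)"
      unfolding direction_add[of t "a i"] quadratic_form_harmonics[symmetric]
      by (simp add: blinfun.bilinear_simps power2_eq_square algebra_simps)
    have "harmonics (a i) \<bullet> \<xi> = cos (a i) * \<xi> $ 1 + sin (a i) * \<xi> $ 2 + cos (2 * a i) * \<xi> $ 3 + sin (2 * a i) * \<xi> $ 4"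
      by (simp add: harmonics_def inner_vec_def sum_4)
    then have "F p + \<rho> * fderiv F p ?u + \<rho>\<^sup>2 / 2 * B ?u ?u = regressor a i \<bullet> \<beta>"
      unfolding reg fu Bu c_def \<xi>_def vector_4 alg by simp
    then show ?thesis
      using Taylor_line_third_order[OF C3 M3 \<rho>, of ?u p] by (simp add: B_def b_bias_def)
  qed
  moreover have "(\<beta> $ 2)\<^sup>2 + (\<beta> $ 3)\<^sup>2 + (\<beta> $ 4)\<^sup>2 + (\<beta> $ 5)\<^sup>2 \<le> (S_xi \<rho> G L)\<^sup>2"
  proof -
    have "((B ?e1 ?e1 - B ?e2 ?e2) / 2)\<^sup>2 + ((B ?e1 ?e2 + B ?e2 ?e1) / 2)\<^sup>2 \<le> L\<^sup>2"
      unfolding B_def using L e by (intro second_harmonic_bound second_derivative_bound[OF C3]) auto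
    from mult_left_mono[OF this, of "\<rho>^4 / 4"] mult_left_mono[OF norm_g, of "\<rho>\<^sup>2"]
    have "\<rho>\<^sup>2 * ((g $ 1)\<^sup>2 + (g $ 2)\<^sup>2) + \<rho>^4 / 4 * (((B ?e1 ?e1 - B ?e2 ?e2) / 2)\<^sup>2 + ((B ?e1 ?e2 + B ?e2 ?e1) / 2)\<^sup>2)
      \<le> \<rho>\<^sup>2 * G\<^sup>2 + \<rho>^4 * L\<^sup>2 / 4" by simp
    also have "\<dots> = (S_xi \<rho> G L)\<^sup>2" by (simp add: S_xi_def)
    also have "\<rho>\<^sup>2 * ((g $ 1)\<^sup>2 + (g $ 2)\<^sup>2) + \<rho>^4 / 4 * (((B ?e1 ?e1 - B ?e2 ?e2) / 2)\<^sup>2 + ((B ?e1 ?e2 + B ?e2 ?e1) / 2)\<^sup>2)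
      = (\<beta> $ 2)\<^sup>2 + (\<beta> $ 3)\<^sup>2 + (\<beta> $ 4)\<^sup>2 + (\<beta> $ 5)\<^sup>2"
    proof -
      have "\<rho>\<^sup>2 * (u\<^sup>2 + v\<^sup>2) + \<rho>^4 / 4 * ((x / 2)\<^sup>2 + (y / 2)\<^sup>2)
        = (\<rho> * u)\<^sup>2 + (\<rho> * v)\<^sup>2 + (\<rho>\<^sup>2 / 4 * x)\<^sup>2 + (\<rho>\<^sup>2 / 4 * y)\<^sup>2" for u v x y :: real
        by (simp add: power_mult_distrib power_divide field_simps flip: power_mult)
      then show ?thesis by (simp only: \<beta>_def \<xi>_def vector_4 vector_5)
    qed
    finally show ?thesis .
  qed
  ultimately show thesis by (intro that[of \<beta>]) (simp_all add: \<beta>_def \<xi>_def g_def)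
qed

section \<open>Confidence ellipsoids\<close>

lemma G_mat_mult_vec: "(G_mat \<rho> *v x) $ 1 = x $ 2 / \<rho>" "(G_mat \<rho> *v x) $ 2 = x $ 3 / \<rho>"
  by (simp_all add: G_mat_def matrix_vector_mult_def sum_5)

lemma inj_transpose_G_mat:
  assumes "\<rho> \<noteq> 0" shows "inj ((*v) (transpose (G_mat \<rho>)))"
proof (rule injI)
  fix x y assume eq: "transpose (G_mat \<rho>) *v x = transpose (G_mat \<rho>) *v y"
  have c: "(transpose (G_mat \<rho>) *v x) $ 2 = x $ 1 / \<rho>" "(transpose (G_mat \<rho>) *v x) $ 3 = x $ 2 / \<rho>" for x
    unfolding transpose_def matrix_vector_mult_def by (simp_all add: G_mat_def sum_2)
  have "x $ 1 / \<rho> = y $ 1 / \<rho>" "x $ 2 / \<rho> = y $ 2 / \<rho>"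
    unfolding c[symmetric] eq by auto
  then show "x = y" using assms by (simp add: vec_eq_iff forall_2)
qed

lemma norm_G_mat_mult_vec:
  assumes "0 < \<rho>" shows "norm (G_mat \<rho> *v x) \<le> norm x / \<rho>"
proof -
  have "(norm (G_mat \<rho> *v x))\<^sup>2 = ((x $ 2)\<^sup>2 + (x $ 3)\<^sup>2) / \<rho>\<^sup>2"
    unfolding power2_norm_eq_inner inner_vec_def
    by (simp add: sum_2 G_mat_mult_vec add_divide_distrib power2_eq_square)
  also have "\<dots> \<le> (norm x)\<^sup>2 / \<rho>\<^sup>2"
    by (intro divide_right_mono) (simp_all add: power2_norm_eq_inner inner_vec_def sum_5 flip: power2_eq_square)
  finally have "(norm (G_mat \<rho> *v x))\<^sup>2 \<le> (norm x / \<rho>)\<^sup>2" by (simp add: power_divide)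
  then show ?thesis by (rule power2_le_imp_le) (use assms in simp)
qed

lemma pos_def_P_mat:
  assumes "0 < \<rho>" "0 < lam" "1 \<le> n"
  shows "pos_def (P_mat \<rho> lam a n)"
  unfolding P_mat_def using assms
  by (intro pos_def_congruence pos_def_matrix_inv pos_def_V_mat inj_transpose_G_mat) auto

text \<open>\<open>x\<close> is lifted to the vector \<open>z\<close> with image \<open>x\<close>
  whose \<open>V_mat\<close> form equals the form of \<open>x\<close>. The hypothesis bounds
  \<open>z\<close>, and \<open>G_mat\<close> contracts by the factor
  \<open>1 / \<rho>\<close>.\<close>

lemma norm_le_P_mat_form:
  assumes "0 < \<rho>" "0 < lam" "1 \<le> n" and k: "0 < k"
    and V: "\<And>z. k * (z \<bullet> z) \<le> z \<bullet> (V_mat lam a n *v z)"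
  shows "(norm x)\<^sup>2 \<le> (x \<bullet> (matrix_inv (P_mat \<rho> lam a n) *v x)) / (\<rho>\<^sup>2 * k)"
proof -
  let ?V = "V_mat lam a n" and ?P = "P_mat \<rho> lam a n" and ?G = "G_mat \<rho>"
  note inv = matrix_inv_inverse[OF pos_def_invertible[OF pos_def_V_mat[OF assms(2,3), of a]]]
  note invP = matrix_inv_inverse[OF pos_def_invertible[OF pos_def_P_mat[OF assms(1-3), of a]]]
  define u where "u = matrix_inv ?P *v x"
  define z where "z = matrix_inv ?V *v (transpose ?G *v u)"
  have x: "x = ?G *v z"
    using invP(3)[of x]
    by (simp add: u_def z_def P_mat_def matrix_vector_mul_assoc matrix_mul_assoc del: transpose_matrix_vector)
  have "x \<bullet> u = z \<bullet> (transpose ?G *v u)"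
    unfolding x by (metis dot_lmul_matrix inner_commute transpose_matrix_vector)
  then have zz: "x \<bullet> u = z \<bullet> (?V *v z)" by (simp add: z_def inv)
  have "(norm x)\<^sup>2 \<le> (norm z / \<rho>)\<^sup>2"
    unfolding x using assms by (intro power_mono norm_G_mat_mult_vec) auto
  also have "\<dots> = (k * (z \<bullet> z)) / (\<rho>\<^sup>2 * k)" using k by (simp add: power_divide power2_norm_eq_inner)
  also have "\<dots> \<le> (x \<bullet> u) / (\<rho>\<^sup>2 * k)" unfolding zz using V k by (intro divide_right_mono) auto
  finally show ?thesis by (simp add: u_def)
qed

text \<open>With \<open>k = m * kappa m abar\<close> and \<open>r = beta_bar\<close> the right-hand
  side is \<open>rho_bar\<close>; this is the origin of the design quantity.\<close>

lemma conf_set_radius: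
  assumes "0 < \<rho>" "0 < lam" "1 \<le> n" "0 \<le> r" "0 < k"
    and V: "\<And>z. k * (z \<bullet> z) \<le> z \<bullet> (V_mat lam a n *v z)"
    and g: "g \<in> conf_set \<rho> lam r a y n"
  shows "norm (g - g_hat \<rho> lam a y n) \<le> r / (\<rho> * sqrt k)"
proof -
  let ?x = "g - g_hat \<rho> lam a y n"
  have "(norm ?x)\<^sup>2 \<le> (?x \<bullet> (matrix_inv (P_mat \<rho> lam a n) *v ?x)) / (\<rho>\<^sup>2 * k)"
    by (rule norm_le_P_mat_form[OF assms(1-3,5) V])
  also have "\<dots> \<le> r\<^sup>2 / (\<rho>\<^sup>2 * k)"
    using g assms by (intro divide_right_mono) (auto simp: conf_set_def)
  also have "\<dots> = (r / (\<rho> * sqrt k))\<^sup>2" using assms by (simp add: power_divide power_mult_distrib)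
  finally show ?thesis using assms by (intro power2_le_imp_le[of "norm ?x"]) auto
qed

section \<open>Convex geometry of the confidence sets\<close>

lemma pos_def_lower_bound:
  fixes A :: "real^'n^'n"
  assumes "pos_def A"
  obtains k where "0 < k" "\<And>x. k * (x \<bullet> x) \<le> x \<bullet> (A *v x)"
proof -
  have sym: "transpose A = A" using assms by (simp add: pos_def_def)
  obtain v where v: "norm v = 1" "A *v v = least_eigenvalue A *\<^sub>R v"
    using least_eigenvalue_symmetric(1)[OF sym] by blast
  have "v \<noteq> 0" using v(1) by auto
  then have "0 < v \<bullet> (A *v v)" using assms by (simp add: pos_def_def)
  then have "0 < least_eigenvalue A" unfolding v(2) using v(1) by (simp add: norm_eq_sqrt_inner)
  then show thesis using least_eigenvalue_symmetric(2)[OF sym] by (rule that)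
qed

text \<open>The confidence set without its centre. The measurements enter the centre only, so for
  fixed bearings this shape does not depend on chance.\<close>

definition ellipsoid :: "real \<Rightarrow> real \<Rightarrow> real \<Rightarrow> (nat \<Rightarrow> real) \<Rightarrow> nat \<Rightarrow> (real^2) set" where
  "ellipsoid \<rho> lam r a n = {x. x \<bullet> (matrix_inv (P_mat \<rho> lam a n) *v x) \<le> r\<^sup>2}"

lemma conf_set_eq_translation:
  "conf_set \<rho> lam r a y n = (+) (g_hat \<rho> lam a y n) ` ellipsoid \<rho> lam r a n"
proof -
  have "x \<in> (+) c ` E \<longleftrightarrow> x - c \<in> E" for x c :: "real^2" and E
    by (metis (no_types, lifting) add_diff_cancel_left' diff_add_cancel add.commute image_iff)
  then show ?thesis by (auto simp: conf_set_def ellipsoid_def)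
qed

lemma ellipsoid_nonempty: "ellipsoid \<rho> lam r a n \<noteq> {}"
  by (auto simp: ellipsoid_def intro!: exI[of _ 0])

lemma compact_ellipsoid:
  assumes "0 < \<rho>" "0 < lam" "1 \<le> n" "0 \<le> r"
  shows "compact (ellipsoid \<rho> lam r a n)"
proof -
  obtain k where k: "0 < k" "\<And>x. k * (x \<bullet> x) \<le> x \<bullet> (V_mat lam a n *v x)"
    using pos_def_lower_bound[OF pos_def_V_mat[OF assms(2,3)]] by blast
  have "norm x \<le> r / (\<rho> * sqrt k)" if "x \<in> ellipsoid \<rho> lam r a n" for x
    using conf_set_radius[OF assms(1-4) k, of "g_hat \<rho> lam a y n + x" y for y] that
    by (auto simp: conf_set_eq_translation)
  then have "bounded (ellipsoid \<rho> lam r a n)" by (auto simp: bounded_iff)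
  moreover have "closed (ellipsoid \<rho> lam r a n)"
    unfolding ellipsoid_def
    by (intro closed_Collect_le continuous_intros matrix_vector_mult_linear_continuous_on)
  ultimately show ?thesis by (simp add: compact_eq_bounded_closed)
qed

lemma convex_ellipsoid:
  assumes "0 < \<rho>" "0 < lam" "1 \<le> n"
  shows "convex (ellipsoid \<rho> lam r a n)"
proof (rule convexI)
  fix x y :: "real^2" and s t :: real
  assume x: "x \<in> ellipsoid \<rho> lam r a n" and y: "y \<in> ellipsoid \<rho> lam r a n"
    and st: "0 \<le> s" "0 \<le> t" "s + t = 1"
  define A where "A = matrix_inv (P_mat \<rho> lam a n)"
  have A: "pos_def A" unfolding A_def by (intro pos_def_matrix_inv pos_def_P_mat assms)
  then have sym: "y \<bullet> (A *v x) = x \<bullet> (A *v y)"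
    using symmetric_inner[of A y x] by (simp add: pos_def_def inner_commute)
  have s: "s = 1 - t" using st by simp
  have "(s *\<^sub>R x + t *\<^sub>R y) \<bullet> (A *v (s *\<^sub>R x + t *\<^sub>R y))
    = s * (x \<bullet> (A *v x)) + t * (y \<bullet> (A *v y)) - s * t * ((x - y) \<bullet> (A *v (x - y)))"
    unfolding s
    by (simp add: matrix_vector_right_distrib matrix_vector_mult_diff_distrib matrix_vector_mult_scaleR
        inner_add_left inner_add_right inner_diff_left inner_diff_right sym algebra_simps power2_eq_square)
  also have "\<dots> \<le> s * r\<^sup>2 + t * r\<^sup>2 - 0"
    using x y st pos_def_nonneg[OF A, of "x - y"]
    by (intro diff_mono add_mono mult_left_mono) (auto simp: ellipsoid_def A_def)
  also have "\<dots> = r\<^sup>2" using st by (simp flip: distrib_right)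
  finally show "s *\<^sub>R x + t *\<^sub>R y \<in> ellipsoid \<rho> lam r a n" by (simp add: ellipsoid_def A_def)
qed

lemma norm_le_norm_max:
  assumes "compact C" "g \<in> C" shows "norm g \<le> norm_max C"
proof -
  have "bdd_above (norm ` C)"
    using assms(1) by (intro bounded_imp_bdd_above compact_imp_bounded compact_continuous_image) (auto intro: continuous_intros)
  then show ?thesis unfolding norm_max_def using assms(2) by (intro cSUP_upper)
qed

lemma norm_min_le_norm:
  assumes "g \<in> C" shows "norm_min C \<le> norm g"
  unfolding norm_min_def using assms by (intro cINF_lower) (auto intro: bdd_belowI2[where m = 0])

lemma norm_max_attained:
  assumes "compact C" "C \<noteq> {}"
  obtains g where "g \<in> C" "norm_max C = norm g"
proof -
  obtain g where g: "g \<in> C" "\<And>h. h \<in> C \<Longrightarrow> norm h \<le> norm g"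
    using continuous_attains_sup[OF assms, of norm] continuous_on_norm_id by blast
  then have "norm_max C = norm g" unfolding norm_max_def by (intro cSup_eq_maximum) auto
  with g(1) show thesis by (rule that)
qed

lemma norm_min_attained:
  assumes "compact C" "C \<noteq> {}"
  obtains g where "g \<in> C" "norm_min C = norm g"
proof -
  obtain g where g: "g \<in> C" "\<And>h. h \<in> C \<Longrightarrow> norm g \<le> norm h"
    using continuous_attains_inf[OF assms, of norm] continuous_on_norm_id by blast
  then have "norm_min C = norm g" unfolding norm_min_def by (intro cInf_eq_minimum) auto
  with g(1) show thesis by (rule that)
qed

text \<open>Moving an extremal point along with the set changes its norm by at most the distance of
  the centres, which gives Lipschitz constant 1. This carries measurability from the estimate to the
  stopping tests.\<close>

lemma continuous_on_norm_max_translation: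
  assumes E: "compact E" "E \<noteq> {}"
  shows "continuous_on UNIV (\<lambda>c. norm_max ((+) c ` E))"
proof -
  have le: "norm_max ((+) c ` E) \<le> norm_max ((+) d ` E) + dist c d" for c d
  proof -
    obtain g where g: "g \<in> (+) c ` E" "norm_max ((+) c ` E) = norm g"
      using norm_max_attained[of "(+) c ` E"] E compact_translation by blast
    then obtain e where e: "e \<in> E" "g = c + e" by blast
    have "norm (d + e) \<le> norm_max ((+) d ` E)"
      using E e by (intro norm_le_norm_max compact_translation) auto
    moreover have "norm (c + e) \<le> norm (d + e) + norm (c - d)"
      using norm_triangle_ineq[of "d + e" "c - d"] by (simp add: add.commute)
    ultimately show ?thesis using g e by (simp add: dist_norm)
  qed
  have "dist (norm_max ((+) c ` E)) (norm_max ((+) d ` E)) \<le> 1 * dist c d" for c d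
    using le[of c d] le[of d c] by (simp add: dist_real_def dist_commute abs_le_iff)
  then have "1-lipschitz_on UNIV (\<lambda>c. norm_max ((+) c ` E))" by (intro lipschitz_onI) auto
  then show ?thesis by (rule lipschitz_on_continuous_on)
qed

lemma continuous_on_norm_min_translation:
  assumes E: "compact E" "E \<noteq> {}"
  shows "continuous_on UNIV (\<lambda>c. norm_min ((+) c ` E))"
proof -
  have le: "norm_min ((+) d ` E) \<le> norm_min ((+) c ` E) + dist c d" for c d
  proof -
    obtain g where g: "g \<in> (+) c ` E" "norm_min ((+) c ` E) = norm g"
      using norm_min_attained[of "(+) c ` E"] E compact_translation by blast
    then obtain e where e: "e \<in> E" "g = c + e" by blast
    have "norm_min ((+) d ` E) \<le> norm (d + e)"
      using e by (intro norm_min_le_norm) auto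
    moreover have "norm (d + e) \<le> norm (c + e) + norm (c - d)"
      using norm_triangle_ineq[of "c + e" "d - c"] by (simp add: norm_minus_commute add.commute)
    ultimately show ?thesis using g e by (simp add: dist_norm)
  qed
  have "dist (norm_min ((+) c ` E)) (norm_min ((+) d ` E)) \<le> 1 * dist c d" for c d
    using le[of c d] le[of d c] by (simp add: dist_real_def dist_commute abs_le_iff)
  then have "1-lipschitz_on UNIV (\<lambda>c. norm_min ((+) c ` E))" by (intro lipschitz_onI) auto
  then show ?thesis by (rule lipschitz_on_continuous_on)
qed

lemma norm_max_le_norm_min_add:
  assumes C: "compact C" "C \<noteq> {}" and R: "\<And>g. g \<in> C \<Longrightarrow> norm (g - c) \<le> R"
  shows "norm_max C \<le> norm_min C + 2 * R"
proof -
  obtain g where g: "g \<in> C" "norm_max C = norm g" using norm_max_attained[OF C] by blast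
  obtain h where h: "h \<in> C" "norm_min C = norm h" using norm_min_attained[OF C] by blast
  have "norm g \<le> norm h + norm (g - h)" using norm_triangle_ineq[of h "g - h"] by simp
  also have "norm (g - h) \<le> norm (g - c) + norm (h - c)"
    using norm_triangle_ineq4[of "g - c" "h - c"] by simp
  finally show ?thesis using R[OF g(1)] R[OF h(1)] g h by simp
qed

lemma descent_dir_properties:
  assumes C: "compact C" "convex C" "C \<noteq> {}" and pos: "0 < norm_min C"
  shows "norm (descent_dir C) = 1" and "g \<in> C \<Longrightarrow> g \<bullet> descent_dir C \<le> - norm_min C"
proof -
  define x where "x = arg_min_on norm C"
  \<comment> \<open>\<open>arg_min_on\<close> chooses some minimizer, so its properties rest on the
    existence of one.\<close>
  obtain g0 where g0: "g0 \<in> C" "norm_min C = norm g0"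
    using norm_min_attained[OF C(1,3)] by blast
  then have "is_arg_min norm (\<lambda>g. g \<in> C) g0"
    using norm_min_le_norm[of _ C] by (simp add: is_arg_min_linorder)
  then have "is_arg_min norm (\<lambda>g. g \<in> C) x"
    unfolding x_def arg_min_on_def arg_min_def by (rule someI)
  then have x: "x \<in> C" "\<And>h. h \<in> C \<Longrightarrow> norm x \<le> norm h" by (auto simp: is_arg_min_linorder)
  then have nx: "norm_min C = norm x" unfolding norm_min_def by (intro cInf_eq_minimum) auto
  have dir: "descent_dir C = - (x /\<^sub>R norm x)" by (simp add: descent_dir_def x_def Let_def)
  show "norm (descent_dir C) = 1" using pos nx by (simp add: dir)
  show "g \<bullet> descent_dir C \<le> - norm_min C" if "g \<in> C"
  proof -
    have "(0 - x) \<bullet> (g - x) \<le> 0"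
      using x C by (intro any_closest_point_dot[of C]) (auto intro: that compact_imp_closed)
    then have "(norm x)\<^sup>2 \<le> g \<bullet> x"
      by (simp add: inner_diff_right inner_commute power2_norm_eq_inner)
    then have "norm x \<le> (g \<bullet> x) / norm x"
      using pos nx by (simp add: pos_le_divide_eq power2_eq_square)
    then show ?thesis by (simp add: dir nx divide_inverse_commute)
  qed
qed

text \<open>\<open>V *v e\<close> is a sum of four sources of error. Paired with \<open>e\<close>,
  each is at most \<open>N\<close>, the norm of \<open>e\<close> in the metric of \<open>V\<close>,
  times its own size; the pairing itself is \<open>N\<^sup>2\<close>, and one factor
  \<open>N\<close> cancels. The bounds hold since \<open>N\<^sup>2\<close> dominates both the sum of
  the squared predictions \<open>regressor a i \<bullet> e\<close> and the regularization part.
  Cauchy-Schwarz over the samples yields \<open>sqrt (real n)\<close> for the remainder, while the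
  first noise meets a single prediction and has factor 1.\<close>

lemma estimation_error_bound:
  assumes lam: "0 < lam" and n: "1 \<le> n"
    and y: "\<And>i. i \<in> {1..n} \<Longrightarrow> y i = regressor a i \<bullet> \<beta> + r i + w i"
    and r: "\<And>i. i \<in> {1..n} \<Longrightarrow> \<bar>r i\<bar> \<le> b" and b: "0 \<le> b"
    and w1: "\<bar>w 1\<bar> \<le> W"
    and S: "S = (\<Sum>i=2..n. w i *\<^sub>R regressor a i)"
      "S \<bullet> (matrix_inv (V_mat lam a n) *v S) \<le> Q\<^sup>2" and Q: "0 \<le> Q"
    and \<beta>: "(\<beta> $ 2)\<^sup>2 + (\<beta> $ 3)\<^sup>2 + (\<beta> $ 4)\<^sup>2 + (\<beta> $ 5)\<^sup>2 \<le> D\<^sup>2" and D: "0 \<le> D"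
  defines "e \<equiv> theta_hat lam a y n - \<beta>"
  shows "e \<bullet> (V_mat lam a n *v e) \<le> (W + Q + sqrt lam * D + b * sqrt (real n))\<^sup>2"
proof -
  let ?V = "V_mat lam a n" and ?\<psi> = "regressor a"
  note V = pos_def_V_mat[OF lam n, of a]
  note inv = matrix_inv_inverse[OF pos_def_invertible[OF V]]
  define N where "N = sqrt (e \<bullet> (?V *v e))"
  have N0: "0 \<le> N" and N2: "N\<^sup>2 = e \<bullet> (?V *v e)" using pos_def_nonneg[OF V, of e] by (auto simp: N_def)
  have form: "N\<^sup>2 = lam * ((e $ 2)\<^sup>2 + (e $ 3)\<^sup>2 + (e $ 4)\<^sup>2 + (e $ 5)\<^sup>2) + (\<Sum>i=1..n. (?\<psi> i \<bullet> e)\<^sup>2)"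
    unfolding N2 V_mat_form ..
  have sq: "(\<Sum>i=1..n. (?\<psi> i \<bullet> e)\<^sup>2) \<le> N\<^sup>2" "lam * ((e $ 2)\<^sup>2 + (e $ 3)\<^sup>2 + (e $ 4)\<^sup>2 + (e $ 5)\<^sup>2) \<le> N\<^sup>2"
    unfolding form using lam by (auto simp: sum_nonneg)
  have gram: "gram a n *v \<beta> = (\<Sum>i=1..n. (?\<psi> i \<bullet> \<beta>) *\<^sub>R ?\<psi> i)"
  proof (induction n)
    case 0
    then show ?case by (simp add: gram_def matrix_vector_mult_def vec_eq_iff)
  next
    case (Suc n)
    then show ?case by (simp add: gram_Suc matrix_vector_mult_add_rdistrib outer_mult_vec)
  qed
  have V\<beta>: "?V *v \<beta> = reg_weight lam *v \<beta> + (\<Sum>i=1..n. (?\<psi> i \<bullet> \<beta>) *\<^sub>R ?\<psi> i)"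
    unfolding V_mat_def matrix_vector_mult_add_rdistrib gram ..
  have "?V *v e = (\<Sum>i=1..n. y i *\<^sub>R ?\<psi> i) - (reg_weight lam *v \<beta> + (\<Sum>i=1..n. (?\<psi> i \<bullet> \<beta>) *\<^sub>R ?\<psi> i))"
    by (simp add: e_def matrix_vector_mult_diff_distrib theta_hat_def inv V\<beta>)
  also have "(\<Sum>i=1..n. y i *\<^sub>R ?\<psi> i) = (\<Sum>i=1..n. (?\<psi> i \<bullet> \<beta>) *\<^sub>R ?\<psi> i) + (\<Sum>i=1..n. r i *\<^sub>R ?\<psi> i) + (\<Sum>i=1..n. w i *\<^sub>R ?\<psi> i)"
    unfolding sum.distrib[symmetric] by (intro sum.cong) (auto simp: y scaleR_add_left)
  also have "(\<Sum>i=1..n. w i *\<^sub>R ?\<psi> i) = w 1 *\<^sub>R ?\<psi> 1 + S"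
    unfolding S(1) using n by (simp add: sum.atLeast_Suc_atMost numeral_2_eq_2)
  finally have Ve: "?V *v e = (\<Sum>i=1..n. r i *\<^sub>R ?\<psi> i) + w 1 *\<^sub>R ?\<psi> 1 + S - reg_weight lam *v \<beta>"
    by simp
  have t1: "(\<Sum>i=1..n. r i * (?\<psi> i \<bullet> e)) \<le> N * (b * sqrt (real n))"
  proof -
    have "(\<Sum>i=1..n. r i * (?\<psi> i \<bullet> e))\<^sup>2 \<le> (\<Sum>i=1..n. (r i)\<^sup>2) * (\<Sum>i=1..n. (?\<psi> i \<bullet> e)\<^sup>2)"
      by (rule Cauchy_Schwarz_ineq_sum)
    also have "\<dots> \<le> (\<Sum>i=1..n. b\<^sup>2) * N\<^sup>2"
      using r b by (intro mult_mono sum_mono sq) (auto simp: sum_nonneg abs_le_square_iff[symmetric])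
    also have "\<dots> = (N * (b * sqrt (real n)))\<^sup>2" by (simp add: power_mult_distrib)
    finally show ?thesis using N0 b by (intro power2_le_imp_le[OF _ mult_nonneg_nonneg]) auto
  qed
  have t2: "w 1 * (?\<psi> 1 \<bullet> e) \<le> N * W"
  proof -
    have "(?\<psi> 1 \<bullet> e)\<^sup>2 \<le> (\<Sum>i=1..n. (?\<psi> i \<bullet> e)\<^sup>2)" using n by (intro member_le_sum) auto
    then have "(?\<psi> 1 \<bullet> e)\<^sup>2 \<le> N\<^sup>2" using sq(1) by linarith
    then have "\<bar>?\<psi> 1 \<bullet> e\<bar> \<le> N" using N0 abs_le_square_iff[of "?\<psi> 1 \<bullet> e" N] by simp
    then have "\<bar>w 1\<bar> * \<bar>?\<psi> 1 \<bullet> e\<bar> \<le> W * N" using w1 by (intro mult_mono) auto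
    then show ?thesis by (metis abs_ge_self abs_mult mult.commute order_trans)
  qed
  have t3: "e \<bullet> S \<le> N * Q"
  proof -
    let ?x = "matrix_inv ?V *v S"
    have "e \<bullet> S = e \<bullet> (?V *v ?x)" by (simp add: inv)
    also have "\<dots> \<le> \<bar>e \<bullet> (?V *v ?x)\<bar>" by simp
    also have "\<dots> \<le> N * sqrt (?x \<bullet> (?V *v ?x))" unfolding N_def by (rule pos_def_cauchy_schwarz[OF V])
    also have "?x \<bullet> (?V *v ?x) = S \<bullet> (matrix_inv ?V *v S)" by (simp add: inv inner_commute)
    also have "N * sqrt \<dots> \<le> N * Q" using S(2) Q N0 by (intro mult_left_mono real_le_lsqrt) auto
    finally show ?thesis .
  qed
  have t4: "- (e \<bullet> (reg_weight lam *v \<beta>)) \<le> N * (sqrt lam * D)"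
  proof -
    have ss: "sqrt lam * (sqrt lam * x) = lam * x" for x using lam by (simp flip: mult.assoc)
    have "- (e \<bullet> (reg_weight lam *v \<beta>)) = (\<Sum>i\<in>{2,3,4,5}. (sqrt lam * e $ i) * (- sqrt lam * \<beta> $ i))"
      by (simp add: inner_vec_def sum_5 reg_weight_mult_vec) (simp add: algebra_simps ss)
    moreover have "(\<Sum>i\<in>{2,3,4,5}. (sqrt lam * e $ i) * (- sqrt lam * \<beta> $ i))\<^sup>2
      \<le> (\<Sum>i\<in>{2,3,4,5}. (sqrt lam * e $ i)\<^sup>2) * (\<Sum>i\<in>{2,3,4,5}. (- sqrt lam * \<beta> $ i)\<^sup>2)"
      by (rule Cauchy_Schwarz_ineq_sum)
    also have "\<dots> \<le> N\<^sup>2 * (lam * D\<^sup>2)"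
    proof (intro mult_mono)
      show "(\<Sum>i\<in>{2,3,4,5}. (sqrt lam * e $ i)\<^sup>2) \<le> N\<^sup>2"
        using sq(2) lam by (simp add: power_mult_distrib algebra_simps)
      have "lam * ((\<beta> $ 2)\<^sup>2 + (\<beta> $ 3)\<^sup>2 + (\<beta> $ 4)\<^sup>2 + (\<beta> $ 5)\<^sup>2) \<le> lam * D\<^sup>2"
        using \<beta> lam by (intro mult_left_mono) auto
      then show "(\<Sum>i\<in>{2,3,4,5}. (- sqrt lam * \<beta> $ i)\<^sup>2) \<le> lam * D\<^sup>2"
        using lam by (simp add: power_mult_distrib algebra_simps)
    qed (auto intro: sum_nonneg)
    also have "\<dots> = (N * (sqrt lam * D))\<^sup>2" using lam by (simp add: power_mult_distrib)
    ultimately show ?thesis using N0 D lam by (metis mult_nonneg_nonneg power2_le_imp_le real_sqrt_ge_zero less_imp_le)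
  qed
  have "N * N = e \<bullet> (?V *v e)" using N2 by (simp add: power2_eq_square)
  also have "\<dots> = (\<Sum>i=1..n. r i * (?\<psi> i \<bullet> e)) + w 1 * (?\<psi> 1 \<bullet> e) + e \<bullet> S - e \<bullet> (reg_weight lam *v \<beta>)"
    unfolding Ve by (simp add: inner_add_right inner_diff_right inner_sum_right inner_commute)
  also have "\<dots> \<le> N * (W + Q + sqrt lam * D + b * sqrt (real n))"
    using t1 t2 t3 t4 by (simp add: distrib_left)
  finally have "N = 0 \<or> N \<le> W + Q + sqrt lam * D + b * sqrt (real n)"
    using N0 by (auto simp: mult_le_cancel_left)
  moreover have "0 \<le> W + Q + sqrt lam * D + b * sqrt (real n)"
    using w1 Q D b lam by (intro add_nonneg_nonneg mult_nonneg_nonneg) auto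
  ultimately have "N\<^sup>2 \<le> (W + Q + sqrt lam * D + b * sqrt (real n))\<^sup>2"
    using N0 by (intro power_mono) auto
  then show ?thesis unfolding N2 .
qed

section \<open>Dependence on the samples taken, and positivity of the confidence radius\<close>

lemma regressor_cong:
  assumes "\<And>i. i \<in> {1..n} \<Longrightarrow> a i = b i" "i \<in> {1..n}"
  shows "regressor a i = regressor b i"
  using assms(1)[of i] assms(1)[of 1] assms(2) by (simp add: regressor_def)

lemma V_mat_cong:
  assumes "\<And>i. i \<in> {1..n} \<Longrightarrow> a i = b i"
  shows "V_mat lam a n = V_mat lam b n"
proof -
  have "(\<Sum>i=1..n. regressor a i $ r * regressor a i $ s) = (\<Sum>i=1..n. regressor b i $ r * regressor b i $ s)" for r s
    by (rule sum.cong) (use regressor_cong[of n a b] assms in auto)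
  then show ?thesis by (simp add: V_mat_def gram_def)
qed

lemma g_hat_cong:
  assumes "\<And>i. i \<in> {1..n} \<Longrightarrow> a i = b i" "\<And>i. i \<in> {1..n} \<Longrightarrow> y i = z i"
  shows "g_hat \<rho> lam a y n = g_hat \<rho> lam b z n"
proof -
  have "(\<Sum>i=1..n. y i *\<^sub>R regressor a i) = (\<Sum>i=1..n. z i *\<^sub>R regressor b i)"
    by (rule sum.cong) (use regressor_cong[of n a b] assms in auto)
  moreover have "V_mat lam a n = V_mat lam b n" by (intro V_mat_cong assms(1))
  ultimately show ?thesis by (simp add: g_hat_def theta_hat_def)
qed

lemma conf_set_cong:
  assumes "\<And>i. i \<in> {1..n} \<Longrightarrow> a i = b i" "\<And>i. i \<in> {1..n} \<Longrightarrow> y i = z i"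
  shows "conf_set \<rho> lam r a y n = conf_set \<rho> lam r b z n"
proof -
  have "V_mat lam a n = V_mat lam b n" by (intro V_mat_cong assms(1))
  moreover have "g_hat \<rho> lam a y n = g_hat \<rho> lam b z n" by (intro g_hat_cong assms)
  ultimately show ?thesis by (simp add: conf_set_def P_mat_def)
qed

lemma conf_radius_cong:
  assumes "\<And>i. i \<in> {1..n} \<Longrightarrow> a i = b i" "1 \<le> n"
  shows "conf_radius \<rho> G L M3 \<sigma> lam d a n = conf_radius \<rho> G L M3 \<sigma> lam d b n"
proof -
  have "V_mat lam a 1 = V_mat lam b 1" using assms by (intro V_mat_cong) auto
  moreover have "V_mat lam a n = V_mat lam b n" by (intro V_mat_cong assms(1))
  ultimately show ?thesis by (simp add: conf_radius_def)
qed

lemma det_V_mat_ge: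
  assumes "0 < lam" "1 \<le> n"
  shows "0 < det (V_mat lam a 1)" "det (V_mat lam a 1) \<le> det (V_mat lam a n)"
proof -
  show pos: "0 < det (V_mat lam a 1)" unfolding V_mat_1 det_V_one using assms by simp
  show "det (V_mat lam a 1) \<le> det (V_mat lam a n)"
    using \<open>1 \<le> n\<close>
  proof (induction n rule: dec_induct)
    case (step n)
    note V = pos_def_V_mat[OF assms(1) step(1), of a]
    have "0 \<le> regressor a (Suc n) \<bullet> (matrix_inv (V_mat lam a n) *v regressor a (Suc n))"
      by (intro pos_def_nonneg pos_def_matrix_inv V)
    then have "det (V_mat lam a n) * 1 \<le> det (V_mat lam a (Suc n))"
      unfolding V_mat_Suc det_add_outer[OF pos_def_invertible[OF V]]
      using step pos by (intro mult_left_mono) auto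
    then show ?case using step by simp
  qed simp
qed

text \<open>The determinant grows along the scan and \<open>d \<le> 1\<close>, so the argument is at
  least 1. Only then does squaring the root in \<open>conf_radius\<close> give back the
  logarithm.\<close>

lemma conf_radius_ln_nonneg:
  assumes "0 < lam" "1 \<le> n" "0 < d" "d \<le> 1"
  shows "0 \<le> ln (2 * sqrt (det (V_mat lam a n)) / (d * sqrt (det (V_mat lam a 1))))"
proof -
  note det = det_V_mat_ge[OF assms(1,2), of a]
  have "d * sqrt (det (V_mat lam a 1)) \<le> 1 * sqrt (det (V_mat lam a n))"
    using assms det by (intro mult_mono) auto
  also have "\<dots> \<le> 2 * sqrt (det (V_mat lam a n))" using det by simp
  finally show ?thesis using assms det by (intro ln_ge_zero) (simp add: pos_le_divide_eq)
qed

lemma conf_radius_nonneg: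
  assumes "0 < \<rho>" "0 \<le> \<sigma>" "0 < lam" "0 < M3" "1 \<le> n" "0 < d" "d \<le> 1"
  shows "0 \<le> conf_radius \<rho> G L M3 \<sigma> lam d a n"
proof -
  have "0 \<le> ln (4 / d)" using assms by simp
  then show ?thesis
    unfolding conf_radius_def S_xi_def b_bias_def using conf_radius_ln_nonneg[of lam n d a] assms
    by (intro add_nonneg_nonneg mult_nonneg_nonneg) auto
qed

lemma regressor_nonzero: "regressor a i \<noteq> 0"
proof -
  have "regressor a i $ 1 = 1" by (simp add: regressor_def Let_def)
  then show ?thesis by (metis zero_index zero_neq_one)
qed

text \<open>The deterministic part of coverage: the noise enters only through the bounds on
  \<open>w 1\<close> and \<open>S\<close>. Both correspond to failure probability
  \<open>d / 2\<close>, the first by \<open>2 / (d / 2) = 4 / d\<close>, the second by the level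
  \<open>c = 2 / d\<close>.\<close>

lemma gradient_in_conf_set:
  assumes field: "field_assumption F p0 pstar G L M3 \<Delta>0"
    and \<rho>: "0 < \<rho>" and \<sigma>: "0 \<le> \<sigma>" and lam: "0 < lam" and n: "1 \<le> n" and d: "0 < d" "d \<le> 1"
    and y: "\<And>i. i \<in> {1..n} \<Longrightarrow> y i = F (q + \<rho> *\<^sub>R direction (t + a i)) + w i"
    and w1: "\<bar>w 1\<bar> \<le> \<sigma> * sqrt (2 * ln (2 / (d / 2)))"
    and S: "S = (\<Sum>i=2..n. w i *\<^sub>R regressor a i)"
      "S \<bullet> (matrix_inv (V_mat lam a n) *v S)
        \<le> 2 * \<sigma>\<^sup>2 * ln (2 / d * sqrt (det (V_mat lam a n) / det (V_mat lam a 1)))"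
  shows "transpose (rot t) *v grad F q \<in> conf_set \<rho> lam (conf_radius \<rho> G L M3 \<sigma> lam d a n) a y n"
proof -
  have M3: "0 < M3" using field by (simp add: field_assumption_def)
  obtain \<beta> :: "real^5" where \<beta>: "\<beta> $ 2 = \<rho> * (transpose (rot t) *v grad F q) $ 1"
    "\<beta> $ 3 = \<rho> * (transpose (rot t) *v grad F q) $ 2"
    "(\<beta> $ 2)\<^sup>2 + (\<beta> $ 3)\<^sup>2 + (\<beta> $ 4)\<^sup>2 + (\<beta> $ 5)\<^sup>2 \<le> (S_xi \<rho> G L)\<^sup>2"
    "\<And>i. \<bar>F (q + \<rho> *\<^sub>R direction (t + a i)) - regressor a i \<bullet> \<beta>\<bar> \<le> b_bias \<rho> M3"
    using field_scan_expansion[OF field \<rho>, of t q a] by metis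
  define r where "r i = F (q + \<rho> *\<^sub>R direction (t + a i)) - regressor a i \<bullet> \<beta>" for i
  let ?e = "theta_hat lam a y n - \<beta>" and ?V = "V_mat lam a n"
  let ?ln = "ln (2 * sqrt (det ?V) / (d * sqrt (det (V_mat lam a 1))))"
  have ln0: "0 \<le> ?ln" by (rule conf_radius_ln_nonneg[OF lam n d])
  have "2 / d * sqrt (det ?V / det (V_mat lam a 1)) = 2 * sqrt (det ?V) / (d * sqrt (det (V_mat lam a 1)))"
    by (simp add: real_sqrt_divide)
  then have S2: "S \<bullet> (matrix_inv ?V *v S) \<le> (\<sigma> * sqrt (2 * ?ln))\<^sup>2"
    using S(2) ln0 by (simp add: power_mult_distrib)
  have e: "?e \<bullet> (?V *v ?e) \<le> (\<sigma> * sqrt (2 * ln (2 / (d / 2))) + \<sigma> * sqrt (2 * ?ln) + sqrt lam * S_xi \<rho> G L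
      + b_bias \<rho> M3 * sqrt (real n))\<^sup>2"
  proof (rule estimation_error_bound[OF lam n _ _ _ w1 S(1) S2])
    show "\<And>i. i \<in> {1..n} \<Longrightarrow> y i = regressor a i \<bullet> \<beta> + r i + w i" by (simp add: y r_def)
    show "\<And>i. \<bar>r i\<bar> \<le> b_bias \<rho> M3" using \<beta>(4) by (simp add: r_def)
    show "0 \<le> b_bias \<rho> M3" using M3 \<rho> by (simp add: b_bias_def)
    show "0 \<le> \<sigma> * sqrt (2 * ?ln)" using \<sigma> ln0 by simp
    show "0 \<le> S_xi \<rho> G L" by (simp add: S_xi_def)
  qed (rule \<beta>(3))
  also have "\<sigma> * sqrt (2 * ln (2 / (d / 2))) + \<sigma> * sqrt (2 * ?ln) + sqrt lam * S_xi \<rho> G L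
      + b_bias \<rho> M3 * sqrt (real n) = conf_radius \<rho> G L M3 \<sigma> lam d a n"
    by (simp add: conf_radius_def)
  finally have e: "?e \<bullet> (?V *v ?e) \<le> (conf_radius \<rho> G L M3 \<sigma> lam d a n)\<^sup>2" .
  have G: "transpose (rot t) *v grad F q = G_mat \<rho> *v \<beta>"
    using \<rho> by (simp add: vec_eq_iff forall_2 G_mat_mult_vec \<beta>(1,2) del: transpose_matrix_vector)
  have diff: "transpose (rot t) *v grad F q - g_hat \<rho> lam a y n = - (G_mat \<rho> *v ?e)"
    unfolding G g_hat_def by (simp add: matrix_vector_mult_diff_distrib)
  \<comment> \<open>Passing from all five coefficients to the two of the gradient does not increase
    the form, so the radius is kept.\<close>
  have "(G_mat \<rho> *v ?e) \<bullet> (matrix_inv (P_mat \<rho> lam a n) *v (G_mat \<rho> *v ?e)) \<le> ?e \<bullet> (?V *v ?e)"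
    unfolding P_mat_def using \<rho> by (intro projected_form_le pos_def_V_mat lam n inj_transpose_G_mat) auto
  moreover have "(- x) \<bullet> (A *v (- x)) = x \<bullet> (A *v x)" for A :: "real^2^2" and x
    using matrix_vector_mult_scaleR[of A "- 1" x] by simp
  ultimately show ?thesis
    unfolding conf_set_def mem_Collect_eq diff using e by simp
qed

section \<open>Rotations of the plane\<close>

lemma norm_transpose_rot [simp]: "norm (transpose (rot t) *v x) = norm x"
proof -
  have "(u * cos t + v * sin t)\<^sup>2 + (v * cos t - u * sin t)\<^sup>2 = u\<^sup>2 + v\<^sup>2" for u v
    using sin_cos_squared_add2[of t] by algebra
  from this[of "x $ 1" "x $ 2"]
  have "(transpose (rot t) *v x) \<bullet> (transpose (rot t) *v x) = x \<bullet> x"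
    unfolding inner_vec_def[of "transpose _ *v _"] sum_2 transpose_rot_mult_vec
    by (simp add: inner_vec_def sum_2 cos_add sin_add flip: power2_eq_square)
  then show ?thesis by (simp only: norm_eq_sqrt_inner)
qed

lemma inner_rot_mult_vec: "x \<bullet> (rot t *v d) = (transpose (rot t) *v x) \<bullet> d"
  by (metis dot_lmul_matrix transpose_matrix_vector)

lemma norm_rot [simp]: "norm (rot t *v d) = norm d"
proof -
  have "(cos t * u - sin t * v)\<^sup>2 + (sin t * u + cos t * v)\<^sup>2 = u\<^sup>2 + v\<^sup>2" for u v
    using sin_cos_squared_add2[of t] by algebra
  from this[of "d $ 1" "d $ 2"] have "(rot t *v d) \<bullet> (rot t *v d) = d \<bullet> d"
    by (simp add: rot_def matrix_vector_mult_def inner_vec_def sum_2 flip: power2_eq_square)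
  then show ?thesis by (simp only: norm_eq_sqrt_inner)
qed

section \<open>The strategy\<close>

locale partial_scan =
  fixes M :: "'w measure"
    and F :: "real^2 \<Rightarrow> real" and p0 pstar :: "real^2"
    and G L M3 \<Delta>0 \<rho> \<sigma> lam \<epsilon> \<eta> \<delta> abar :: real
    and m Kmax :: nat
    and \<delta>k :: "nat \<Rightarrow> real"
    and p :: "nat \<Rightarrow> 'w \<Rightarrow> real^2" and \<theta> :: "nat \<Rightarrow> 'w \<Rightarrow> real"
    and \<alpha> w y :: "nat \<Rightarrow> nat \<Rightarrow> 'w \<Rightarrow> real"
    and Info :: "nat \<Rightarrow> nat \<Rightarrow> 'w measure"
    and C :: "nat \<Rightarrow> nat \<Rightarrow> 'w \<Rightarrow> (real^2) set"
    and condA condB :: "nat \<Rightarrow> nat \<Rightarrow> 'w \<Rightarrow> bool"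
  assumes prob: "prob_space M"
    and field: "field_assumption F p0 pstar G L M3 \<Delta>0"
    and pos: "0 < \<rho>" "0 \<le> \<sigma>" "0 < lam" "0 < \<epsilon>"
    and eta: "0 < \<eta>" "\<eta> < 1"
    and delta: "0 < \<delta>" "\<delta> < 1"
    and abar: "0 < abar" "abar < 2 * pi"
    and m: "5 \<le> m"
    and Kmax: "Kmax = nat \<lceil>2 * L * \<Delta>0 / (\<eta>^2 * \<epsilon>^2)\<rceil>"
    and deltak: "\<And>k. k \<le> Kmax \<Longrightarrow> \<delta>k k = \<delta> / (real Kmax + 1)"
    and design: "\<And>k. k \<le> Kmax \<Longrightarrow>
          rho_bar \<rho> G L M3 \<sigma> lam m abar (\<delta>k k) \<le> (1 - \<eta>) * \<epsilon> / 4"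
    and measurement: "\<And>k i \<omega>.
          y k i \<omega> = F (p k \<omega> + \<rho> *\<^sub>R direction (\<theta> k \<omega> + \<alpha> k i \<omega>)) + w k i \<omega>"
    and bearings: "\<And>k i \<omega>. k \<le> Kmax \<Longrightarrow> i \<in> {1..m} \<Longrightarrow> \<omega> \<in> space M \<Longrightarrow>
          \<alpha> k i \<omega> = scan_bearing m abar i"
    and conf: "\<And>k n \<omega>. C k n \<omega> =
          conf_set \<rho> lam (conf_radius \<rho> G L M3 \<sigma> lam (\<delta>k k) (\<lambda>i. \<alpha> k i \<omega>) n)
            (\<lambda>i. \<alpha> k i \<omega>) (\<lambda>i. y k i \<omega>) n"
    and condA: "\<And>k n \<omega>. condA k n \<omega> \<longleftrightarrow> norm_max (C k n \<omega>) \<le> \<epsilon>"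
    and condB: "\<And>k n \<omega>. condB k n \<omega> \<longleftrightarrow> \<eta> * norm_max (C k n \<omega>) \<le> norm_min (C k n \<omega>)"
    and info: "\<And>k i. Info k i = scan_info M (sample_taken m condA condB) \<alpha> y k i"
    and noise: "\<And>k i. k \<le> Kmax \<Longrightarrow> i \<in> {1..m} \<Longrightarrow>
          cond_subgaussian M (Info k (i - 1)) \<sigma> (w k i)"
    and bearing_meas: "\<And>k i. k \<le> Kmax \<Longrightarrow> i \<in> {1..m} \<Longrightarrow>
          \<alpha> k i \<in> borel_measurable (Info k (i - 1))"
    and pose_meas: "\<And>k. k \<le> Kmax \<Longrightarrow>
          p k \<in> borel_measurable (Info k 0) \<and> \<theta> k \<in> borel_measurable (Info k 0)"
    and start: "\<And>\<omega>. \<omega> \<in> space M \<Longrightarrow> p 0 \<omega> = p0"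
    and move: "\<And>k n \<omega>. k \<le> Kmax \<Longrightarrow> n \<le> m \<Longrightarrow> \<omega> \<in> space M \<Longrightarrow>
          episode_reached m condA condB k \<omega> \<Longrightarrow>
          scan_stops condA condB k n \<omega> \<Longrightarrow> \<not> condA k n \<omega> \<Longrightarrow>
          p (Suc k) \<omega> =
            p k \<omega> + (norm_min (C k n \<omega>) / L) *\<^sub>R (rot (\<theta> k \<omega>) *v descent_dir (C k n \<omega>)) \<and>
          direction (\<theta> (Suc k) \<omega>) = rot (\<theta> k \<omega>) *v descent_dir (C k n \<omega>)"
begin

interpretation M: prob_space M by (rule prob)

abbreviation "bearing \<equiv> scan_bearing m abar"
definition \<delta>' :: real where "\<delta>' = \<delta> / (real Kmax + 1)"
abbreviation "radius \<equiv> conf_radius \<rho> G L M3 \<sigma> lam \<delta>' bearing"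
abbreviation "reached \<equiv> episode_reached m condA condB"

text \<open>
  For \<open>n \<ge> 1\<close>, \<open>T k n\<close> is the event that sample \<open>n\<close> of episode \<open>k\<close> is taken. Unlike \<open>sample_taken\<close>
  it is decreasing in \<open>n\<close> from \<open>n = 0\<close> on.
\<close>

definition T :: "nat \<Rightarrow> nat \<Rightarrow> 'w set" where
  "T k n = {\<omega> \<in> space M. reached k \<omega> \<and> n \<le> m \<and> (\<forall>j\<in>{1..<n}. \<not> (condA k j \<omega> \<or> condB k j \<omega>))}"

lemma \<delta>': "0 < \<delta>'" "\<delta>' \<le> 1"
  using delta by (auto simp: \<delta>'_def divide_le_eq)

lemma field_facts: "C3 F" "0 < L" "0 < M3" "\<And>p q. norm (grad F p - grad F q) \<le> L * norm (p - q)"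
  "\<And>q. F pstar \<le> F q" "F p0 - F pstar \<le> \<Delta>0"
proof -
  show "C3 F" "0 < L" "0 < M3" "\<And>p q. norm (grad F p - grad F q) \<le> L * norm (p - q)" "F p0 - F pstar \<le> \<Delta>0"
    using field by (auto simp: field_assumption_def)
  show "F pstar \<le> F q" for q
    using field by (cases "q = pstar") (auto simp: field_assumption_def less_imp_le)
qed

lemma radius_nonneg: "1 \<le> n \<Longrightarrow> 0 \<le> radius n"
  using conf_radius_nonneg[of \<rho> \<sigma> lam M3 n \<delta>'] pos field_facts \<delta>' by simp

text \<open>The bearings are those of the design at every outcome, so radius and shape are
  deterministic and only the measurements remain random.\<close>

lemma C_eq:
  assumes "k \<le> Kmax" "n \<in> {1..m}" "\<omega> \<in> space M"
  shows "C k n \<omega> = conf_set \<rho> lam (radius n) bearing (\<lambda>i. y k i \<omega>) n"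
proof -
  have b: "\<And>i. i \<in> {1..n} \<Longrightarrow> \<alpha> k i \<omega> = bearing i" using bearings assms by simp
  have "conf_radius \<rho> G L M3 \<sigma> lam (\<delta>k k) (\<lambda>i. \<alpha> k i \<omega>) n = radius n"
    unfolding deltak[OF assms(1), folded \<delta>'_def] using assms by (intro conf_radius_cong b) auto
  then show ?thesis unfolding conf by (simp only:) (intro conf_set_cong b refl)
qed

lemma C_properties:
  assumes "k \<le> Kmax" "n \<in> {1..m}" "\<omega> \<in> space M"
  shows "compact (C k n \<omega>)" "convex (C k n \<omega>)" "C k n \<omega> \<noteq> {}"
  unfolding C_eq[OF assms] conf_set_eq_translation using pos assms radius_nonneg[of n]
  by (auto simp: compact_translation convex_translation compact_ellipsoid convex_ellipsoid ellipsoid_nonempty)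

text \<open>The measurements need only be \<open>H\<close>-measurable after restriction to
  \<open>A\<close>. Computing the centre from the restricted values gives an
  \<open>H\<close>-measurable function that agrees with the true centre on \<open>A\<close>. This
  serves both for \<open>M\<close> and for the information available during a scan.\<close>

lemma condition_measurable:
  assumes k: "k \<le> Kmax" and n: "n \<in> {1..m}" and H: "space H = space M" and A: "A \<in> sets H"
    and y: "\<And>j. j \<in> {1..n} \<Longrightarrow> (\<lambda>\<omega>. indicator A \<omega> * y k j \<omega>) \<in> borel_measurable H"
  shows "{\<omega> \<in> A. condA k n \<omega>} \<in> sets H" "{\<omega> \<in> A. condB k n \<omega>} \<in> sets H"
proof -
  define c where "c \<omega> = g_hat \<rho> lam bearing (\<lambda>i. indicator A \<omega> * y k i \<omega>) n" for \<omega>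
  let ?E = "ellipsoid \<rho> lam (radius n) bearing n"
  have E: "compact ?E" "?E \<noteq> {}"
    using pos n radius_nonneg[of n] by (auto intro!: compact_ellipsoid simp: ellipsoid_nonempty)
  have "(\<lambda>x. G_mat \<rho> *v (matrix_inv (V_mat lam bearing n) *v x)) \<in> borel_measurable borel"
    by (simp add: matrix_vector_mul_assoc)
      (intro borel_measurable_continuous_onI matrix_vector_mult_linear_continuous_on)
  moreover have "(\<lambda>\<omega>. \<Sum>i=1..n. (indicator A \<omega> * y k i \<omega>) *\<^sub>R regressor bearing i) \<in> borel_measurable H"
    using y by (intro borel_measurable_sum borel_measurable_scaleR) auto
  ultimately have c: "c \<in> borel_measurable H"
    unfolding c_def g_hat_def theta_hat_def by (rule measurable_compose[rotated])
  have max: "(\<lambda>\<omega>. norm_max ((+) (c \<omega>) ` ?E)) \<in> borel_measurable H"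
    by (rule measurable_compose[OF c borel_measurable_continuous_onI[OF continuous_on_norm_max_translation[OF E]]])
  have min: "(\<lambda>\<omega>. norm_min ((+) (c \<omega>) ` ?E)) \<in> borel_measurable H"
    by (rule measurable_compose[OF c borel_measurable_continuous_onI[OF continuous_on_norm_min_translation[OF E]]])
  have sub: "A \<subseteq> space M" using sets.sets_into_space[OF A] H by simp
  have C: "C k n \<omega> = (+) (c \<omega>) ` ?E" if "\<omega> \<in> A" for \<omega>
    using C_eq[OF k n, of \<omega>] that sub by (auto simp: c_def conf_set_eq_translation)
  have "A \<inter> {\<omega> \<in> space H. norm_max ((+) (c \<omega>) ` ?E) \<le> \<epsilon>} \<in> sets H" using A max by simp
  also have "A \<inter> {\<omega> \<in> space H. norm_max ((+) (c \<omega>) ` ?E) \<le> \<epsilon>} = {\<omega> \<in> A. condA k n \<omega>}"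
    using sub by (auto simp: condA C H)
  finally show "{\<omega> \<in> A. condA k n \<omega>} \<in> sets H" .
  have "A \<inter> {\<omega> \<in> space H. \<eta> * norm_max ((+) (c \<omega>) ` ?E) \<le> norm_min ((+) (c \<omega>) ` ?E)} \<in> sets H"
    using A max min by simp
  also have "A \<inter> {\<omega> \<in> space H. \<eta> * norm_max ((+) (c \<omega>) ` ?E) \<le> norm_min ((+) (c \<omega>) ` ?E)} = {\<omega> \<in> A. condB k n \<omega>}"
    using sub by (auto simp: condB C H)
  finally show "{\<omega> \<in> A. condB k n \<omega>} \<in> sets H" .
qed

section \<open>Stopping events and the information they carry\<close>

lemma T_decreasing: "T k (Suc n) \<subseteq> T k n"
  by (auto simp: T_def)

lemma T_antimono: "n \<le> n' \<Longrightarrow> T k n' \<subseteq> T k n"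
  by (rule lift_Suc_antimono_le[of "T k", OF T_decreasing])

lemma T_Suc:
  assumes "n \<in> {1..<m}"
  shows "T k (Suc n) = T k n - {\<omega> \<in> T k n. condA k n \<omega>} - {\<omega> \<in> T k n. condB k n \<omega>}"
  using assms by (auto simp: T_def less_Suc_eq)

lemma T_first: "T 0 1 = space M"
  using m by (auto simp: T_def episode_reached_def)

lemma T_iff_taken: "n \<in> {1..m} \<Longrightarrow> T k n = {\<omega> \<in> space M. sample_taken m condA condB k n \<omega>}"
  by (auto simp: T_def sample_taken_def)

lemma reached_Suc:
  "reached (Suc k) \<omega> \<longleftrightarrow> reached k \<omega> \<and> (\<exists>n\<le>m. scan_stops condA condB k n \<omega> \<and> \<not> condA k n \<omega>)"
  by (auto simp: episode_reached_def less_Suc_eq)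

lemma scan_stops_iff_T:
  assumes "\<omega> \<in> space M" "reached k \<omega>"
  shows "scan_stops condA condB k n \<omega> \<and> n \<le> m \<longleftrightarrow> n \<in> {1..m} \<and> \<omega> \<in> T k n \<and> (condA k n \<omega> \<or> condB k n \<omega>)"
  using assms by (auto simp: scan_stops_def T_def)

text \<open>Expresses the start of an episode through finitely many tests of the preceding one, as
  the induction over episodes requires.\<close>

lemma T_next:
  "T (Suc k) 1 = (\<Union>n\<in>{1..m}. {\<omega> \<in> T k n. condB k n \<omega>} - {\<omega> \<in> T k n. condA k n \<omega>})"
proof (intro set_eqI iffI)
  fix \<omega> assume "\<omega> \<in> T (Suc k) 1"
  then have \<omega>: "\<omega> \<in> space M" "reached (Suc k) \<omega>" by (simp_all add: T_def)
  then obtain n where "reached k \<omega>" "n \<le> m" "scan_stops condA condB k n \<omega>" "\<not> condA k n \<omega>"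
    unfolding reached_Suc by blast
  then show "\<omega> \<in> (\<Union>n\<in>{1..m}. {\<omega> \<in> T k n. condB k n \<omega>} - {\<omega> \<in> T k n. condA k n \<omega>})"
    using scan_stops_iff_T[OF \<omega>(1), of k n] by (intro UN_I[of n]) simp_all
next
  fix \<omega> assume "\<omega> \<in> (\<Union>n\<in>{1..m}. {\<omega> \<in> T k n. condB k n \<omega>} - {\<omega> \<in> T k n. condA k n \<omega>})"
  then obtain n where n: "n \<in> {1..m}" "\<omega> \<in> T k n" "condB k n \<omega>" "\<not> condA k n \<omega>" by auto
  then have \<omega>: "\<omega> \<in> space M" "reached k \<omega>" by (simp_all add: T_def)
  then have "reached (Suc k) \<omega>"
    using scan_stops_iff_T[OF \<omega>, of n] n unfolding reached_Suc by (intro conjI exI[of _ n]) simp_all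
  then show "\<omega> \<in> T (Suc k) 1" using \<omega> m by (simp add: T_def)
qed

lemma Info_sets: "sets (Info k i) = sigma_sets (space M)
    {{\<omega> \<in> space M. sample_taken m condA condB k' j \<omega> \<and> (\<alpha> k' j \<omega>, y k' j \<omega>) \<in> S} | k' j S.
      (k' < k \<or> k' = k \<and> j \<le> i) \<and> S \<in> sets (borel :: (real \<times> real) measure)}"
  unfolding info scan_info_def by (rule sets_measure_of) auto

lemma space_Info [simp]: "space (Info k i) = space M"
  unfolding info scan_info_def by (rule space_measure_of) auto

lemma Info_mono: "i \<le> i' \<Longrightarrow> sets (Info k i) \<subseteq> sets (Info k i')"
  unfolding Info_sets
proof (intro sigma_sets_mono' Collect_mono impI)
  fix X
  assume "i \<le> i'" and "\<exists>k' j S. X = {\<omega> \<in> space M. sample_taken m condA condB k' j \<omega> \<and> (\<alpha> k' j \<omega>, y k' j \<omega>) \<in> S} \<and>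
    (k' < k \<or> k' = k \<and> j \<le> i) \<and> S \<in> sets (borel :: (real \<times> real) measure)"
  then show "\<exists>k' j S. X = {\<omega> \<in> space M. sample_taken m condA condB k' j \<omega> \<and> (\<alpha> k' j \<omega>, y k' j \<omega>) \<in> S} \<and>
    (k' < k \<or> k' = k \<and> j \<le> i') \<and> S \<in> sets (borel :: (real \<times> real) measure)"
    by (elim exE conjE, intro exI conjI) (assumption | auto)+
qed

lemma Info_generator:
  assumes "k' < k \<or> k' = k \<and> j \<le> i" "j \<in> {1..m}" "S \<in> sets (borel :: (real \<times> real) measure)"
  shows "{\<omega> \<in> T k' j. (\<alpha> k' j \<omega>, y k' j \<omega>) \<in> S} \<in> sets (Info k i)"
proof -
  have "{\<omega> \<in> T k' j. (\<alpha> k' j \<omega>, y k' j \<omega>) \<in> S}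
    = {\<omega> \<in> space M. sample_taken m condA condB k' j \<omega> \<and> (\<alpha> k' j \<omega>, y k' j \<omega>) \<in> S}"
    using assms(2) by (auto simp: T_iff_taken)
  then show ?thesis unfolding Info_sets using assms by (intro sigma_sets.Basic) blast
qed

lemma T_in_Info:
  assumes "k' < k \<or> k' = k \<and> j \<le> i" "j \<in> {1..m}"
  shows "T k' j \<in> sets (Info k i)"
  using Info_generator[OF assms, of UNIV] by simp

text \<open>The generators of \<open>Info\<close> reveal a measurement only where the sample is
  taken; elsewhere the product is the constant 0, so a preimage gains either nothing or the whole
  complement.\<close>

lemma y_Info_measurable:
  assumes "k' < k \<or> k' = k \<and> j \<le> i" "j \<in> {1..m}" and A: "A \<in> sets (Info k i)" "A \<subseteq> T k' j"
  shows "(\<lambda>\<omega>. indicator A \<omega> * y k' j \<omega>) \<in> borel_measurable (Info k i)"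
proof -
  have "(\<lambda>\<omega>. indicator (T k' j) \<omega> * y k' j \<omega>) \<in> borel_measurable (Info k i)"
  proof (rule measurableI)
    fix S :: "real set" assume S: "S \<in> sets borel"
    let ?X = "{\<omega> \<in> T k' j. (\<alpha> k' j \<omega>, y k' j \<omega>) \<in> UNIV \<times> S}"
    have "UNIV \<times> S \<in> sets (borel :: (real \<times> real) measure)"
      using S by (simp add: borel_prod[symmetric])
    then have X: "?X \<in> sets (Info k i)" by (rule Info_generator[OF assms(1,2)])
    have sub: "T k' j \<subseteq> space M" by (auto simp: T_def)
    have "(\<lambda>\<omega>. indicator (T k' j) \<omega> * y k' j \<omega>) -` S \<inter> space (Info k i)
      = (if 0 \<in> S then ?X \<union> (space (Info k i) - T k' j) else ?X)"
      using sub by (auto simp: indicator_def of_bool_def split: if_splits)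
    then show "(\<lambda>\<omega>. indicator (T k' j) \<omega> * y k' j \<omega>) -` S \<inter> space (Info k i) \<in> sets (Info k i)"
      using X sets.compl_sets[OF T_in_Info[OF assms(1,2)]] by (auto intro: sets.Un)
  qed simp
  then have "(\<lambda>\<omega>. indicator A \<omega> * (indicator (T k' j) \<omega> * y k' j \<omega>)) \<in> borel_measurable (Info k i)"
    using A(1) by measurable
  moreover have "(\<lambda>\<omega>. indicator A \<omega> * (indicator (T k' j) \<omega> * y k' j \<omega>)) = (\<lambda>\<omega>. indicator A \<omega> * y k' j \<omega>)"
    using A(2) by (auto simp: indicator_def fun_eq_iff)
  ultimately show ?thesis by simp
qed

lemma w_measurable: "k \<le> Kmax \<Longrightarrow> i \<in> {1..m} \<Longrightarrow> w k i \<in> borel_measurable M"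
  using noise[of k i] by (auto simp: cond_subgaussian_def)

lemma signal_measurable:
  assumes "k \<le> Kmax" "i \<in> {1..m}" "space H = space M"
    "p k \<in> borel_measurable H" "\<theta> k \<in> borel_measurable H"
  shows "(\<lambda>\<omega>. F (p k \<omega> + \<rho> *\<^sub>R direction (\<theta> k \<omega> + \<alpha> k i \<omega>))) \<in> borel_measurable H"
proof -
  have dir: "direction = (\<lambda>t. cos t *\<^sub>R axis 1 1 + sin t *\<^sub>R axis 2 1)"
    by (auto simp: fun_eq_iff vec_eq_iff forall_2 axis_def)
  have "continuous_on UNIV direction" unfolding dir by (intro continuous_intros)
  then have "direction \<in> borel_measurable borel" by (rule borel_measurable_continuous_onI)
  moreover have "F \<in> borel_measurable borel"
    using field_facts(1) unfolding C3_def
    by (intro borel_measurable_continuous_onI)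
      (auto simp: continuous_on_eq_continuous_at intro: differentiable_imp_continuous_within)
  ultimately have "(\<lambda>\<omega>. F (p k \<omega> + \<rho> *\<^sub>R direction (\<theta> k \<omega> + bearing i))) \<in> borel_measurable H"
    using assms(4,5) by measurable
  then show ?thesis
    using assms bearings by (subst measurable_cong) auto
qed

lemma M_measurable_episode:
  assumes k: "k \<le> Kmax" and T1: "T k 1 \<in> sets M" and y: "\<And>j. j \<in> {1..m} \<Longrightarrow> y k j \<in> borel_measurable M"
  shows "n \<in> {1..m} \<Longrightarrow> T k n \<in> sets M" and "T (Suc k) 1 \<in> sets M"
proof -
  have cond: "{\<omega> \<in> T k n. condA k n \<omega>} \<in> sets M" "{\<omega> \<in> T k n. condB k n \<omega>} \<in> sets M"
    if "T k n \<in> sets M" "n \<in> {1..m}" for n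
    using that y by (auto intro!: condition_measurable k)
  show T: "T k n \<in> sets M" if "n \<in> {1..m}" for n
  proof -
    have "1 \<le> n" "n \<le> m" using that by auto
    then show ?thesis
    proof (induction n rule: dec_induct)
      case base
      show ?case by (rule T1)
    next
      case (step n)
      then show ?case using cond[of n] by (subst T_Suc) auto
    qed
  qed
  show "T (Suc k) 1 \<in> sets M"
    unfolding T_next using cond T by (intro sets.finite_UN sets.Diff) auto
qed

lemma subalgebra_Info:
  assumes "\<And>k' j. (k' < k \<or> k' = k \<and> j \<le> i) \<Longrightarrow> j \<in> {1..m} \<Longrightarrow>
      k' \<le> Kmax \<and> T k' j \<in> sets M \<and> y k' j \<in> borel_measurable M"
  shows "subalgebra M (Info k i)"
proof -
  have "{\<omega> \<in> space M. sample_taken m condA condB k' j \<omega> \<and> (\<alpha> k' j \<omega>, y k' j \<omega>) \<in> S} \<in> sets M"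
    if k': "k' < k \<or> k' = k \<and> j \<le> i" and S: "S \<in> sets (borel :: (real \<times> real) measure)" for k' j S
  proof (cases "j \<in> {1..m}")
    case True
    note * = assms[OF k' True]
    \<comment> \<open>The bearing is replaced by its constant value: measurability of
      \<open>\<alpha>\<close> is assumed relative to \<open>Info\<close>, whose inclusion in
      \<open>M\<close> is what is being proved.\<close>
    then have "(\<lambda>\<omega>. (bearing j, y k' j \<omega>)) \<in> M \<rightarrow>\<^sub>M borel"
      by (auto simp: borel_prod[symmetric])
    then have "T k' j \<inter> ((\<lambda>\<omega>. (bearing j, y k' j \<omega>)) -` S \<inter> space M) \<in> sets M"
      using * S by (intro sets.Int measurable_sets) auto
    also have "T k' j \<inter> ((\<lambda>\<omega>. (bearing j, y k' j \<omega>)) -` S \<inter> space M)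
      = {\<omega> \<in> space M. sample_taken m condA condB k' j \<omega> \<and> (\<alpha> k' j \<omega>, y k' j \<omega>) \<in> S}"
      using * True bearings by (auto simp: T_iff_taken)
    finally show ?thesis .
  next
    case False
    then have "\<not> sample_taken m condA condB k' j \<omega>" for \<omega> by (auto simp: sample_taken_def)
    then show ?thesis by simp
  qed
  then have "sets (Info k i) \<subseteq> sets M"
    unfolding Info_sets by (intro sets.sigma_sets_subset) blast
  then show ?thesis by (simp add: subalgebra_def)
qed

text \<open>
  The pose of episode \<open>k\<close> is measurable because the earlier episodes are, and it makes the
  samples of episode \<open>k\<close> measurable in turn.
\<close>

lemma M_measurable:
  assumes "k \<le> Kmax"
  shows "T k 1 \<in> sets M \<and> (\<forall>j\<in>{1..m}. y k j \<in> borel_measurable M)"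
  using assms
proof (induction k rule: less_induct)
  case (less k)
  have "subalgebra M (Info k 0)"
  proof (rule subalgebra_Info)
    fix k' j assume "k' < k \<or> k' = k \<and> j \<le> 0" and j: "j \<in> {1..m}"
    then have "k' < k" by simp
    then have "k' \<le> Kmax" and IH: "T k' 1 \<in> sets M" "\<forall>j\<in>{1..m}. y k' j \<in> borel_measurable M"
      using less.IH[of k'] less.prems by simp_all
    moreover have "T k' j \<in> sets M" using \<open>k' \<le> Kmax\<close> IH j M_measurable_episode(1)[of k' j] by blast
    ultimately show "k' \<le> Kmax \<and> T k' j \<in> sets M \<and> y k' j \<in> borel_measurable M" using j by blast
  qed
  then have "p k \<in> borel_measurable M" "\<theta> k \<in> borel_measurable M"
    using pose_meas[OF less.prems] by (auto intro: measurable_from_subalg)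
  then have "y k j \<in> borel_measurable M" if "j \<in> {1..m}" for j
  proof -
    have "y k j = (\<lambda>\<omega>. F (p k \<omega> + \<rho> *\<^sub>R direction (\<theta> k \<omega> + \<alpha> k j \<omega>)) + w k j \<omega>)"
      by (rule ext) (rule measurement)
    then show ?thesis
      using signal_measurable[OF less.prems that refl] w_measurable[OF less.prems that]
        \<open>p k \<in> borel_measurable M\<close> \<open>\<theta> k \<in> borel_measurable M\<close> by (simp only: borel_measurable_add)
  qed
  moreover have "T k 1 \<in> sets M"
  proof (cases k)
    case 0
    then show ?thesis using T_first by simp
  next
    case (Suc k')
    then have "k' \<le> Kmax" and IH: "T k' 1 \<in> sets M" "\<forall>j\<in>{1..m}. y k' j \<in> borel_measurable M"
      using less.IH[of k'] less.prems by simp_all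
    then show ?thesis using M_measurable_episode(2)[of k'] unfolding Suc by blast
  qed
  ultimately show ?case by simp
qed

lemma T_M: "k \<le> Kmax \<Longrightarrow> n \<in> {1..m} \<Longrightarrow> T k n \<in> sets M"
  using M_measurable M_measurable_episode(1) by blast

lemma subalgebra_Info_M: "k \<le> Kmax \<Longrightarrow> subalgebra M (Info k i)"
proof (rule subalgebra_Info)
  fix k' j assume "k \<le> Kmax" "k' < k \<or> k' = k \<and> j \<le> i" "j \<in> {1..m}"
  then have "k' \<le> Kmax" by auto
  then show "k' \<le> Kmax \<and> T k' j \<in> sets M \<and> y k' j \<in> borel_measurable M"
    using M_measurable[of k'] T_M[of k' j] \<open>j \<in> {1..m}\<close> by blast
qed

text \<open>Whether sample \<open>n + 1\<close> is taken is decided by tests that use only the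
  samples up to \<open>n\<close>, all of them taken on \<open>T k n\<close>.\<close>

lemma T_predictable:
  assumes k: "k \<le> Kmax" and n: "n \<in> {1..<m}"
  shows "T k (Suc n) \<in> sets (Info k n)"
proof -
  have n': "n \<in> {1..m}" using n by simp
  have T: "T k n \<in> sets (Info k n)" using n' by (intro T_in_Info) auto
  have y: "(\<lambda>\<omega>. indicator (T k n) \<omega> * y k j \<omega>) \<in> borel_measurable (Info k n)" if "j \<in> {1..n}" for j
    using that n' by (intro y_Info_measurable[OF _ _ T T_antimono]) auto
  have "{\<omega> \<in> T k n. condA k n \<omega>} \<in> sets (Info k n)" "{\<omega> \<in> T k n. condB k n \<omega>} \<in> sets (Info k n)"
    by (rule condition_measurable[OF k n' space_Info T y], assumption)+
  then show ?thesis unfolding T_Suc[OF n] using T by (intro sets.Diff)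
qed

text \<open>Pose and bearing determine the noiseless signal, so the noise of a taken sample can be
  recovered as measurement minus signal.\<close>

lemma w_Info_measurable:
  assumes k: "k \<le> Kmax" and n: "n \<in> {1..<m}" and j: "j \<in> {1..n}"
  shows "(\<lambda>\<omega>. indicator (T k (Suc n)) \<omega> * w k j \<omega>) \<in> borel_measurable (Info k n)"
proof -
  let ?s = "\<lambda>\<omega>. F (p k \<omega> + \<rho> *\<^sub>R direction (\<theta> k \<omega> + \<alpha> k j \<omega>))"
  have T: "T k (Suc n) \<in> sets (Info k n)" by (rule T_predictable[OF k n])
  have "subalgebra (Info k n) (Info k 0)" using Info_mono[of 0 n k] by (simp add: subalgebra_def)
  then have "p k \<in> borel_measurable (Info k n)" "\<theta> k \<in> borel_measurable (Info k n)"
    using pose_meas[OF k] by (auto intro: measurable_from_subalg)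
  then have s: "?s \<in> borel_measurable (Info k n)"
    using k n j by (intro signal_measurable) auto
  have y: "(\<lambda>\<omega>. indicator (T k (Suc n)) \<omega> * y k j \<omega>) \<in> borel_measurable (Info k n)"
    using n j by (intro y_Info_measurable T T_antimono) auto
  have "(\<lambda>\<omega>. indicator (T k (Suc n)) \<omega> * w k j \<omega>)
    = (\<lambda>\<omega>. indicator (T k (Suc n)) \<omega> * y k j \<omega> - indicator (T k (Suc n)) \<omega> * ?s \<omega>)"
    by (auto simp: fun_eq_iff measurement indicator_def)
  then show ?thesis using y s T by simp
qed

section \<open>Coverage of the gradient and termination\<close>

lemma gradient_in_C:
  assumes k: "k \<le> Kmax"
  obtains B where "B \<in> sets M" "measure M B \<le> \<delta>'"
    "\<And>n \<omega>. n \<in> {1..m} \<Longrightarrow> \<omega> \<in> space M - B \<Longrightarrow> \<omega> \<in> T k n \<Longrightarrow>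
      transpose (rot (\<theta> k \<omega>)) *v grad F (p k \<omega>) \<in> C k n \<omega>"
proof -
  define B1 where "B1 = {\<omega> \<in> space M. \<sigma> * sqrt (2 * ln (2 / (\<delta>' / 2))) < \<bar>w k 1 \<omega>\<bar>}"
  have m1: "1 \<in> {1..m}" using m by simp
  have "w k 1 \<in> borel_measurable M" by (rule w_measurable[OF k m1])
  then have B1: "B1 \<in> sets M" unfolding B1_def by measurable
  have B1': "measure M B1 \<le> \<delta>' / 2"
    unfolding B1_def using \<delta>' pos
    by (intro cond_subgaussian_tail[OF prob subalgebra_Info_M[OF k] noise[OF k m1]]) auto
  \<comment> \<open>The level \<open>2 / \<delta>'\<close> fails with probability at most
    \<open>\<delta>' / 2\<close>, the half left over by the first sample.\<close>
  obtain B2 where B2: "B2 \<in> sets M" "measure M B2 \<le> 1 / (2 / \<delta>')"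
    and B2': "\<And>n \<omega>. n \<in> {1..m} \<Longrightarrow> \<omega> \<in> space M - B2 \<Longrightarrow> \<omega> \<in> T k n \<Longrightarrow>
      (\<Sum>i=2..n. w k i \<omega> *\<^sub>R regressor bearing i)
        \<bullet> (matrix_inv (V_mat lam bearing n) *v (\<Sum>i=2..n. w k i \<omega> *\<^sub>R regressor bearing i))
      \<le> 2 * \<sigma>\<^sup>2 * ln (2 / \<delta>' * sqrt (det (V_mat lam bearing n) / det (V_mat lam bearing 1)))"
  proof (rule self_normalized_bound[where M = M and \<sigma> = \<sigma> and c = "2 / \<delta>'" and V = "V_mat lam bearing"
        and \<psi> = "regressor bearing" and T = "T k" and H = "Info k" and X = "w k" and N = m])
    show "prob_space M" "0 \<le> \<sigma>" by (fact prob pos)+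
    show "0 < 2 / \<delta>'" using \<delta>' by simp
    show "pos_def (V_mat lam bearing 1)" using pos by (intro pos_def_V_mat) auto
    show "\<And>n. V_mat lam bearing (Suc n)
        = V_mat lam bearing n + outer (regressor bearing (Suc n)) (regressor bearing (Suc n))"
      by (rule V_mat_Suc)
    show "\<And>n. regressor bearing n \<noteq> 0" by (rule regressor_nonzero)
    show "\<And>n. n \<in> {1..m} \<Longrightarrow> T k n \<in> sets M" by (rule T_M[OF k])
    show "\<And>n. T k (Suc n) \<subseteq> T k n" by (rule T_decreasing)
    show "\<And>n. subalgebra M (Info k n)" by (rule subalgebra_Info_M[OF k])
    show "\<And>n. n \<in> {1..<m} \<Longrightarrow> T k (Suc n) \<in> sets (Info k n)" by (rule T_predictable[OF k])
    show "\<And>n j. n \<in> {1..<m} \<Longrightarrow> j \<in> {2..n} \<Longrightarrow>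
        (\<lambda>\<omega>. indicator (T k (Suc n)) \<omega> * w k j \<omega>) \<in> borel_measurable (Info k n)"
      by (intro w_Info_measurable k) auto
    show "cond_subgaussian M (Info k n) \<sigma> (w k (Suc n))" if "n \<in> {1..<m}" for n
      using noise[OF k, of "Suc n"] that by simp
  qed blast
  show thesis
  proof (rule that)
    show "B1 \<union> B2 \<in> sets M" using B1 B2 by simp
    have "measure M (B1 \<union> B2) \<le> measure M B1 + measure M B2" by (rule measure_Un_le[OF B1 B2(1)])
    then show "measure M (B1 \<union> B2) \<le> \<delta>'" using B1' B2(2) by simp
  next
    fix n \<omega> assume n: "n \<in> {1..m}" and \<omega>: "\<omega> \<in> space M - (B1 \<union> B2)" "\<omega> \<in> T k n"
    have sp: "\<omega> \<in> space M" using \<omega> by simp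
    show "transpose (rot (\<theta> k \<omega>)) *v grad F (p k \<omega>) \<in> C k n \<omega>"
      unfolding C_eq[OF k n sp]
    proof (rule gradient_in_conf_set[OF field, where w = "\<lambda>i. w k i \<omega>"])
      show "0 < \<rho>" "0 \<le> \<sigma>" "0 < lam" "0 < \<delta>'" "\<delta>' \<le> 1" "1 \<le> n" using pos \<delta>' n by auto
      show "y k i \<omega> = F (p k \<omega> + \<rho> *\<^sub>R direction (\<theta> k \<omega> + bearing i)) + w k i \<omega>" if "i \<in> {1..n}" for i
        using measurement[of k i \<omega>] bearings[OF k _ sp, of i] that n by simp
      show "\<bar>w k 1 \<omega>\<bar> \<le> \<sigma> * sqrt (2 * ln (2 / (\<delta>' / 2)))" using \<omega> by (auto simp: B1_def)
    qed (use B2'[OF n _ \<omega>(2)] \<omega>(1) in auto)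
  qed
qed

text \<open>This holds at every outcome, since the size of the set after \<open>m\<close> samples is
  deterministic. If the termination test fails, then \<open>(1 - \<eta>) * norm_max\<close> exceeds
  \<open>(1 - \<eta>) * \<epsilon>\<close>, while the two norms differ by at most half of that; so
  the motion test succeeds.\<close>

lemma scan_stops_within:
  assumes k: "k \<le> Kmax" and \<omega>: "\<omega> \<in> space M"
  obtains n where "n \<in> {1..m}" "scan_stops condA condB k n \<omega>"
proof -
  have m': "m \<in> {1..m}" "1 \<le> m" using m by auto
  note C = C_properties[OF k m'(1) \<omega>]
  have kap: "0 < kappa m abar" using m abar by (intro kappa_pos) auto
  then have k0: "0 < real m * kappa m abar" using m by simp
  have "radius m = beta_bar \<rho> G L M3 \<sigma> lam m abar \<delta>'"
    unfolding conf_radius_def beta_bar_def det_ratio_def V_mat_1 by (simp add: real_sqrt_divide mult.commute)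
  then have R: "radius m / (\<rho> * sqrt (real m * kappa m abar)) \<le> (1 - \<eta>) * \<epsilon> / 4"
    using design[OF k] deltak[OF k, folded \<delta>'_def] by (simp add: rho_bar_def)
  have "norm (g - g_hat \<rho> lam bearing (\<lambda>i. y k i \<omega>) m) \<le> (1 - \<eta>) * \<epsilon> / 4" if "g \<in> C k m \<omega>" for g
    using conf_set_radius[OF _ _ m'(2) radius_nonneg[OF m'(2)] k0 kappa_le_V_mat_form, of \<rho> lam g "\<lambda>i. y k i \<omega>"]
      that R pos m unfolding C_eq[OF k m'(1) \<omega>] by linarith
  from norm_max_le_norm_min_add[OF C(1,3) this]
  have gap: "norm_max (C k m \<omega>) \<le> norm_min (C k m \<omega>) + (1 - \<eta>) * \<epsilon> / 2" by (simp add: mult.commute)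
  have AB: "condA k m \<omega> \<or> condB k m \<omega>"
  proof (cases "norm_max (C k m \<omega>) \<le> \<epsilon>")
    case False
    then have "(1 - \<eta>) * \<epsilon> \<le> (1 - \<eta>) * norm_max (C k m \<omega>)" using eta by (intro mult_left_mono) auto
    then have le: "(1 - \<eta>) * \<epsilon> \<le> norm_max (C k m \<omega>) - \<eta> * norm_max (C k m \<omega>)" by (simp add: left_diff_distrib)
    have "h \<le> b" if "a \<le> x - h" "0 \<le> a" "x \<le> b + a / 2" for a b h x :: real
      using that by linarith
    from this[OF le _ gap] have "\<eta> * norm_max (C k m \<omega>) \<le> norm_min (C k m \<omega>)" using eta pos by simp
    then show ?thesis by (simp add: condB)
  qed (simp add: condA)
  define n where "n = (LEAST n. 1 \<le> n \<and> (condA k n \<omega> \<or> condB k n \<omega>))"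
  have n: "1 \<le> n \<and> (condA k n \<omega> \<or> condB k n \<omega>)"
    unfolding n_def by (rule LeastI[of _ m]) (use AB m' in simp)
  have "n \<le> m" unfolding n_def by (rule Least_le) (use AB m' in simp)
  moreover have "\<not> (condA k j \<omega> \<or> condB k j \<omega>)" if "j \<in> {1..<n}" for j
  proof -
    have "\<not> (1 \<le> j \<and> (condA k j \<omega> \<or> condB k j \<omega>))"
      by (rule not_less_Least[of j "\<lambda>n. 1 \<le> n \<and> (condA k n \<omega> \<or> condB k n \<omega>)"])
        (use that in \<open>simp add: n_def\<close>)
    then show ?thesis using that by simp
  qed
  ultimately show thesis using n by (intro that[of n]) (simp_all add: scan_stops_def)
qed

text \<open>The step length \<open>?\<gamma> / L\<close> minimizes the quadratic bound
  \<open>L / 2 * l\<^sup>2 - ?\<gamma> * l\<close> of the descent lemma, with value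
  \<open>- ?\<gamma>\<^sup>2 / (2 * L)\<close>. The two tests give
  \<open>?\<gamma> > \<eta> * \<epsilon>\<close>.\<close>

lemma move_decreases:
  assumes k: "k \<le> Kmax" and \<omega>: "\<omega> \<in> space M" "reached k \<omega>" and n: "n \<in> {1..m}"
    and stops: "scan_stops condA condB k n \<omega>" "\<not> condA k n \<omega>"
    and g: "transpose (rot (\<theta> k \<omega>)) *v grad F (p k \<omega>) \<in> C k n \<omega>"
  shows "F (p (Suc k) \<omega>) < F (p k \<omega>) - (\<eta> * \<epsilon>)\<^sup>2 / (2 * L)"
proof -
  let ?C = "C k n \<omega>" let ?R = "rot (\<theta> k \<omega>)" let ?d = "descent_dir ?C" let ?\<gamma> = "norm_min ?C"
  note C = C_properties[OF k n \<omega>(1)]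
  have "\<epsilon> < norm_max ?C" "\<eta> * norm_max ?C \<le> ?\<gamma>"
    using stops by (auto simp: scan_stops_def condA condB)
  then have \<gamma>: "\<eta> * \<epsilon> < ?\<gamma>" using eta by (smt (verit) mult_strict_left_mono)
  then have \<gamma>0: "0 < ?\<gamma>" using eta pos by (smt (verit) mult_pos_pos)
  have p': "p (Suc k) \<omega> = p k \<omega> + (?\<gamma> / L) *\<^sub>R (?R *v ?d)"
    using move[OF k _ \<omega> stops] n by simp
  have "F (p (Suc k) \<omega>) \<le> F (p k \<omega>) + grad F (p k \<omega>) \<bullet> ((?\<gamma> / L) *\<^sub>R (?R *v ?d))
      + L / 2 * (norm ((?\<gamma> / L) *\<^sub>R (?R *v ?d)))\<^sup>2"
    unfolding p' by (rule descent_lemma[OF field_facts(1,4)])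
  also have "norm ((?\<gamma> / L) *\<^sub>R (?R *v ?d)) = ?\<gamma> / L"
    using descent_dir_properties(1)[OF C \<gamma>0] \<gamma>0 field_facts(2) by simp
  also have "grad F (p k \<omega>) \<bullet> ((?\<gamma> / L) *\<^sub>R (?R *v ?d)) = ?\<gamma> / L * ((transpose ?R *v grad F (p k \<omega>)) \<bullet> ?d)"
    by (simp only: inner_scaleR_right inner_rot_mult_vec)
  also have "\<dots> \<le> ?\<gamma> / L * (- ?\<gamma>)"
    using descent_dir_properties(2)[OF C \<gamma>0 g] \<gamma>0 field_facts(2) by (intro mult_left_mono) auto
  also have "F (p k \<omega>) + ?\<gamma> / L * (- ?\<gamma>) + L / 2 * (?\<gamma> / L)\<^sup>2 = F (p k \<omega>) - ?\<gamma>\<^sup>2 / (2 * L)"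
    using field_facts(2) by (simp add: field_simps power2_eq_square)
  also have "\<dots> < F (p k \<omega>) - (\<eta> * \<epsilon>)\<^sup>2 / (2 * L)"
    using \<gamma> eta pos field_facts(2) by (intro diff_strict_left_mono divide_strict_right_mono power_strict_mono) auto
  finally show ?thesis by simp
qed

text \<open>If none of the episodes \<open>0\<close> to \<open>Kmax\<close> ended the search, there
  would be \<open>Kmax + 1\<close> moves, and the total decrease would exceed the initial gap.
  Coverage at the last test turns the bound on the greatest norm into one on the gradient.\<close>

lemma terminates:
  assumes \<omega>: "\<omega> \<in> space M"
    and g: "\<And>k n. k \<le> Kmax \<Longrightarrow> n \<in> {1..m} \<Longrightarrow> \<omega> \<in> T k n \<Longrightarrow>
      transpose (rot (\<theta> k \<omega>)) *v grad F (p k \<omega>) \<in> C k n \<omega>"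
  obtains K n where "K \<le> Kmax" "reached K \<omega>" "n \<in> {1..m}" "scan_stops condA condB K n \<omega>" "condA K n \<omega>"
    "norm (grad F (p K \<omega>)) \<le> \<epsilon>"
proof -
  define c where "c = (\<eta> * \<epsilon>)\<^sup>2 / (2 * L)"
  have c: "0 < c" using eta pos field_facts(2) by (simp add: c_def)
  have "\<exists>K\<le>Kmax. reached K \<omega> \<and> (\<exists>n\<in>{1..m}. scan_stops condA condB K n \<omega> \<and> condA K n \<omega>)"
  proof (rule ccontr)
    assume contra: "\<not> ?thesis"
    have "reached k \<omega> \<and> F (p k \<omega>) \<le> F p0 - real k * c" if "k \<le> Suc Kmax" for k
      using that
    proof (induction k)
      case 0
      then show ?case using start[OF \<omega>] by (simp add: episode_reached_def)
    next
      case (Suc k)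
      then have k: "k \<le> Kmax" and IH: "reached k \<omega>" "F (p k \<omega>) \<le> F p0 - real k * c" by auto
      obtain n where n: "n \<in> {1..m}" "scan_stops condA condB k n \<omega>" by (rule scan_stops_within[OF k \<omega>])
      have nA: "\<not> condA k n \<omega>" using contra k IH n by blast
      have "\<omega> \<in> T k n" using scan_stops_iff_T[OF \<omega> IH(1), of n] n by simp
      then have "F (p (Suc k) \<omega>) < F (p k \<omega>) - c"
        unfolding c_def by (intro move_decreases[OF k \<omega> IH(1) n nA] g k n)
      moreover have "reached (Suc k) \<omega>"
        unfolding reached_Suc using IH n nA by auto
      ultimately show ?case using IH(2) by (simp add: distrib_right)
    qed
    from this[of "Suc Kmax"] have "F pstar \<le> F p0 - real (Suc Kmax) * c"
      using field_facts(5) order_trans by blast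
    then have "real (Suc Kmax) * c \<le> \<Delta>0" using field_facts(6) by simp
    \<comment> \<open>The ceiling gives only this weak inequality; the contradiction comes from the
      extra move, as \<open>(Kmax + 1) * c \<le> \<Delta>0 \<le> Kmax * c\<close>.\<close>
    moreover have "\<Delta>0 / c \<le> real Kmax"
    proof -
      have "\<Delta>0 / c = 2 * L * \<Delta>0 / (\<eta>^2 * \<epsilon>^2)" by (simp add: c_def power_mult_distrib)
      then show ?thesis unfolding Kmax by (simp add: real_nat_ceiling_ge)
    qed
    ultimately show False using c by (simp add: divide_le_eq distrib_right)
  qed
  then obtain K n where K: "K \<le> Kmax" "reached K \<omega>" "n \<in> {1..m}" "scan_stops condA condB K n \<omega>" "condA K n \<omega>"
    by blast
  have "\<omega> \<in> T K n" using scan_stops_iff_T[OF \<omega> K(2), of n] K by simp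
  from norm_le_norm_max[OF C_properties(1)[OF K(1,3) \<omega>] g[OF K(1,3) this]]
  have "norm (grad F (p K \<omega>)) \<le> \<epsilon>" using K(5) by (simp add: condA del: transpose_matrix_vector)
  with K show thesis by (rule that)
qed

section \<open>Measurability and probability of success\<close>

lemma condition_M_measurable:
  assumes "k \<le> Kmax" "n \<in> {1..m}"
  shows "{\<omega> \<in> space M. condA k n \<omega>} \<in> sets M" "{\<omega> \<in> space M. condB k n \<omega>} \<in> sets M"
proof -
  have y: "(\<lambda>\<omega>. indicator (space M) \<omega> * y k j \<omega>) \<in> borel_measurable M" if "j \<in> {1..n}" for j
    using M_measurable[OF assms(1)] assms(2) that
    by (intro borel_measurable_times borel_measurable_indicator sets.top) auto
  show "{\<omega> \<in> space M. condA k n \<omega>} \<in> sets M" "{\<omega> \<in> space M. condB k n \<omega>} \<in> sets M"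
    by (rule condition_measurable[OF assms refl sets.top y], assumption)+
qed

lemma scan_stops_measurable:
  assumes "k \<le> Kmax" "n \<le> m"
  shows "{\<omega> \<in> space M. scan_stops condA condB k n \<omega>} \<in> sets M"
proof (cases "1 \<le> n")
  case True
  then have "{\<omega> \<in> space M. (condA k n \<omega> \<or> condB k n \<omega>) \<and> (\<forall>j\<in>{1..<n}. \<not> (condA k j \<omega> \<or> condB k j \<omega>))} \<in> sets M"
    using assms
    by (intro sets.sets_Collect_conj sets.sets_Collect_disj sets.sets_Collect_finite_All sets.sets_Collect_neg
        condition_M_measurable) auto
  with True show ?thesis by (simp add: scan_stops_def)
qed (simp add: scan_stops_def)

lemma p_measurable: "k \<le> Kmax \<Longrightarrow> p k \<in> borel_measurable M"
  using pose_meas measurable_from_subalg[OF subalgebra_Info_M] by blast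

text \<open>\<open>K\<close> is at once the index of the last episode and the number of moves made,
  because reaching an episode requires a move in each earlier one.\<close>

definition success :: "'w set" where
  "success = {\<omega> \<in> space M. \<exists>K\<le>Kmax. reached K \<omega> \<and>
     (\<forall>k\<le>K. \<exists>n\<le>m. scan_stops condA condB k n \<omega> \<and> \<alpha> k n \<omega> - \<alpha> k 1 \<omega> \<le> abar) \<and>
     (\<exists>n\<le>m. scan_stops condA condB K n \<omega> \<and> condA K n \<omega>) \<and>
     norm (grad F (p K \<omega>)) \<le> \<epsilon>}"

lemma bearing_difference:
  assumes "k \<le> Kmax" "n \<in> {1..m}" "\<omega> \<in> space M"
  shows "\<alpha> k n \<omega> - \<alpha> k 1 \<omega> \<le> abar"
  using bearings[OF assms] bearings[OF assms(1) _ assms(3), of 1] scan_bearing_range[of m abar n]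
    assms m abar by (simp add: scan_bearing_def)

text \<open>The clause on all episodes up to \<open>K\<close> is supplied by
  \<open>scan_stops_within\<close> and \<open>bearing_difference\<close>; what remains is a finite
  combination of measurable events.\<close>

lemma success_eq:
  "success = (\<Union>K\<in>{..Kmax}. {\<omega> \<in> space M. reached K \<omega>} \<inter>
     (\<Union>n\<in>{1..m}. {\<omega> \<in> space M. scan_stops condA condB K n \<omega>} \<inter> {\<omega> \<in> space M. condA K n \<omega>}) \<inter>
     {\<omega> \<in> space M. norm (grad F (p K \<omega>)) \<le> \<epsilon>})"
proof (intro set_eqI iffI)
  fix \<omega> assume "\<omega> \<in> success"
  then obtain K n where "K \<le> Kmax" "\<omega> \<in> space M" "reached K \<omega>" "n \<le> m" "scan_stops condA condB K n \<omega>"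
    "condA K n \<omega>" "norm (grad F (p K \<omega>)) \<le> \<epsilon>" unfolding success_def by blast
  moreover from this have "n \<in> {1..m}" by (simp add: scan_stops_def)
  ultimately show "\<omega> \<in> (\<Union>K\<in>{..Kmax}. {\<omega> \<in> space M. reached K \<omega>} \<inter>
     (\<Union>n\<in>{1..m}. {\<omega> \<in> space M. scan_stops condA condB K n \<omega>} \<inter> {\<omega> \<in> space M. condA K n \<omega>}) \<inter>
     {\<omega> \<in> space M. norm (grad F (p K \<omega>)) \<le> \<epsilon>})"
    by blast
next
  fix \<omega> assume "\<omega> \<in> (\<Union>K\<in>{..Kmax}. {\<omega> \<in> space M. reached K \<omega>} \<inter>
     (\<Union>n\<in>{1..m}. {\<omega> \<in> space M. scan_stops condA condB K n \<omega>} \<inter> {\<omega> \<in> space M. condA K n \<omega>}) \<inter>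
     {\<omega> \<in> space M. norm (grad F (p K \<omega>)) \<le> \<epsilon>})"
  then obtain K n where K: "K \<le> Kmax" "\<omega> \<in> space M" "reached K \<omega>" "n \<in> {1..m}"
    "scan_stops condA condB K n \<omega>" "condA K n \<omega>" "norm (grad F (p K \<omega>)) \<le> \<epsilon>" by auto
  have "\<exists>n\<le>m. scan_stops condA condB k n \<omega> \<and> \<alpha> k n \<omega> - \<alpha> k 1 \<omega> \<le> abar" if "k \<le> K" for k
  proof -
    have k: "k \<le> Kmax" using that K by simp
    obtain n where "n \<in> {1..m}" "scan_stops condA condB k n \<omega>" by (rule scan_stops_within[OF k K(2)])
    then show ?thesis using bearing_difference[OF k _ K(2), of n] by (intro exI[of _ n]) simp
  qed
  moreover have "\<exists>n\<le>m. scan_stops condA condB K n \<omega> \<and> condA K n \<omega>" using K by (intro exI[of _ n]) simp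
  ultimately show "\<omega> \<in> success" unfolding success_def using K by blast
qed

text \<open>\<open>measure\<close> is 0 outside the measurable sets, so comparison with the good
  event requires this.\<close>

lemma success_measurable: "success \<in> sets M"
proof -
  have reached: "{\<omega> \<in> space M. reached K \<omega>} \<in> sets M" if "K \<le> Kmax" for K
  proof -
    have "{\<omega> \<in> space M. reached K \<omega>} = T K 1" using m by (auto simp: T_def)
    then show ?thesis using M_measurable[OF that] by simp
  qed
  have grad: "{\<omega> \<in> space M. norm (grad F (p K \<omega>)) \<le> \<epsilon>} \<in> sets M" if "K \<le> Kmax" for K
  proof -
    have "L-lipschitz_on UNIV (grad F)"
      using field_facts by (intro lipschitz_onI) (auto simp: dist_norm)
    then have "grad F \<in> borel_measurable borel"
      by (intro borel_measurable_continuous_onI lipschitz_on_continuous_on)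
    then have "(\<lambda>\<omega>. grad F (p K \<omega>)) \<in> borel_measurable M"
      by (rule measurable_compose[OF p_measurable[OF that]])
    then show ?thesis by measurable
  qed
  show ?thesis
    unfolding success_eq
    by (intro sets.finite_UN sets.Int reached grad scan_stops_measurable condition_M_measurable) auto
qed

text \<open>Union bound over the \<open>Kmax + 1\<close> episodes, each failing with probability at
  most \<open>\<delta>'\<close>. Coverage is claimed on \<open>T k n\<close> only, so nothing is
  asked of an episode that is never reached.\<close>

lemma success_probability: "1 - \<delta> \<le> measure M success"
proof -
  let ?good = "\<lambda>k B. B \<in> sets M \<and> measure M B \<le> \<delta>' \<and> (\<forall>n\<in>{1..m}. \<forall>\<omega>\<in>T k n - B.
      transpose (rot (\<theta> k \<omega>)) *v grad F (p k \<omega>) \<in> C k n \<omega>)"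
  have "\<forall>k\<in>{..Kmax}. \<exists>B. ?good k B"
  proof
    fix k assume "k \<in> {..Kmax}"
    then have "k \<le> Kmax" by simp
    then obtain B where B: "B \<in> sets M" "measure M B \<le> \<delta>'"
      and g: "\<And>n \<omega>. n \<in> {1..m} \<Longrightarrow> \<omega> \<in> space M - B \<Longrightarrow> \<omega> \<in> T k n \<Longrightarrow>
        transpose (rot (\<theta> k \<omega>)) *v grad F (p k \<omega>) \<in> C k n \<omega>"
      by (rule gradient_in_C) blast
    have "transpose (rot (\<theta> k \<omega>)) *v grad F (p k \<omega>) \<in> C k n \<omega>" if "n \<in> {1..m}" "\<omega> \<in> T k n - B" for n \<omega>
      using g[of n \<omega>] that by (simp add: T_def)
    with B show "\<exists>B. ?good k B" by blast
  qed
  from bchoice[OF this] obtain B where "\<forall>k\<in>{..Kmax}. ?good k (B k)" ..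
  then have B: "\<And>k. k \<le> Kmax \<Longrightarrow> B k \<in> sets M" "\<And>k. k \<le> Kmax \<Longrightarrow> measure M (B k) \<le> \<delta>'"
    and g: "\<And>k n \<omega>. k \<le> Kmax \<Longrightarrow> n \<in> {1..m} \<Longrightarrow> \<omega> \<in> T k n - B k \<Longrightarrow>
      transpose (rot (\<theta> k \<omega>)) *v grad F (p k \<omega>) \<in> C k n \<omega>" by simp_all
  let ?B = "\<Union>k\<in>{..Kmax}. B k"
  have Bm: "?B \<in> sets M" using B by (intro sets.finite_UN) auto
  have "measure M ?B \<le> (\<Sum>k\<in>{..Kmax}. measure M (B k))"
    using B by (intro M.finite_measure_subadditive_finite) auto
  also have "\<dots> \<le> (\<Sum>k\<in>{..Kmax}. \<delta>')" using B by (intro sum_mono) auto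
  also have "\<dots> = \<delta>" by (simp add: \<delta>'_def add.commute)
  finally have "1 - \<delta> \<le> measure M (space M - ?B)" using M.prob_compl[OF Bm] by simp
  also have "space M - ?B \<subseteq> success"
  proof
    fix \<omega> assume \<omega>: "\<omega> \<in> space M - ?B"
    then have sp: "\<omega> \<in> space M" by simp
    have g': "transpose (rot (\<theta> k \<omega>)) *v grad F (p k \<omega>) \<in> C k n \<omega>"
      if "k \<le> Kmax" "n \<in> {1..m}" "\<omega> \<in> T k n" for k n
      using g[OF that(1,2), of \<omega>] \<omega> that(1,3) by simp
    obtain K n where "K \<le> Kmax" "reached K \<omega>" "n \<in> {1..m}" "scan_stops condA condB K n \<omega>" "condA K n \<omega>"
      "norm (grad F (p K \<omega>)) \<le> \<epsilon>" by (rule terminates[OF sp g'])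
    then show "\<omega> \<in> success" unfolding success_eq using sp by blast
  qed
  then have "measure M (space M - ?B) \<le> measure M success"
    by (rule M.finite_measure_mono[OF _ success_measurable])
  finally show ?thesis .
qed

end

theorem theorem3:
  fixes M :: "'w measure"
    and F :: "real^2 \<Rightarrow> real" and p0 pstar :: "real^2"
    and G L M3 \<Delta>0 \<rho> \<sigma> lam \<epsilon> \<eta> \<delta> abar :: real
    and m Kmax :: nat
    and \<delta>k :: "nat \<Rightarrow> real"
    and p :: "nat \<Rightarrow> 'w \<Rightarrow> real^2" and \<theta> :: "nat \<Rightarrow> 'w \<Rightarrow> real"
    and \<alpha> w y :: "nat \<Rightarrow> nat \<Rightarrow> 'w \<Rightarrow> real"
    and Info :: "nat \<Rightarrow> nat \<Rightarrow> 'w measure"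
    and C :: "nat \<Rightarrow> nat \<Rightarrow> 'w \<Rightarrow> (real^2) set"
    and condA condB :: "nat \<Rightarrow> nat \<Rightarrow> 'w \<Rightarrow> bool"
  assumes prob: "prob_space M"
    and field: "field_assumption F p0 pstar G L M3 \<Delta>0"
    and pos: "0 < \<rho>" "0 \<le> \<sigma>" "0 < lam" "0 < \<epsilon>"
    and eta: "0 < \<eta>" "\<eta> < 1"
    and delta: "0 < \<delta>" "\<delta> < 1"
    and abar: "0 < abar" "abar < 2 * pi"
    and m: "5 \<le> m"
    and Kmax: "Kmax = nat \<lceil>2 * L * \<Delta>0 / (\<eta>^2 * \<epsilon>^2)\<rceil>"
    and deltak: "\<And>k. k \<le> Kmax \<Longrightarrow> \<delta>k k = \<delta> / (real Kmax + 1)"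
    and design: "\<And>k. k \<le> Kmax \<Longrightarrow>
          rho_bar \<rho> G L M3 \<sigma> lam m abar (\<delta>k k) \<le> (1 - \<eta>) * \<epsilon> / 4"
    and measurement: "\<And>k i \<omega>.
          y k i \<omega> = F (p k \<omega> + \<rho> *\<^sub>R direction (\<theta> k \<omega> + \<alpha> k i \<omega>)) + w k i \<omega>"
    and bearings: "\<And>k i \<omega>. k \<le> Kmax \<Longrightarrow> i \<in> {1..m} \<Longrightarrow> \<omega> \<in> space M \<Longrightarrow>
          \<alpha> k i \<omega> = scan_bearing m abar i"
    and conf: "\<And>k n \<omega>. C k n \<omega> =
          conf_set \<rho> lam (conf_radius \<rho> G L M3 \<sigma> lam (\<delta>k k) (\<lambda>i. \<alpha> k i \<omega>) n)
            (\<lambda>i. \<alpha> k i \<omega>) (\<lambda>i. y k i \<omega>) n"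
    and condA: "\<And>k n \<omega>. condA k n \<omega> \<longleftrightarrow> norm_max (C k n \<omega>) \<le> \<epsilon>"
    and condB: "\<And>k n \<omega>. condB k n \<omega> \<longleftrightarrow> \<eta> * norm_max (C k n \<omega>) \<le> norm_min (C k n \<omega>)"
    and info: "\<And>k i. Info k i = scan_info M (sample_taken m condA condB) \<alpha> y k i"
    and noise: "\<And>k i. k \<le> Kmax \<Longrightarrow> i \<in> {1..m} \<Longrightarrow>
          cond_subgaussian M (Info k (i - 1)) \<sigma> (w k i)"
    and bearing_meas: "\<And>k i. k \<le> Kmax \<Longrightarrow> i \<in> {1..m} \<Longrightarrow>
          \<alpha> k i \<in> borel_measurable (Info k (i - 1))"
    and pose_meas: "\<And>k. k \<le> Kmax \<Longrightarrow>
          p k \<in> borel_measurable (Info k 0) \<and> \<theta> k \<in> borel_measurable (Info k 0)"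
    and start: "\<And>\<omega>. \<omega> \<in> space M \<Longrightarrow> p 0 \<omega> = p0"
    and move: "\<And>k n \<omega>. k \<le> Kmax \<Longrightarrow> n \<le> m \<Longrightarrow> \<omega> \<in> space M \<Longrightarrow>
          episode_reached m condA condB k \<omega> \<Longrightarrow>
          scan_stops condA condB k n \<omega> \<Longrightarrow> \<not> condA k n \<omega> \<Longrightarrow>
          p (Suc k) \<omega> =
            p k \<omega> + (norm_min (C k n \<omega>) / L) *\<^sub>R (rot (\<theta> k \<omega>) *v descent_dir (C k n \<omega>)) \<and>
          direction (\<theta> (Suc k) \<omega>) = rot (\<theta> k \<omega>) *v descent_dir (C k n \<omega>)"
  shows "1 - \<delta> \<le> measure M {\<omega> \<in> space M. \<exists>K\<le>Kmax.
           episode_reached m condA condB K \<omega> \<and>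
           (\<forall>k\<le>K. \<exists>n\<le>m. scan_stops condA condB k n \<omega> \<and> \<alpha> k n \<omega> - \<alpha> k 1 \<omega> \<le> abar) \<and>
           (\<exists>n\<le>m. scan_stops condA condB K n \<omega> \<and> condA K n \<omega>) \<and>
           norm (grad F (p K \<omega>)) \<le> \<epsilon>}"
proof -
  have "partial_scan M F p0 pstar G L M3 \<Delta>0 \<rho> \<sigma> lam \<epsilon> \<eta> \<delta> abar m Kmax \<delta>k p \<theta> \<alpha> w y Info C condA condB"
    by (rule partial_scan.intro) (fact assms)+
  then interpret partial_scan M F p0 pstar G L M3 \<Delta>0 \<rho> \<sigma> lam \<epsilon> \<eta> \<delta> abar m Kmax \<delta>k p \<theta> \<alpha> w y Info C condA condB .
  show ?thesis using success_probability unfolding success_def .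
qed

end
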